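(* Let $\mathfrak O$ be a compact discrete valuation ring with residue field of size $q$. Let $\theta\colon M\to\operatorname{Hom}(V,W)$ be a module representation over $\mathfrak O$. Suppose that $M$, $V$, and $W$ are free of finite ranks $\ell$, $d$, and $e$, respectively. Then: (i) $\mathsf Z^2_\theta(T)=\mathsf Z_{\Lambda(\theta^\bullet)}(q^{d-e}T)$. (ii) $\zeta^{\mathsf{cc}}_{\mathsf H_\theta}(s)=\zeta^2_{\theta^\bullet}(s+d-e-\ell)$.
   Context: Rings are associative, commutative, and unital. Maps act on the right. $\operatorname{k}(H)$ denotes the number of conjugacy classes of a finite group $H$. Let $\mathfrak P$ be the maximal ideal of $\mathfrak O$ and $\mathfrak O_n=\mathfrak O/\mathfrak P^n$. A module representation over a ring $R$ is an $R$-module homomorphism $\theta\colon M\to\operatorname{Hom}(V,W)$, where $M,V,W$ are $R$-modules; write $x*_\theta a=x(a\theta)$. If $M,V$ are finite as sets, $\operatorname{ask}^m(\theta)=\frac1{|M|}\sum_{a\in M}|\operatorname{Ker}(a\theta)|^m$. For an $R$-algebra $A$, write $U_A=U\otimes_RA$ and let $\theta^A\colon M_A\to\operatorname{Hom}_A(V_A,W_A)$ be the induced module representation over $A$ (change of scalars). For a module representation $\theta$ over $\mathfrak O$ involving finitely generated modules, $\mathsf Z^m_\theta(T)=\sum_{n=0}^\infty\operatorname{ask}^m(\theta^{\mathfrak O_n})T^n\in\mathbf Q[[T]]$, $\mathsf Z_\theta(T)=\mathsf Z^1_\theta(T)$, and $\zeta^m_\theta(s)=\mathsf Z^m_\theta(q^{-s})$.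 Write $U^*=\operatorname{Hom}(U,R)$. The module representation $\theta^\bullet\colon W^*\to\operatorname{Hom}(V,M^* )$ is $\psi\mapsto\bigl(x\mapsto(a\mapsto(x(a\theta))\psi)\bigr)$. The alternating hull of $\theta$ is $\Lambda(\theta)\colon V\oplus M\to\operatorname{Hom}(V\oplus M,W)$ with $(x,a)*_{\Lambda(\theta)}(x',a')=x*_\theta a'-x'*_\theta a$ (where $(x',a')$ is the element of the parameterising module and $(x,a)$ the vector it is applied to). For a module representation $\theta\colon M\to\operatorname{Hom}(V,W)$ over $R$ and a commutative $R$-algebra $A$, the additive group $M_A$ acts on $V_A\oplus W_A$ via $(x,y).a=(x,\,x(a\theta^A)+y)$, and $\mathsf H_\theta(A)=M_A\ltimes(V_A\oplus W_A)$ is the associated semidirect product; $\mathsf H_\theta$ is a functor from commutative $R$-algebras to groups. For such a group functor $\mathsf G$ over $R$ (with finite class numbers at finite quotients), $\zeta^{\mathsf{cc}}_{\mathsf G}(s)=\sum_{\mathfrak a}\operatorname{k}(\mathsf G(R/\mathfrak a))\,|R/\mathfrak a|^{-s}$, where $\mathfrak a$ ranges over ideals of $R$ with $|R/\mathfrak a|<\infty$ (a formal Dirichlet series). *)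

theory Defs
  imports
    "HOL-Algebra.Algebra"
    "HOL-Analysis.Abstract_Topology"
    "HOL-Computational_Algebra.Formal_Power_Series"
begin

section \<open>Compact discrete valuation rings\<close>

definition discrete_valuation_ring :: "('a, 'x) ring_scheme \<Rightarrow> bool" where
  "discrete_valuation_ring R \<longleftrightarrow> principal_domain R \<and> \<not> field R \<and> (\<exists>!P. maximalideal P R)"

definition max_ideal :: "('a, 'x) ring_scheme \<Rightarrow> 'a set" where
  "max_ideal R = (THE P. maximalideal P R)"

definition max_ideal_power :: "('a, 'x) ring_scheme \<Rightarrow> nat \<Rightarrow> 'a set" where
  "max_ideal_power R n = max_ideal R [^]\<^bsub>ideals_set R\<^esub> n"

definition adic_topology :: "('a, 'x) ring_scheme \<Rightarrow> 'a topology" where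
  "adic_topology R =
     topology_generated_by {max_ideal_power R n +>\<^bsub>R\<^esub> x | n x. x \<in> carrier R}"

definition compact_dvr :: "('a, 'x) ring_scheme \<Rightarrow> bool" where
  "compact_dvr R \<longleftrightarrow> discrete_valuation_ring R \<and> compact_space (adic_topology R)"

definition residue_card :: "('a, 'x) ring_scheme \<Rightarrow> nat" where
  "residue_card R = card (carrier (R Quot max_ideal R))"


section \<open>Modules\<close>

text \<open>
  The record type of modules extends that of rings, so a module also has the fields
  \<open>mult\<close> and \<open>one\<close>. They carry no meaning for a module and are left undefined below.
\<close>

definition ring_as_module :: "('a, 'x) ring_scheme \<Rightarrow> ('a, 'a) module" where
  "ring_as_module R = \<lparr>carrier = carrier R, monoid.mult = undefined, monoid.one = undefined,
     ring.zero = \<zero>\<^bsub>R\<^esub>, ring.add = ring.add R, module.smult = monoid.mult R\<rparr>"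

definition direct_sum_module :: "('a, 'm) module \<Rightarrow> ('a, 'n) module \<Rightarrow> ('a, 'm \<times> 'n) module" where
  "direct_sum_module M N = \<lparr>carrier = carrier M \<times> carrier N, monoid.mult = undefined, monoid.one = undefined,
     ring.zero = (\<zero>\<^bsub>M\<^esub>, \<zero>\<^bsub>N\<^esub>),
     ring.add = (\<lambda>(x, y) (x', y'). (x \<oplus>\<^bsub>M\<^esub> x', y \<oplus>\<^bsub>N\<^esub> y')),
     module.smult = (\<lambda>r (x, y). (r \<odot>\<^bsub>M\<^esub> x, r \<odot>\<^bsub>N\<^esub> y))\<rparr>"

definition linear_maps :: "('a, 'x) ring_scheme \<Rightarrow> ('a, 'm) module \<Rightarrow> ('a, 'n) module \<Rightarrow> ('m \<Rightarrow> 'n) set" where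
  "linear_maps R M N = {f \<in> carrier M \<rightarrow> carrier N.
     (\<forall>x\<in>carrier M. \<forall>y\<in>carrier M. f (x \<oplus>\<^bsub>M\<^esub> y) = f x \<oplus>\<^bsub>N\<^esub> f y) \<and>
     (\<forall>r\<in>carrier R. \<forall>x\<in>carrier M. f (r \<odot>\<^bsub>M\<^esub> x) = r \<odot>\<^bsub>N\<^esub> f x)}"

text \<open>
  Elements of a Hom module are extensional functions, so that equality in the module is
  equality of maps on the carrier.
\<close>

definition hom_module :: "('a, 'x) ring_scheme \<Rightarrow> ('a, 'm) module \<Rightarrow> ('a, 'n) module \<Rightarrow> ('a, 'm \<Rightarrow> 'n) module" where
  "hom_module R M N = \<lparr>carrier = linear_maps R M N \<inter> extensional (carrier M),
     monoid.mult = undefined, monoid.one = undefined,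
     ring.zero = (\<lambda>x\<in>carrier M. \<zero>\<^bsub>N\<^esub>),
     ring.add = (\<lambda>f g. \<lambda>x\<in>carrier M. f x \<oplus>\<^bsub>N\<^esub> g x),
     module.smult = (\<lambda>r f. \<lambda>x\<in>carrier M. r \<odot>\<^bsub>N\<^esub> f x)\<rparr>"

definition dual_module :: "('a, 'x) ring_scheme \<Rightarrow> ('a, 'm) module \<Rightarrow> ('a, 'm \<Rightarrow> 'a) module" where
  "dual_module R M = hom_module R M (ring_as_module R)"

definition free_of_rank :: "('a, 'x) ring_scheme \<Rightarrow> ('a, 'm) module \<Rightarrow> nat \<Rightarrow> bool" where
  "free_of_rank R M n \<longleftrightarrow>
     (\<exists>b \<in> {..<n} \<rightarrow> carrier M. \<forall>x\<in>carrier M.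
        \<exists>!c. c \<in> {..<n} \<rightarrow>\<^sub>E carrier R \<and> x = (\<Oplus>\<^bsub>M\<^esub>i\<in>{..<n}. c i \<odot>\<^bsub>M\<^esub> b i))"


section \<open>Change of scalars\<close>

text \<open>
  An algebra over \<open>R\<close> is a commutative ring \<open>A\<close> together with its structure map
  \<open>\<phi> \<in> ring_hom R A\<close>. The underlying group of the tensor product of \<open>U\<close> and \<open>A\<close> over \<open>R\<close>
  is the free Abelian group on the pairs \<open>(u, b)\<close> modulo the usual relations.
\<close>

definition tensor_free :: "('a, 'm) module \<Rightarrow> ('b, 'y) ring_scheme \<Rightarrow> ('m \<times> 'b \<Rightarrow>\<^sub>0 int) monoid" where
  "tensor_free U A = free_Abelian_group (carrier U \<times> carrier A)"

definition tensor_relators ::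
  "('a, 'x) ring_scheme \<Rightarrow> ('b, 'y) ring_scheme \<Rightarrow> ('a \<Rightarrow> 'b) \<Rightarrow> ('a, 'm) module \<Rightarrow> ('m \<times> 'b \<Rightarrow>\<^sub>0 int) set" where
  "tensor_relators R A \<phi> U =
     {frag_of (u \<oplus>\<^bsub>U\<^esub> u', b) - frag_of (u, b) - frag_of (u', b) | u u' b.
        u \<in> carrier U \<and> u' \<in> carrier U \<and> b \<in> carrier A} \<union>
     {frag_of (u, b \<oplus>\<^bsub>A\<^esub> b') - frag_of (u, b) - frag_of (u, b') | u b b'.
        u \<in> carrier U \<and> b \<in> carrier A \<and> b' \<in> carrier A} \<union>
     {frag_of (r \<odot>\<^bsub>U\<^esub> u, b) - frag_of (u, \<phi> r \<otimes>\<^bsub>A\<^esub> b) | r u b.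
        r \<in> carrier R \<and> u \<in> carrier U \<and> b \<in> carrier A}"

definition tensor_rel_subgroup ::
  "('a, 'x) ring_scheme \<Rightarrow> ('b, 'y) ring_scheme \<Rightarrow> ('a \<Rightarrow> 'b) \<Rightarrow> ('a, 'm) module \<Rightarrow> ('m \<times> 'b \<Rightarrow>\<^sub>0 int) set" where
  "tensor_rel_subgroup R A \<phi> U = generate (tensor_free U A) (tensor_relators R A \<phi> U)"

definition tensor_class ::
  "('a, 'x) ring_scheme \<Rightarrow> ('b, 'y) ring_scheme \<Rightarrow> ('a \<Rightarrow> 'b) \<Rightarrow> ('a, 'm) module \<Rightarrow>
   ('m \<times> 'b \<Rightarrow>\<^sub>0 int) \<Rightarrow> ('m \<times> 'b \<Rightarrow>\<^sub>0 int) set" where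
  "tensor_class R A \<phi> U f = tensor_rel_subgroup R A \<phi> U #>\<^bsub>tensor_free U A\<^esub> f"

text \<open>
  Scalars act by \<open>a \<odot> (u \<otimes> b) = u \<otimes> (a b)\<close>. Operations on classes are given, as in
  \<^const>\<open>rcoset_mult\<close>, by the union over all representatives.
\<close>

definition extend_module ::
  "('a, 'x) ring_scheme \<Rightarrow> ('b, 'y) ring_scheme \<Rightarrow> ('a \<Rightarrow> 'b) \<Rightarrow> ('a, 'm) module \<Rightarrow>
   ('b, ('m \<times> 'b \<Rightarrow>\<^sub>0 int) set) module" where
  "extend_module R A \<phi> U =
    (let T = tensor_free U A Mod tensor_rel_subgroup R A \<phi> U in
     \<lparr>carrier = carrier T, monoid.mult = undefined, monoid.one = undefined,
      ring.zero = monoid.one T, ring.add = monoid.mult T,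
      module.smult = (\<lambda>a \<xi>. \<Union>f\<in>\<xi>. tensor_class R A \<phi> U
                 (frag_extend (\<lambda>(u, b). frag_of (u, a \<otimes>\<^bsub>A\<^esub> b)) f))\<rparr>)"


section \<open>Module representations\<close>

text \<open>
  A module representation from \<open>M\<close> to \<open>Hom(V, W)\<close>: \<open>rep_par\<close> is \<open>M\<close>, \<open>rep_dom\<close> is \<open>V\<close>,
  \<open>rep_cod\<close> is \<open>W\<close>, and \<open>rep_map \<theta> a x\<close> is the image of \<open>x\<close> under the homomorphism attached
  to \<open>a\<close> (written with maps on the right: \<open>x (a \<theta>)\<close>).
\<close>

record ('a, 'm, 'v, 'w) module_rep =
  rep_par :: "('a, 'm) module"
  rep_dom :: "('a, 'v) module"
  rep_cod :: "('a, 'w) module"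
  rep_map :: "'m \<Rightarrow> 'v \<Rightarrow> 'w"

definition is_module_rep :: "('a, 'x) ring_scheme \<Rightarrow> ('a, 'm, 'v, 'w) module_rep \<Rightarrow> bool" where
  "is_module_rep R \<theta> \<longleftrightarrow>
     Module.module R (rep_par \<theta>) \<and> Module.module R (rep_dom \<theta>) \<and> Module.module R (rep_cod \<theta>) \<and>
     rep_map \<theta> \<in> linear_maps R (rep_par \<theta>) (hom_module R (rep_dom \<theta>) (rep_cod \<theta>))"

text \<open>The map is \<open>(a \<otimes> \<alpha>, x \<otimes> \<beta>) \<mapsto> x (a \<theta>) \<otimes> (\<alpha> \<beta>)\<close>, extended biadditively.\<close>

definition extend_rep ::
  "('a, 'x) ring_scheme \<Rightarrow> ('b, 'y) ring_scheme \<Rightarrow> ('a \<Rightarrow> 'b) \<Rightarrow> ('a, 'm, 'v, 'w) module_rep \<Rightarrow>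
   ('b, ('m \<times> 'b \<Rightarrow>\<^sub>0 int) set, ('v \<times> 'b \<Rightarrow>\<^sub>0 int) set, ('w \<times> 'b \<Rightarrow>\<^sub>0 int) set) module_rep" where
  "extend_rep R A \<phi> \<theta> =
     \<lparr>rep_par = extend_module R A \<phi> (rep_par \<theta>),
      rep_dom = extend_module R A \<phi> (rep_dom \<theta>),
      rep_cod = extend_module R A \<phi> (rep_cod \<theta>),
      rep_map = (\<lambda>\<mu>\<in>carrier (extend_module R A \<phi> (rep_par \<theta>)).
                 \<lambda>\<xi>\<in>carrier (extend_module R A \<phi> (rep_dom \<theta>)).
        \<Union>g\<in>\<mu>. \<Union>f\<in>\<xi>. tensor_class R A \<phi> (rep_cod \<theta>)
          (frag_extend (\<lambda>(a, \<alpha>).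
             frag_extend (\<lambda>(x, \<beta>). frag_of (rep_map \<theta> a x, \<alpha> \<otimes>\<^bsub>A\<^esub> \<beta>)) f) g))\<rparr>"

definition quot_rep ::
  "('a, 'x) ring_scheme \<Rightarrow> 'a set \<Rightarrow> ('a, 'm, 'v, 'w) module_rep \<Rightarrow>
   ('a set, ('m \<times> 'a set \<Rightarrow>\<^sub>0 int) set, ('v \<times> 'a set \<Rightarrow>\<^sub>0 int) set, ('w \<times> 'a set \<Rightarrow>\<^sub>0 int) set) module_rep" where
  "quot_rep R I \<theta> = extend_rep R (R Quot I) (\<lambda>r. I +>\<^bsub>R\<^esub> r) \<theta>"

definition bullet_rep ::
  "('a, 'x) ring_scheme \<Rightarrow> ('a, 'm, 'v, 'w) module_rep \<Rightarrow> ('a, 'w \<Rightarrow> 'a, 'v, 'm \<Rightarrow> 'a) module_rep" where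
  "bullet_rep R \<theta> =
     \<lparr>rep_par = dual_module R (rep_cod \<theta>),
      rep_dom = rep_dom \<theta>,
      rep_cod = dual_module R (rep_par \<theta>),
      rep_map = (\<lambda>\<psi>\<in>carrier (dual_module R (rep_cod \<theta>)).
        \<lambda>x\<in>carrier (rep_dom \<theta>). \<lambda>a\<in>carrier (rep_par \<theta>). \<psi> (rep_map \<theta> a x))\<rparr>"

definition alternating_hull ::
  "('a, 'm, 'v, 'w) module_rep \<Rightarrow> ('a, 'v \<times> 'm, 'v \<times> 'm, 'w) module_rep" where
  "alternating_hull \<theta> =
    (let S = direct_sum_module (rep_dom \<theta>) (rep_par \<theta>) in
     \<lparr>rep_par = S, rep_dom = S, rep_cod = rep_cod \<theta>,
      rep_map = (\<lambda>(x', a')\<in>carrier S. \<lambda>(x, a)\<in>carrier S.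
        rep_map \<theta> a' x \<ominus>\<^bsub>rep_cod \<theta>\<^esub> rep_map \<theta> a x')\<rparr>)"

definition ask :: "nat \<Rightarrow> ('a, 'm, 'v, 'w) module_rep \<Rightarrow> rat" where
  "ask m \<theta> = (\<Sum>a\<in>carrier (rep_par \<theta>).
       of_nat (card {x \<in> carrier (rep_dom \<theta>). rep_map \<theta> a x = \<zero>\<^bsub>rep_cod \<theta>\<^esub>}) ^ m)
     / of_nat (card (carrier (rep_par \<theta>)))"

definition ask_series :: "('a, 'x) ring_scheme \<Rightarrow> nat \<Rightarrow> ('a, 'm, 'v, 'w) module_rep \<Rightarrow> rat fps" where
  "ask_series R m \<theta> = Abs_fps (\<lambda>n. ask m (quot_rep R (max_ideal_power R n) \<theta>))"


section \<open>The group functor of a module representation\<close>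

definition semidirect_product ::
  "('g, 'x) monoid_scheme \<Rightarrow> ('n, 'y) monoid_scheme \<Rightarrow> ('n \<Rightarrow> 'g \<Rightarrow> 'n) \<Rightarrow> ('g \<times> 'n) monoid" where
  "semidirect_product G N act =
     \<lparr>carrier = carrier G \<times> carrier N,
      monoid.mult = (\<lambda>(g, n) (g', n'). (g \<otimes>\<^bsub>G\<^esub> g', act n g' \<otimes>\<^bsub>N\<^esub> n')),
      monoid.one = (\<one>\<^bsub>G\<^esub>, \<one>\<^bsub>N\<^esub>)\<rparr>"

definition rep_group :: "('a, 'm, 'v, 'w) module_rep \<Rightarrow> ('m \<times> 'v \<times> 'w) monoid" where
  "rep_group \<theta> =
     semidirect_product (add_monoid (rep_par \<theta>))
       (add_monoid (direct_sum_module (rep_dom \<theta>) (rep_cod \<theta>)))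
       (\<lambda>(x, y) a. (x, rep_map \<theta> a x \<oplus>\<^bsub>rep_cod \<theta>\<^esub> y))"

definition rep_group_functor ::
  "('a, 'x) ring_scheme \<Rightarrow> ('a, 'm, 'v, 'w) module_rep \<Rightarrow> ('b, 'y) ring_scheme \<Rightarrow> ('a \<Rightarrow> 'b) \<Rightarrow>
   (('m \<times> 'b \<Rightarrow>\<^sub>0 int) set \<times> ('v \<times> 'b \<Rightarrow>\<^sub>0 int) set \<times> ('w \<times> 'b \<Rightarrow>\<^sub>0 int) set) monoid" where
  "rep_group_functor R \<theta> A \<phi> = rep_group (extend_rep R A \<phi> \<theta>)"

definition class_number :: "('g, 'x) monoid_scheme \<Rightarrow> nat" where
  "class_number G =
     card (orbits G (carrier G) (\<lambda>g. \<lambda>h\<in>carrier G. g \<otimes>\<^bsub>G\<^esub> h \<otimes>\<^bsub>G\<^esub> inv\<^bsub>G\<^esub> g))"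


section \<open>Formal Dirichlet series\<close>

text \<open>
  A function \<open>c\<close> with \<open>c 0 = 0\<close> stands for the formal Dirichlet series with coefficient
  \<open>c N\<close> at \<open>N\<^sup>-\<^sup>s\<close>.
\<close>

type_synonym dirichlet = "nat \<Rightarrow> rat"

text \<open>Substitution of \<open>s + k\<close> for \<open>s\<close>: \<open>N\<^sup>-\<^sup>(\<^sup>s\<^sup>+\<^sup>k\<^sup>) = N\<^sup>-\<^sup>k N\<^sup>-\<^sup>s\<close>.\<close>

definition dirichlet_shift :: "int \<Rightarrow> dirichlet \<Rightarrow> dirichlet" where
  "dirichlet_shift k c = (\<lambda>N. c N * of_nat N powi (- k))"

text \<open>Substitution of \<open>q\<^sup>-\<^sup>s\<close>, where \<open>q \<ge> 2\<close>, for the variable of a formal power series.\<close>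

definition dirichlet_of_fps :: "nat \<Rightarrow> rat fps \<Rightarrow> dirichlet" where
  "dirichlet_of_fps q F = (\<lambda>N. \<Sum>n | q ^ n = N. fps_nth F n)"

definition ask_zeta :: "('a, 'x) ring_scheme \<Rightarrow> nat \<Rightarrow> ('a, 'm, 'v, 'w) module_rep \<Rightarrow> dirichlet" where
  "ask_zeta R m \<theta> = dirichlet_of_fps (residue_card R) (ask_series R m \<theta>)"

definition class_zeta ::
  "('a, 'x) ring_scheme \<Rightarrow> ('a set ring \<Rightarrow> ('a \<Rightarrow> 'a set) \<Rightarrow> 'g monoid) \<Rightarrow> dirichlet" where
  "class_zeta R G = (\<lambda>N. \<Sum>I | ideal I R \<and> finite (carrier (R Quot I)) \<and> card (carrier (R Quot I)) = N.
     of_nat (class_number (G (R Quot I) (\<lambda>r. I +>\<^bsub>R\<^esub> r))))"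

end

theory Submission
  imports Defs
begin

text \<open>
  Both identities come from counting the solutions of one system of equations over the finite
  rings \<open>A = O/P\<^sup>n\<close> in two ways. After a choice of bases, \<open>\<theta>\<close> is an array \<open>t i j k\<close>: over \<open>A\<close>,
  the vector \<open>x * a\<close> has the coordinates \<open>\<Sum>i j. t i j k a\<^sub>i x\<^sub>j\<close>. Passing to \<open>\<theta>\<^sup>\<bullet>\<close> exchanges the
  first and the third index. So \<open>\<theta>\<close> and \<open>\<theta>\<^sup>\<bullet>\<close> are two ways of reading the trilinear form
  \<open>\<langle>a, x, y\<rangle> = \<Sum>i j k. t i j k a\<^sub>i x\<^sub>j y\<^sub>k\<close>.

  For the double count one usually sums an additive character of \<open>A\<close> that is nontrivial on
  every nonzero ideal. Less is enough: a rational-valued function \<open>w\<close> on \<open>A\<close> whose sum over an ideal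
  is \<open>1\<close> for the zero ideal and \<open>0\<close> for every other one (\<open>ideal_detector\<close>). It exists because
  the nonzero ideals of \<open>A\<close>, if there are any, have a least member. If an additive map \<open>f\<close> from a finite abelian
  group to \<open>A\<close> has an ideal as its image, then its fibres over the image have equal size, so the
  sum of \<open>w (f g)\<close> over the group is the order of the group if \<open>f = 0\<close> and \<open>0\<close> otherwise
  (\<open>ideal_detector_orthogonality\<close>).

  Now sum \<open>w (\<langle>a, x, y'\<rangle> - \<langle>a, x', y\<rangle>)\<close> over all \<open>a, x, x', y, y'\<close>. Summing over \<open>y, y'\<close> first
  leaves the triples in which \<open>x\<close> and \<open>x'\<close> lie in the kernel of \<open>a\<close>, that is, the second
  moment of the kernel sizes of \<open>\<theta>\<close>. Summing over \<open>a\<close> first leaves the quadruples with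
  \<open>x * y' = x' * y\<close> for \<open>\<theta>\<^sup>\<bullet>\<close>, that is, the first moment for the alternating hull of \<open>\<theta>\<^sup>\<bullet>\<close>.
  Up to powers of \<open>|A|\<close> this is \<open>kernel_square_count\<close>, and together with \<open>|A| = q\<^sup>n\<close> it gives the first identity.

  For the second one, the class number of a finite group times its order is the number of
  commuting pairs. Elements \<open>(a, x, y)\<close> and \<open>(a', x', y')\<close> of the group attached to \<open>\<theta>\<close> commute
  if and only if \<open>x * a' = x' * a\<close>. The number of such quadruples is the right-hand side of the
  same double count for the transposed array, whose left-hand side is the second moment for
  \<open>\<theta>\<^sup>\<bullet>\<close> (\<open>class_number_eq_ask_square\<close>). Finally the ideals of finite index in \<open>O\<close> are the powers
  of \<open>P\<close>, which turns the sum over ideals into the substitution of \<open>q\<^sup>-\<^sup>s\<close>.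

  Most of the remaining work identifies the extended modules, which are quotients of free
  abelian groups, with \<open>A\<^sup>J\<close>: a basis of \<open>U\<close> gives coordinates on \<open>U \<otimes> A\<close> (\<open>vcoord_bij\<close>), and in these
  coordinates an extended representation is the evident bilinear map (\<open>extend_rep_map\<close>).
\<close>

section \<open>Detecting the zero ideal of a finite ring\<close>

text \<open>
  Such a function replaces an additive character that is nontrivial on every nonzero ideal.
  It need not turn sums into products as a character does, so every use of it has to go
  through a single additive map into the ring.
\<close>

definition ideal_detector :: "('b, 'y) ring_scheme \<Rightarrow> ('b \<Rightarrow> rat) \<Rightarrow> bool" where
  "ideal_detector A w \<longleftrightarrow>
     (\<forall>I. ideal I A \<longrightarrow> (\<Sum>a\<in>I. w a) = (if I = {\<zero>\<^bsub>A\<^esub>} then 1 else 0))"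

text \<open>
  The hypothesis says that the multiples of \<open>s\<close> form the least nonzero ideal (or that the
  ring is zero). A function that is \<open>1\<close> at zero, constant on the rest of this ideal with total
  \<open>-1\<close> there, and \<open>0\<close> elsewhere then cancels over every nonzero ideal.
\<close>

lemma (in cring) ideal_detector_exists:
  assumes fin: "finite (carrier R)"
    and s: "s \<in> carrier R"
    and least: "\<And>x. x \<in> carrier R \<Longrightarrow> x \<noteq> \<zero> \<Longrightarrow> s \<noteq> \<zero> \<and> (\<exists>c\<in>carrier R. s = c \<otimes> x)"
  shows "\<exists>w. ideal_detector R w"
proof -
  define S where "S = PIdl s"
  have S: "ideal S R" unfolding S_def using s by (rule cgenideal_ideal)
  have S_sub: "S \<subseteq> carrier R" using S by (meson additive_subgroup.a_subset ideal.axioms(1))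
  have S0: "\<zero> \<in> S" using S by (meson additive_subgroup.zero_closed ideal.axioms(1))
  have finS: "finite S" using S_sub fin finite_subset by blast
  define w :: "'a \<Rightarrow> rat" where
    "w x = (if x = \<zero> then 1 else if x \<in> S then - 1 / of_nat (card S - 1) else 0)" for x
  have "(\<Sum>a\<in>I. w a) = (if I = {\<zero>} then 1 else 0)" if I: "ideal I R" for I
  proof (cases "I = {\<zero>}")
    case True
    then show ?thesis by (simp add: w_def)
  next
    case False
    have I0: "\<zero> \<in> I" using I by (meson additive_subgroup.zero_closed ideal.axioms(1))
    with False obtain x where x: "x \<in> I" "x \<noteq> \<zero>" by blast
    have I_sub: "I \<subseteq> carrier R" using I by (meson additive_subgroup.a_subset ideal.axioms(1))
    obtain c where c: "c \<in> carrier R" "s = c \<otimes> x" and "s \<noteq> \<zero>" using least x I_sub by blast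
    have "s \<in> I" using ideal.I_l_closed[OF I x(1) c(1)] c(2) by simp
    then have SI: "S \<subseteq> I" unfolding S_def by (rule cgenideal_minimal[OF I])
    have "s \<in> S" unfolding S_def using s by (rule cgenideal_self)
    then have "{\<zero>, s} \<subseteq> S" using S0 by simp
    then have "card {\<zero>, s} \<le> card S" by (rule card_mono[OF finS])
    then have c2: "card S \<ge> 2" using \<open>s \<noteq> \<zero>\<close> by simp
    have finI: "finite I" using I_sub fin finite_subset by blast
    have "(\<Sum>a\<in>I. w a) = (\<Sum>a\<in>S. w a)"
      by (rule sum.mono_neutral_right[OF finI SI]) (auto simp: w_def S0)
    also have "\<dots> = w \<zero> + (\<Sum>a\<in>S - {\<zero>}. w a)" by (rule sum.remove[OF finS S0])
    also have "(\<Sum>a\<in>S - {\<zero>}. w a) = (\<Sum>a\<in>S - {\<zero>}. - 1 / of_nat (card S - 1))"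
      by (rule sum.cong) (auto simp: w_def)
    also have "\<dots> = -1" using c2 S0 finS by simp
    finally show ?thesis using False by (simp add: w_def)
  qed
  then show ?thesis unfolding ideal_detector_def by blast
qed

lemma sum_over_kernel_fibres:
  fixes w :: "'b \<Rightarrow> rat"
  assumes "group_hom G H f" and fin: "finite (carrier G)"
  shows "(\<Sum>x\<in>carrier G. w (f x)) = of_nat (card (kernel G H f)) * (\<Sum>y\<in>f ` carrier G. w y)"
proof -
  interpret group_hom G H f by fact
  have fibre: "card {x \<in> carrier G. f x = y} = card (kernel G H f)" if "y \<in> f ` carrier G" for y
  proof -
    from that obtain z where z: "z \<in> carrier G" "y = f z" by blast
    have "bij_betw (\<lambda>k. k \<otimes>\<^bsub>G\<^esub> z) (kernel G H f) {x \<in> carrier G. f x = y}"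
    proof (rule bij_betw_byWitness[where f' = "\<lambda>x. x \<otimes>\<^bsub>G\<^esub> inv\<^bsub>G\<^esub> z"])
      show "\<forall>a\<in>kernel G H f. a \<otimes>\<^bsub>G\<^esub> z \<otimes>\<^bsub>G\<^esub> inv\<^bsub>G\<^esub> z = a"
        using z by (auto simp: kernel_def G.m_assoc)
      show "\<forall>a'\<in>{x \<in> carrier G. f x = y}. a' \<otimes>\<^bsub>G\<^esub> inv\<^bsub>G\<^esub> z \<otimes>\<^bsub>G\<^esub> z = a'"
        using z by (auto simp: G.m_assoc)
    qed (use z in \<open>auto simp: kernel_def\<close>)
    then show ?thesis by (simp add: bij_betw_same_card)
  qed
  have "(\<Sum>x\<in>carrier G. w (f x)) = (\<Sum>y\<in>f ` carrier G. \<Sum>x | x \<in> carrier G \<and> f x = y. w (f x))"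
    by (rule sum.image_gen[OF fin])
  also have "\<dots> = (\<Sum>y\<in>f ` carrier G. of_nat (card (kernel G H f)) * w y)"
    by (rule sum.cong[OF refl]) (simp add: fibre)
  finally show ?thesis by (simp add: sum_distrib_left)
qed

text \<open>
  Closure of the image under multiplication makes it an ideal, and all fibres over it have
  the size of the kernel.
\<close>

lemma (in cring) ideal_detector_orthogonality:
  assumes w: "ideal_detector R w"
    and G: "comm_group G" and fin: "finite (carrier G)"
    and f: "f \<in> hom G (add_monoid R)"
    and scale: "\<And>r x. r \<in> carrier R \<Longrightarrow> x \<in> carrier G \<Longrightarrow> \<exists>y\<in>carrier G. f y = r \<otimes> f x"
  shows "(\<Sum>x\<in>carrier G. w (f x)) = (if \<forall>x\<in>carrier G. f x = \<zero> then of_nat (card (carrier G)) else 0)"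
proof -
  interpret G: comm_group G by fact
  interpret h: group_hom G "add_monoid R" f
    by unfold_locales (rule f)
  have I: "ideal (f ` carrier G) R"
  proof (rule idealI)
    show "ring R" by (rule ring_axioms)
    show "subgroup (f ` carrier G) (add_monoid R)" by (rule h.img_is_subgroup)
    fix a x assume a: "a \<in> f ` carrier G" and x: "x \<in> carrier R"
    then have ac: "a \<in> carrier R" using h.hom_closed by auto
    show *: "x \<otimes> a \<in> f ` carrier G" using a scale[OF x] by (auto simp: image_iff) metis
    show "a \<otimes> x \<in> f ` carrier G" using * by (simp add: m_comm ac x)
  qed
  show ?thesis
  proof (cases "\<forall>x\<in>carrier G. f x = \<zero>")
    case True
    then have "(\<Sum>x\<in>carrier G. w (f x)) = (\<Sum>x\<in>carrier G. w \<zero>)" by simp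
    moreover have "w \<zero> = 1" using w zeroideal unfolding ideal_detector_def by (elim allE[of _ "{\<zero>}"]) simp
    ultimately show ?thesis using True by simp
  next
    case False
    then have "f ` carrier G \<noteq> {\<zero>}" by blast
    then have "(\<Sum>y\<in>f ` carrier G. w y) = 0" using w I unfolding ideal_detector_def by simp
    then show ?thesis using sum_over_kernel_fibres[OF h.group_hom_axioms fin, of w] unfolding if_not_P[OF False] by simp
  qed
qed

section \<open>Dot products and contractions\<close>

lemma (in comm_monoid) finprod_swap:
  assumes "finite B" "\<And>x y. x \<in> A \<Longrightarrow> y \<in> B \<Longrightarrow> f x y \<in> carrier G"
  shows "(\<Otimes>x\<in>A. \<Otimes>y\<in>B. f x y) = (\<Otimes>y\<in>B. \<Otimes>x\<in>A. f x y)"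
  using assms
proof (induction B rule: finite_induct)
  case (insert b B)
  have "(\<Otimes>x\<in>A. \<Otimes>y\<in>insert b B. f x y) = (\<Otimes>x\<in>A. f x b \<otimes> (\<Otimes>y\<in>B. f x y))"
    by (rule finprod_cong') (use insert in \<open>auto intro!: finprod_closed\<close>)
  also have "\<dots> = (\<Otimes>x\<in>A. f x b) \<otimes> (\<Otimes>x\<in>A. \<Otimes>y\<in>B. f x y)"
    by (rule finprod_multf) (use insert in \<open>auto intro!: finprod_closed\<close>)
  also have "\<dots> = (\<Otimes>x\<in>A. f x b) \<otimes> (\<Otimes>y\<in>B. \<Otimes>x\<in>A. f x y)"
    using insert by simp
  also have "\<dots> = (\<Otimes>y\<in>insert b B. \<Otimes>x\<in>A. f x y)"
    by (rule finprod_insert[symmetric]) (use insert in \<open>auto intro!: finprod_closed\<close>)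
  finally show ?case .
qed simp

context abelian_monoid begin
lemmas finsum_swap = add.finprod_swap
end

definition vectors :: "'i set \<Rightarrow> ('b, 'y) ring_scheme \<Rightarrow> ('i \<Rightarrow> 'b) set" where
  "vectors I A = I \<rightarrow>\<^sub>E carrier A"

definition dot :: "('b, 'y) ring_scheme \<Rightarrow> 'i set \<Rightarrow> ('i \<Rightarrow> 'b) \<Rightarrow> ('i \<Rightarrow> 'b) \<Rightarrow> 'b" where
  "dot A I u v = (\<Oplus>\<^bsub>A\<^esub>i\<in>I. u i \<otimes>\<^bsub>A\<^esub> v i)"

text \<open>
  For \<open>t\<close> an array of structure constants, this is the \<open>k\<close>-th coordinate of the image of the
  vector \<open>x\<close> under the map attached to the parameter \<open>a\<close>.
\<close>

definition contract ::
  "('b, 'y) ring_scheme \<Rightarrow> 'i set \<Rightarrow> 'j set \<Rightarrow> ('i \<Rightarrow> 'j \<Rightarrow> 'k \<Rightarrow> 'b) \<Rightarrow> ('i \<Rightarrow> 'b) \<Rightarrow> ('j \<Rightarrow> 'b) \<Rightarrow> 'k \<Rightarrow> 'b" where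
  "contract A I J t a x k = dot A I a (\<lambda>i. dot A J x (\<lambda>j. t i j k))"

text \<open>
  Exchanging the first and the third index passes from the structure constants of a
  representation to those of its bullet.
\<close>

definition transpose13 :: "('i \<Rightarrow> 'j \<Rightarrow> 'k \<Rightarrow> 'b) \<Rightarrow> 'k \<Rightarrow> 'j \<Rightarrow> 'i \<Rightarrow> 'b" where
  "transpose13 t = (\<lambda>k j i. t i j k)"

lemma vectors_mem: "v \<in> vectors I A \<Longrightarrow> i \<in> I \<Longrightarrow> v i \<in> carrier A"
  by (auto simp: vectors_def)

lemma finite_vectors: "finite I \<Longrightarrow> finite (carrier A) \<Longrightarrow> finite (vectors I A)"
  by (simp add: vectors_def finite_PiE)

lemma card_vectors: "finite I \<Longrightarrow> card (vectors I A) = card (carrier A) ^ card I"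
  by (simp add: vectors_def card_PiE)

context cring begin

lemma dot_closed [simp, intro]:
  "u \<in> I \<rightarrow> carrier R \<Longrightarrow> v \<in> I \<rightarrow> carrier R \<Longrightarrow> dot R I u v \<in> carrier R"
  unfolding dot_def by (rule finsum_closed) auto

lemma dot_cong:
  assumes "\<And>i. i \<in> I \<Longrightarrow> u i = u' i" "\<And>i. i \<in> I \<Longrightarrow> v i = v' i"
    "u' \<in> I \<rightarrow> carrier R" "v' \<in> I \<rightarrow> carrier R"
  shows "dot R I u v = dot R I u' v'"
  unfolding dot_def by (rule finsum_cong') (use assms in auto)

lemma dot_commute:
  "u \<in> I \<rightarrow> carrier R \<Longrightarrow> v \<in> I \<rightarrow> carrier R \<Longrightarrow> dot R I u v = dot R I v u"
  unfolding dot_def by (rule finsum_cong') (auto simp: m_comm Pi_iff)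

lemma dot_add_left:
  assumes "u \<in> I \<rightarrow> carrier R" "u' \<in> I \<rightarrow> carrier R" "v \<in> I \<rightarrow> carrier R"
  shows "dot R I (\<lambda>i. u i \<oplus> u' i) v = dot R I u v \<oplus> dot R I u' v"
proof -
  have "(\<Oplus>i\<in>I. (u i \<oplus> u' i) \<otimes> v i) = (\<Oplus>i\<in>I. u i \<otimes> v i \<oplus> u' i \<otimes> v i)"
    by (rule finsum_cong') (use assms in \<open>auto simp: Pi_iff l_distr\<close>)
  also have "\<dots> = (\<Oplus>i\<in>I. u i \<otimes> v i) \<oplus> (\<Oplus>i\<in>I. u' i \<otimes> v i)"
    by (rule finsum_addf) (use assms in auto)
  finally show ?thesis by (simp add: dot_def)
qed

lemma dot_scale_left:
  assumes fin: "finite I" and "r \<in> carrier R" "u \<in> I \<rightarrow> carrier R" "v \<in> I \<rightarrow> carrier R"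
  shows "dot R I (\<lambda>i. r \<otimes> u i) v = r \<otimes> dot R I u v"
proof -
  have "dot R I (\<lambda>i. r \<otimes> u i) v = (\<Oplus>i\<in>I. r \<otimes> (u i \<otimes> v i))"
    unfolding dot_def by (rule finsum_cong') (use assms in \<open>auto simp: Pi_iff m_assoc\<close>)
  also have "\<dots> = r \<otimes> dot R I u v"
    unfolding dot_def by (rule finsum_rdistr[symmetric]) (use assms in auto)
  finally show ?thesis .
qed

lemma dot_scale_right:
  assumes "finite I" "r \<in> carrier R" "u \<in> I \<rightarrow> carrier R" "v \<in> I \<rightarrow> carrier R"
  shows "dot R I u (\<lambda>i. r \<otimes> v i) = r \<otimes> dot R I u v"
  proof -
  have "dot R I u (\<lambda>i. r \<otimes> v i) = dot R I (\<lambda>i. r \<otimes> v i) u"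
    by (rule dot_commute) (use assms in auto)
  then show ?thesis using dot_scale_left[OF assms(1,2,4,3)] dot_commute[of u I v] assms by simp
qed

lemma a_minus_eq_scale: "x \<in> carrier R \<Longrightarrow> y \<in> carrier R \<Longrightarrow> x \<ominus> y = x \<oplus> (\<ominus> \<one>) \<otimes> y"
  by (simp add: a_minus_def l_minus)

lemma dot_diff_left:
  assumes "finite I" "u \<in> I \<rightarrow> carrier R" "u' \<in> I \<rightarrow> carrier R" "v \<in> I \<rightarrow> carrier R"
  shows "dot R I (\<lambda>i. u i \<ominus> u' i) v = dot R I u v \<ominus> dot R I u' v"
proof -
  have "dot R I (\<lambda>i. u i \<ominus> u' i) v = dot R I (\<lambda>i. u i \<oplus> (\<ominus> \<one>) \<otimes> u' i) v"
    by (rule dot_cong) (use assms in \<open>auto simp: a_minus_eq_scale Pi_iff\<close>)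
  also have "\<dots> = dot R I u v \<oplus> (\<ominus> \<one>) \<otimes> dot R I u' v"
    using assms by (subst dot_add_left) (auto simp: dot_scale_left)
  finally show ?thesis using assms by (simp add: a_minus_eq_scale)
qed

lemma dot_diff_right:
  assumes "finite I" "u \<in> I \<rightarrow> carrier R" "v \<in> I \<rightarrow> carrier R" "v' \<in> I \<rightarrow> carrier R"
  shows "dot R I u (\<lambda>i. v i \<ominus> v' i) = dot R I u v \<ominus> dot R I u v'"
  proof -
  have "dot R I u (\<lambda>i. v i \<ominus> v' i) = dot R I (\<lambda>i. v i \<ominus> v' i) u"
    by (rule dot_commute) (use assms in auto)
  then show ?thesis using dot_diff_left[OF assms(1,3,4,2)] dot_commute[of u I v] dot_commute[of u I v'] assms by simp
qed

lemma dot_zero_right: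
  assumes "u \<in> I \<rightarrow> carrier R" "\<And>i. i \<in> I \<Longrightarrow> v i = \<zero>"
  shows "dot R I u v = \<zero>"
proof -
  have "dot R I u v = (\<Oplus>i\<in>I. \<zero>)"
    unfolding dot_def by (rule finsum_cong') (use assms in \<open>auto simp: Pi_iff\<close>)
  then show ?thesis by simp
qed

lemma dot_unit:
  assumes "finite I" "k \<in> I" "v \<in> I \<rightarrow> carrier R"
  shows "dot R I (\<lambda>i. if i = k then \<one> else \<zero>) v = v k"
proof -
  have "dot R I (\<lambda>i. if i = k then \<one> else \<zero>) v = (\<Oplus>i\<in>I. if i = k then v i else \<zero>)"
    unfolding dot_def by (rule finsum_cong') (use assms in \<open>auto simp: Pi_iff\<close>)
  also have "\<dots> = v k" using finsum_singleton[of k I v] assms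
    by (simp add: eq_commute[of _ k])
  finally show ?thesis .
qed

lemma dot_swap:
  assumes "finite I" "finite J" "u \<in> I \<rightarrow> carrier R" "v \<in> J \<rightarrow> carrier R"
    and s: "\<And>i j. i \<in> I \<Longrightarrow> j \<in> J \<Longrightarrow> s i j \<in> carrier R"
  shows "dot R I u (\<lambda>i. dot R J v (\<lambda>j. s i j)) = dot R J v (\<lambda>j. dot R I u (\<lambda>i. s i j))"
proof -
  have "dot R I u (\<lambda>i. dot R J v (\<lambda>j. s i j)) = (\<Oplus>i\<in>I. \<Oplus>j\<in>J. u i \<otimes> (v j \<otimes> s i j))"
    unfolding dot_def
    by (rule finsum_cong') (use assms in \<open>auto simp: Pi_iff intro!: finsum_rdistr finsum_closed\<close>)
  also have "\<dots> = (\<Oplus>j\<in>J. \<Oplus>i\<in>I. u i \<otimes> (v j \<otimes> s i j))"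
    by (rule finsum_swap) (use assms in \<open>auto simp: Pi_iff\<close>)
  also have "\<dots> = (\<Oplus>j\<in>J. \<Oplus>i\<in>I. v j \<otimes> (u i \<otimes> s i j))"
    by (rule finsum_cong'; (rule finsum_cong')?)
      (use assms in \<open>auto simp: Pi_iff m_lcomm intro!: finsum_closed\<close>)
  also have "\<dots> = dot R J v (\<lambda>j. dot R I u (\<lambda>i. s i j))"
    unfolding dot_def
    by (rule finsum_cong') (use assms in \<open>auto simp: Pi_iff intro!: finsum_rdistr[symmetric] finsum_closed\<close>)
  finally show ?thesis .
qed

end

context cring begin

lemma contract_closed:
  assumes "a \<in> I \<rightarrow> carrier R" "x \<in> J \<rightarrow> carrier R"
    and "\<And>i j. i \<in> I \<Longrightarrow> j \<in> J \<Longrightarrow> t i j k \<in> carrier R"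
  shows "contract R I J t a x k \<in> carrier R"
  unfolding contract_def using assms by (auto intro!: dot_closed)

lemma contract_diff_left:
  assumes "finite I" "a \<in> I \<rightarrow> carrier R" "a' \<in> I \<rightarrow> carrier R" "x \<in> J \<rightarrow> carrier R"
    and "\<And>i j. i \<in> I \<Longrightarrow> j \<in> J \<Longrightarrow> t i j k \<in> carrier R"
  shows "contract R I J t (\<lambda>i. a i \<ominus> a' i) x k = contract R I J t a x k \<ominus> contract R I J t a' x k"
  unfolding contract_def using assms by (intro dot_diff_left) auto

lemma contract_diff_right:
  assumes "finite I" "finite J" "a \<in> I \<rightarrow> carrier R" "x \<in> J \<rightarrow> carrier R" "x' \<in> J \<rightarrow> carrier R"
    and t: "\<And>i j. i \<in> I \<Longrightarrow> j \<in> J \<Longrightarrow> t i j k \<in> carrier R"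
  shows "contract R I J t a (\<lambda>j. x j \<ominus> x' j) k = contract R I J t a x k \<ominus> contract R I J t a x' k"
proof -
  have "contract R I J t a (\<lambda>j. x j \<ominus> x' j) k
      = dot R I a (\<lambda>i. dot R J x (\<lambda>j. t i j k) \<ominus> dot R J x' (\<lambda>j. t i j k))"
    unfolding contract_def by (rule dot_cong) (use assms in \<open>auto intro!: dot_diff_left\<close>)
  also have "\<dots> = contract R I J t a x k \<ominus> contract R I J t a x' k"
    unfolding contract_def by (rule dot_diff_right) (use assms in auto)
  finally show ?thesis .
qed

lemma contract_cong:
  assumes "\<And>i. i \<in> I \<Longrightarrow> a i = a' i" "\<And>j. j \<in> J \<Longrightarrow> x j = x' j"
    "a' \<in> I \<rightarrow> carrier R" "x' \<in> J \<rightarrow> carrier R"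
    and t: "\<And>i j. i \<in> I \<Longrightarrow> j \<in> J \<Longrightarrow> t i j k \<in> carrier R"
  shows "contract R I J t a x k = contract R I J t a' x' k"
  unfolding contract_def using assms by (intro dot_cong) auto

text \<open>
  Both sides are the value of one trilinear form at \<open>a\<close>, \<open>x\<close> and \<open>y\<close>.
\<close>

lemma dot_contract:
  assumes "finite I" "finite K" "a \<in> I \<rightarrow> carrier R" "x \<in> J \<rightarrow> carrier R" "y \<in> K \<rightarrow> carrier R"
    and t: "\<And>i j k. i \<in> I \<Longrightarrow> j \<in> J \<Longrightarrow> k \<in> K \<Longrightarrow> t i j k \<in> carrier R"
  shows "dot R K y (contract R I J t a x) = dot R I a (contract R K J (transpose13 t) y x)"
  using dot_swap[OF assms(2,1,5,3), of "\<lambda>k i. dot R J x (\<lambda>j. t i j k)"] assms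
  by (simp add: contract_def[abs_def] transpose13_def)

abbreviation "vector_group K \<equiv> product_group K (\<lambda>_. add_monoid R)"

lemma carrier_vector_group: "carrier (vector_group K) = vectors K R"
  by (simp add: vectors_def)

lemma comm_group_vector_group: "comm_group (vector_group K)"
proof (rule group.group_comm_groupI)
  show "group (vector_group K)" by (rule product_group) (rule add.is_group)
  fix x y assume "x \<in> carrier (vector_group K)" "y \<in> carrier (vector_group K)"
  then show "x \<otimes>\<^bsub>vector_group K\<^esub> y = y \<otimes>\<^bsub>vector_group K\<^esub> x"
    by (auto simp: a_comm PiE_iff intro!: restrict_ext)
qed

lemma dot_restrict: "dot R K (\<lambda>i\<in>K. u i) v = dot R K u v" if "u \<in> K \<rightarrow> carrier R" "v \<in> K \<rightarrow> carrier R"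
  by (rule dot_cong) (use that in auto)

lemma dot_restrict_add:
  assumes "u \<in> K \<rightarrow> carrier R" "u' \<in> K \<rightarrow> carrier R" "v \<in> K \<rightarrow> carrier R"
  shows "dot R K (\<lambda>i\<in>K. u i \<oplus> u' i) v = dot R K u v \<oplus> dot R K u' v"
  using assms by (subst dot_restrict) (auto intro: dot_add_left)

lemma dot_restrict_scale:
  assumes "finite K" "r \<in> carrier R" "u \<in> K \<rightarrow> carrier R" "v \<in> K \<rightarrow> carrier R"
  shows "dot R K (\<lambda>i\<in>K. r \<otimes> u i) v = r \<otimes> dot R K u v"
  using assms by (subst dot_restrict) (auto intro: dot_scale_left)

lemma dot_hom:
  assumes "v \<in> K \<rightarrow> carrier R"
  shows "(\<lambda>y. dot R K y v) \<in> hom (vector_group K) (add_monoid R)"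
proof (rule homI)
  fix y y' assume y: "y \<in> carrier (vector_group K)" "y' \<in> carrier (vector_group K)"
  then have "y \<in> K \<rightarrow> carrier R" "y' \<in> K \<rightarrow> carrier R" by auto
  then show "dot R K (y \<otimes>\<^bsub>vector_group K\<^esub> y') v = dot R K y v \<otimes>\<^bsub>add_monoid R\<^esub> dot R K y' v"
    using assms by (simp add: dot_restrict_add)
next
  fix y assume "y \<in> carrier (vector_group K)"
  then have "y \<in> K \<rightarrow> carrier R" by auto
  then show "dot R K y v \<in> carrier (add_monoid R)" using assms by simp
qed

lemma dot_eq_zero_iff:
  assumes "finite K" "v \<in> K \<rightarrow> carrier R"
  shows "(\<forall>y\<in>vectors K R. dot R K y v = \<zero>) \<longleftrightarrow> (\<forall>k\<in>K. v k = \<zero>)"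
proof
  assume L: "\<forall>y\<in>vectors K R. dot R K y v = \<zero>"
  show "\<forall>k\<in>K. v k = \<zero>"
  proof
    fix k assume k: "k \<in> K"
    have "(\<lambda>i\<in>K. if i = k then \<one> else \<zero>) \<in> vectors K R" by (simp add: vectors_def)
    then have "dot R K (\<lambda>i\<in>K. if i = k then \<one> else \<zero>) v = \<zero>" using L by blast
    then show "v k = \<zero>" using k assms by (simp add: dot_restrict dot_unit)
  qed
next
  assume "\<forall>k\<in>K. v k = \<zero>"
  then show "\<forall>y\<in>vectors K R. dot R K y v = \<zero>"
    by (auto intro!: dot_zero_right simp: vectors_mem)
qed

lemma sum_detector_dot:
  assumes w: "ideal_detector R w" and fin: "finite (carrier R)" and K: "finite K" and v: "v \<in> K \<rightarrow> carrier R"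
  shows "(\<Sum>y\<in>vectors K R. w (dot R K y v))
       = (if \<forall>k\<in>K. v k = \<zero> then of_nat (card (carrier R)) ^ card K else 0)"
proof -
  have "(\<Sum>y\<in>carrier (vector_group K). w (dot R K y v))
      = (if \<forall>y\<in>carrier (vector_group K). dot R K y v = \<zero> then of_nat (card (carrier (vector_group K))) else 0)"
  proof (rule ideal_detector_orthogonality[OF w comm_group_vector_group _ dot_hom[OF v]])
    show "finite (carrier (vector_group K))" unfolding carrier_vector_group by (rule finite_vectors[OF K fin])
    fix r y assume r: "r \<in> carrier R" and "y \<in> carrier (vector_group K)"
    then have y: "y \<in> K \<rightarrow> carrier R" by auto
    show "\<exists>z\<in>carrier (vector_group K). dot R K z v = r \<otimes> dot R K y v"
      by (rule bexI[of _ "\<lambda>i\<in>K. r \<otimes> y i"])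
        (use r y v K in \<open>auto simp: dot_restrict_scale\<close>)
  qed
  then show ?thesis
    unfolding carrier_vector_group dot_eq_zero_iff[OF K v] by (simp add: card_vectors[OF K])
qed

text \<open>
  Two separate sums of \<open>w\<close> could not be combined afterwards, since \<open>w\<close> need not turn
  sums into products. So the pair \<open>(y, y')\<close> is treated as one element of a product group.
\<close>

lemma sum_detector_two_dots:
  assumes w: "ideal_detector R w" and fin: "finite (carrier R)" and K: "finite K"
    and v: "v \<in> K \<rightarrow> carrier R" and v': "v' \<in> K \<rightarrow> carrier R"
  shows "(\<Sum>(y, y')\<in>vectors K R \<times> vectors K R. w (dot R K y' v \<ominus> dot R K y v'))
       = (if (\<forall>k\<in>K. v k = \<zero>) \<and> (\<forall>k\<in>K. v' k = \<zero>) then of_nat (card (carrier R)) ^ (2 * card K) else 0)"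
proof -
  let ?G = "vector_group K \<times>\<times> vector_group K"
  define f where "f = (\<lambda>(y, y'). dot R K y' v \<ominus> dot R K y v')"
  have car: "carrier ?G = vectors K R \<times> vectors K R"
    by (simp add: vectors_def)
  have mem: "y \<in> K \<rightarrow> carrier R" if "y \<in> vectors K R" for y using that by (auto simp: vectors_def)
  have G: "comm_group ?G"
  proof (rule group.group_comm_groupI)
    show "group ?G" by (intro DirProd_group comm_group.axioms(2) comm_group_vector_group)
    interpret V: comm_group "vector_group K" by (rule comm_group_vector_group)
    fix x y assume "x \<in> carrier ?G" "y \<in> carrier ?G"
    then show "x \<otimes>\<^bsub>?G\<^esub> y = y \<otimes>\<^bsub>?G\<^esub> x"
      by (auto simp: DirProd_def simp del: mult_product_group carrier_product_group intro: V.m_comm)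
  qed
  have f: "f \<in> hom ?G (add_monoid R)"
  proof (rule homI)
    fix p p' assume "p \<in> carrier ?G" "p' \<in> carrier ?G"
    then obtain y z y' z' where p: "p = (y, z)" "p' = (y', z')"
      and m: "y \<in> vectors K R" "z \<in> vectors K R" "y' \<in> vectors K R" "z' \<in> vectors K R"
      unfolding car by blast
    have "dot R K (\<lambda>i\<in>K. z i \<oplus> z' i) v = dot R K z v \<oplus> dot R K z' v"
         "dot R K (\<lambda>i\<in>K. y i \<oplus> y' i) v' = dot R K y v' \<oplus> dot R K y' v'"
      using m[THEN mem] v v' by (simp_all add: dot_restrict_add)
    moreover have "(a \<oplus> b) \<ominus> (c \<oplus> d) = (a \<ominus> c) \<oplus> (b \<ominus> d)"
      if "a \<in> carrier R" "b \<in> carrier R" "c \<in> carrier R" "d \<in> carrier R" for a b c d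
      using that by (simp add: a_minus_def minus_add a_ac)
    ultimately show "f (p \<otimes>\<^bsub>?G\<^esub> p') = f p \<otimes>\<^bsub>add_monoid R\<^esub> f p'"
      using m[THEN mem] v v' by (simp add: f_def p DirProd_def)
  next
    fix p assume "p \<in> carrier ?G"
    then show "f p \<in> carrier (add_monoid R)"
      unfolding car f_def using v v' by (auto dest!: mem)
  qed
  have "(\<Sum>p\<in>carrier ?G. w (f p)) = (if \<forall>p\<in>carrier ?G. f p = \<zero> then of_nat (card (carrier ?G)) else 0)"
  proof (rule ideal_detector_orthogonality[OF w G _ f])
    show "finite (carrier ?G)" unfolding car by (intro finite_cartesian_product finite_vectors K fin)
    fix r p assume r: "r \<in> carrier R" and "p \<in> carrier ?G"
    then obtain y z where p: "p = (y, z)" and m: "y \<in> vectors K R" "z \<in> vectors K R"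
      unfolding car by blast
    have m': "y \<in> K \<rightarrow> carrier R" "z \<in> K \<rightarrow> carrier R" using m[THEN mem] by auto
    have "f (\<lambda>i\<in>K. r \<otimes> y i, \<lambda>i\<in>K. r \<otimes> z i) = r \<otimes> dot R K z v \<ominus> r \<otimes> dot R K y v'"
      using m' r v v' K by (simp add: f_def dot_restrict_scale)
    also have "\<dots> = r \<otimes> f p"
      using m' r v v' by (simp add: f_def p a_minus_def r_distr r_minus)
    finally show "\<exists>p'\<in>carrier ?G. f p' = r \<otimes> f p"
      unfolding car using m' r by (intro bexI[of _ "(\<lambda>i\<in>K. r \<otimes> y i, \<lambda>i\<in>K. r \<otimes> z i)"]) (auto simp: vectors_def)
  qed
  moreover have "(\<forall>p\<in>carrier ?G. f p = \<zero>) \<longleftrightarrow> (\<forall>k\<in>K. v k = \<zero>) \<and> (\<forall>k\<in>K. v' k = \<zero>)"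
  proof
    assume L: "\<forall>p\<in>carrier ?G. f p = \<zero>"
    have z: "(\<lambda>i\<in>K. \<zero>) \<in> vectors K R" by (simp add: vectors_def)
    have dz: "dot R K (\<lambda>i\<in>K. \<zero>) u = \<zero>" if "u \<in> K \<rightarrow> carrier R" for u
      using that by (subst dot_commute) (auto intro!: dot_zero_right)
    have "\<forall>y\<in>vectors K R. dot R K y v = \<zero>"
    proof
      fix y assume y: "y \<in> vectors K R"
      then have "f (\<lambda>i\<in>K. \<zero>, y) = \<zero>" using L z unfolding car by blast
      then show "dot R K y v = \<zero>" using v v' y[THEN mem] by (simp add: f_def dz a_minus_def)
    qed
    moreover have "\<forall>y\<in>vectors K R. dot R K y v' = \<zero>"
    proof
      fix y assume y: "y \<in> vectors K R"
      then have "f (y, \<lambda>i\<in>K. \<zero>) = \<zero>" using L z unfolding car by blast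
      then show "dot R K y v' = \<zero>" using v v' y[THEN mem] by (simp add: f_def dz a_minus_def)
    qed
    ultimately show "(\<forall>k\<in>K. v k = \<zero>) \<and> (\<forall>k\<in>K. v' k = \<zero>)"
      using dot_eq_zero_iff[OF K v] dot_eq_zero_iff[OF K v'] by simp
  next
    assume "(\<forall>k\<in>K. v k = \<zero>) \<and> (\<forall>k\<in>K. v' k = \<zero>)"
    then show "\<forall>p\<in>carrier ?G. f p = \<zero>"
      unfolding car f_def by (auto dest!: mem simp: dot_zero_right)
  qed
  moreover have "card (carrier ?G) = card (carrier R) ^ (2 * card K)"
    unfolding car by (simp add: card_cartesian_product card_vectors[OF K] power_add mult_2)
  ultimately show ?thesis
    unfolding car by (simp add: f_def case_prod_unfold)
qed

end

section \<open>Counting pairs of kernel vectors\<close>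

lemma card_square_as_sum:
  assumes "finite B"
  shows "(of_nat (card {x \<in> B. P x}) :: rat) ^ 2 = (\<Sum>x\<in>B. \<Sum>x'\<in>B. if P x \<and> P x' then 1 else 0)"
proof -
  have "(of_nat (card {x \<in> B. P x}) :: rat) = (\<Sum>x\<in>B. if P x then 1 else 0)"
    using assms by (simp add: sum.If_cases Int_def)
  then have "(of_nat (card {x \<in> B. P x}) :: rat) ^ 2
      = (\<Sum>x\<in>B. if P x then 1 else 0) * (\<Sum>x\<in>B. if P x then 1 else 0)"
    by (simp add: power2_eq_square)
  also have "\<dots> = (\<Sum>x\<in>B. \<Sum>x'\<in>B. (if P x then 1 else 0) * (if P x' then 1 else 0))"
    by (rule sum_product)
  also have "\<dots> = (\<Sum>x\<in>B. \<Sum>x'\<in>B. if P x \<and> P x' then 1 else 0)"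
    by (intro sum.cong refl) simp
  finally show ?thesis .
qed

lemma card_filter_bij:
  assumes bij: "bij_betw f D E" and PQ: "\<And>x. x \<in> D \<Longrightarrow> P x \<longleftrightarrow> Q (f x)"
  shows "card {x \<in> D. P x} = card {y \<in> E. Q y}"
proof (rule bij_betw_same_card, rule bij_betw_imageI)
  show "inj_on f {x \<in> D. P x}"
    using bij_betw_imp_inj_on[OF bij] by (rule inj_on_subset) blast
  have "f ` {x \<in> D. P x} = {y \<in> f ` D. Q y}" using PQ by blast
  then show "f ` {x \<in> D. P x} = {y \<in> E. Q y}" unfolding bij_betw_imp_surj_on[OF bij] .
qed

text \<open>
  The sum \<open>S\<close> of \<open>w\<close> over the values of the trilinear form \<open>\<langle>a, x, y'\<rangle> - \<langle>a, x', y\<rangle>\<close> is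
  evaluated twice. With \<open>(y, y')\<close> innermost it counts the pairs \<open>x, x'\<close> in the kernel of \<open>a\<close>;
  with \<open>a\<close> innermost it counts the quadruples on the right-hand side.
\<close>

lemma (in cring) kernel_square_count:
  fixes t :: "'i \<Rightarrow> 'j \<Rightarrow> 'k \<Rightarrow> 'a"
  assumes w: "ideal_detector R w" and fin: "finite (carrier R)"
    and I: "finite I" and J: "finite J" and K: "finite K"
    and t: "\<And>i j k. i \<in> I \<Longrightarrow> j \<in> J \<Longrightarrow> k \<in> K \<Longrightarrow> t i j k \<in> carrier R"
  shows "of_nat (card (carrier R)) ^ (2 * card K) *
      (\<Sum>a\<in>vectors I R. (of_nat (card {x \<in> vectors J R. \<forall>k\<in>K. contract R I J t a x k = \<zero>}) :: rat) ^ 2)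
    = of_nat (card (carrier R)) ^ card I *
      of_nat (card {((x', y'), (x, y)). x' \<in> vectors J R \<and> y' \<in> vectors K R \<and> x \<in> vectors J R \<and> y \<in> vectors K R \<and>
        (\<forall>i\<in>I. contract R K J (transpose13 t) y' x i \<ominus> contract R K J (transpose13 t) y x' i = \<zero>)})"
proof -
  let ?X = "vectors J R" and ?Y = "vectors K R" and ?A = "vectors I R"
  let ?c = "contract R I J t" and ?d = "contract R K J (transpose13 t)"
  let ?q = "of_nat (card (carrier R)) :: rat"
  define S where "S = (\<Sum>x\<in>?X. \<Sum>x'\<in>?X. \<Sum>a\<in>?A. \<Sum>(y, y')\<in>?Y \<times> ?Y.
     w (dot R K y' (?c a x) \<ominus> dot R K y (?c a x')))"
  have finX: "finite ?X" and finY: "finite ?Y" and finA: "finite ?A"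
    using I J K fin by (auto intro: finite_vectors)
  have X: "x \<in> J \<rightarrow> carrier R" if "x \<in> ?X" for x using that by (auto simp: vectors_def)
  have Y: "y \<in> K \<rightarrow> carrier R" if "y \<in> ?Y" for y using that by (auto simp: vectors_def)
  have A: "a \<in> I \<rightarrow> carrier R" if "a \<in> ?A" for a using that by (auto simp: vectors_def)
  have c: "?c a x \<in> K \<rightarrow> carrier R" if "a \<in> ?A" "x \<in> ?X" for a x
    using that X A t by (auto intro!: contract_closed)
  have d: "?d y x \<in> I \<rightarrow> carrier R" if "y \<in> ?Y" "x \<in> ?X" for y x
    using that X Y t by (auto intro!: contract_closed simp: transpose13_def)
  have "S = (\<Sum>x\<in>?X. \<Sum>x'\<in>?X. \<Sum>a\<in>?A.
      ?q ^ (2 * card K) * (if (\<forall>k\<in>K. ?c a x k = \<zero>) \<and> (\<forall>k\<in>K. ?c a x' k = \<zero>) then 1 else 0))"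
    unfolding S_def
    by (intro sum.cong refl) (simp add: sum_detector_two_dots[OF w fin K] c)
  also have "\<dots> = (\<Sum>x\<in>?X. \<Sum>a\<in>?A. \<Sum>x'\<in>?X.
      ?q ^ (2 * card K) * (if (\<forall>k\<in>K. ?c a x k = \<zero>) \<and> (\<forall>k\<in>K. ?c a x' k = \<zero>) then 1 else 0))"
    by (intro sum.cong refl sum.swap)
  also have "\<dots> = (\<Sum>a\<in>?A. \<Sum>x\<in>?X. \<Sum>x'\<in>?X.
      ?q ^ (2 * card K) * (if (\<forall>k\<in>K. ?c a x k = \<zero>) \<and> (\<forall>k\<in>K. ?c a x' k = \<zero>) then 1 else 0))"
    by (rule sum.swap)
  also have "\<dots> = ?q ^ (2 * card K) * (\<Sum>a\<in>?A. (of_nat (card {x \<in> ?X. \<forall>k\<in>K. ?c a x k = \<zero>})) ^ 2)"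
    by (simp add: card_square_as_sum[OF finX] sum_distrib_left)
  finally have L: "S = ?q ^ (2 * card K) * (\<Sum>a\<in>?A. (of_nat (card {x \<in> ?X. \<forall>k\<in>K. ?c a x k = \<zero>})) ^ 2)" .
  have inner: "(\<Sum>a\<in>?A. w (dot R K y' (?c a x) \<ominus> dot R K y (?c a x')))
     = ?q ^ card I * (if \<forall>i\<in>I. ?d y' x i \<ominus> ?d y x' i = \<zero> then 1 else 0)"
    if "x \<in> ?X" "x' \<in> ?X" "y \<in> ?Y" "y' \<in> ?Y" for x x' y y'
  proof -
    have "dot R K y' (?c a x) \<ominus> dot R K y (?c a x') = dot R I a (\<lambda>i. ?d y' x i \<ominus> ?d y x' i)"
      if a: "a \<in> ?A" for a
    proof -
      have "dot R K y' (?c a x) = dot R I a (?d y' x)"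
        by (rule dot_contract[OF I K A X Y]) (use a \<open>x \<in> ?X\<close> \<open>y' \<in> ?Y\<close> t in auto)
      moreover have "dot R K y (?c a x') = dot R I a (?d y x')"
        by (rule dot_contract[OF I K A X Y]) (use a \<open>x' \<in> ?X\<close> \<open>y \<in> ?Y\<close> t in auto)
      ultimately show ?thesis
        using dot_diff_right[OF I A[OF a] d[OF \<open>y' \<in> ?Y\<close> \<open>x \<in> ?X\<close>] d[OF \<open>y \<in> ?Y\<close> \<open>x' \<in> ?X\<close>]] by simp
    qed
    then have "(\<Sum>a\<in>?A. w (dot R K y' (?c a x) \<ominus> dot R K y (?c a x')))
        = (\<Sum>a\<in>?A. w (dot R I a (\<lambda>i. ?d y' x i \<ominus> ?d y x' i)))"
      by (intro sum.cong refl) simp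
    also have "\<dots> = (if \<forall>i\<in>I. ?d y' x i \<ominus> ?d y x' i = \<zero> then ?q ^ card I else 0)"
      by (rule sum_detector_dot[OF w fin I])
        (use d[OF \<open>y' \<in> ?Y\<close> \<open>x \<in> ?X\<close>] d[OF \<open>y \<in> ?Y\<close> \<open>x' \<in> ?X\<close>] in auto)
    finally show ?thesis by simp
  qed
  let ?Q = "\<lambda>x' y' x y. \<forall>i\<in>I. ?d y' x i \<ominus> ?d y x' i = \<zero>"
  have "S = (\<Sum>x\<in>?X. \<Sum>x'\<in>?X. \<Sum>(y, y')\<in>?Y \<times> ?Y. \<Sum>a\<in>?A.
     w (dot R K y' (?c a x) \<ominus> dot R K y (?c a x')))"
    unfolding S_def by (intro sum.cong refl, subst sum.swap) (simp add: case_prod_unfold)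
  also have "\<dots> = (\<Sum>x\<in>?X. \<Sum>x'\<in>?X. \<Sum>(y, y')\<in>?Y \<times> ?Y. ?q ^ card I * (if ?Q x' y' x y then 1 else 0))"
    by (intro sum.cong refl) (auto simp: inner)
  also have "\<dots> = ?q ^ card I * (\<Sum>x\<in>?X. \<Sum>x'\<in>?X. \<Sum>(y, y')\<in>?Y \<times> ?Y. if ?Q x' y' x y then 1 else 0)"
    by (simp add: sum_distrib_left case_prod_unfold)
  also have "(\<Sum>x\<in>?X. \<Sum>x'\<in>?X. \<Sum>(y, y')\<in>?Y \<times> ?Y. if ?Q x' y' x y then 1 else (0::rat))
     = (\<Sum>(x, x', y, y')\<in>?X \<times> ?X \<times> ?Y \<times> ?Y. if ?Q x' y' x y then 1 else 0)"
    by (simp add: sum.cartesian_product case_prod_unfold)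
  also have "\<dots> = of_nat (card {(x, x', y, y') \<in> ?X \<times> ?X \<times> ?Y \<times> ?Y. ?Q x' y' x y})"
    using finX finY by (simp add: sum.If_cases Int_def case_prod_unfold mem_Times_iff conj_ac)
  also have "card {(x, x', y, y') \<in> ?X \<times> ?X \<times> ?Y \<times> ?Y. ?Q x' y' x y}
     = card {((x', y'), (x, y)). x' \<in> ?X \<and> y' \<in> ?Y \<and> x \<in> ?X \<and> y \<in> ?Y \<and> ?Q x' y' x y}"
    by (rule bij_betw_same_card[of "\<lambda>(x, x', y, y'). ((x', y'), (x, y))"],
        rule bij_betw_byWitness[where f' = "\<lambda>((x', y'), (x, y)). (x, x', y, y')"]) auto
  finally show ?thesis using L by simp
qed

section \<open>Finite quotients of discrete valuation rings\<close>

lemma carrier_Quot: "carrier (R Quot I) = (\<lambda>x. I +>\<^bsub>R\<^esub> x) ` carrier R"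
  unfolding FactRing_def A_RCOSETS_def' by auto

lemma (in ring) coset_eq_iff:
  assumes "ideal I R" "x \<in> carrier R" "y \<in> carrier R"
  shows "I +> x = I +> y \<longleftrightarrow> x \<ominus> y \<in> I"
proof -
  interpret ideal I R by fact
  have "I +> x = I +> y \<longleftrightarrow> x \<in> I +> y"
    using a_rcos_self[OF assms(2)] a_repr_independence'[of x y] assms by auto
  also have "\<dots> \<longleftrightarrow> x \<ominus> y \<in> I"
    using a_rcos_module_minus[OF ring_axioms] assms by auto
  finally show ?thesis .
qed

lemma (in cring) diff_of_sums:
  assumes "a \<in> carrier R" "b \<in> carrier R" "a' \<in> carrier R" "b' \<in> carrier R" "s \<in> carrier R"
  shows "(a \<oplus> s \<otimes> b) \<ominus> (a' \<oplus> s \<otimes> b') = (a \<ominus> a') \<oplus> s \<otimes> (b \<ominus> b')"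
  using assms by (simp add: a_minus_def minus_add r_distr r_minus a_ac)
lemma (in cring) diff_sum_regroup:
  assumes "a \<in> carrier R" "b \<in> carrier R" "x \<in> carrier R" "s \<in> carrier R"
  shows "x \<ominus> (a \<oplus> s \<otimes> b) = (x \<ominus> a) \<ominus> s \<otimes> b"
  using assms by (simp add: a_minus_def minus_add a_ac)
lemma (in cring) diff_factor_right:
  assumes "y \<in> carrier R" "b \<in> carrier R" "s \<in> carrier R"
  shows "y \<otimes> s \<ominus> s \<otimes> b = (y \<ominus> b) \<otimes> s"
  using assms by (simp add: a_minus_def l_distr l_minus m_comm[of s b])
lemma (in cring) eq_sum_minus:
  assumes "a \<in> carrier R" "b \<in> carrier R"
  shows "a = (a \<oplus> b) \<ominus> b"
  using assms by (simp add: a_minus_def a_assoc r_neg)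

text \<open>
  A principal domain with a distinguished nonzero nonunit \<open>p\<close> dividing every nonunit: a
  discrete valuation ring with a chosen uniformizer. The ideals \<open>P n\<close> are then the powers of the
  maximal ideal.
\<close>

locale uniformized_domain = principal_domain +
  fixes p
  assumes p_closed [simp, intro]: "p \<in> carrier R"
    and p_nonzero: "p \<noteq> \<zero>"
    and p_nonunit: "p \<notin> Units R"
    and nonunit_imp_multiple: "x \<in> carrier R \<Longrightarrow> x \<notin> Units R \<Longrightarrow> x \<in> PIdl p"
begin

definition P :: "nat \<Rightarrow> 'a set" where "P n = PIdl (p [^] n)"

lemma P_ideal: "ideal (P n) R"
  by (simp add: P_def cgenideal_ideal)

lemma P_mem_iff: "x \<in> P n \<longleftrightarrow> (\<exists>z\<in>carrier R. x = z \<otimes> p [^] n)"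
  by (auto simp: P_def cgenideal_def)

lemma P_1: "P 1 = PIdl p"
  by (simp add: P_def)

lemma P_1_mem_iff: "x \<in> P 1 \<longleftrightarrow> (\<exists>z\<in>carrier R. x = z \<otimes> p)"
  by (simp add: P_mem_iff)

lemma P_0: "P 0 = carrier R"
  by (auto simp: P_mem_iff intro: bexI[where x = "_"])

lemma p_pow_nonzero: "p [^] (n::nat) \<noteq> \<zero>"
  by (induction n) (auto simp: p_nonzero integral_iff)

text \<open>
  Factors \<open>p\<close> can be split off as long as the cofactor is not a unit, and fewer than \<open>n\<close>
  of them can occur in an element outside \<open>P n\<close>.
\<close>

lemma not_in_P_imp:
  assumes "r \<in> carrier R" "r \<notin> P n"
  shows "\<exists>m<n. \<exists>u\<in>Units R. r = u \<otimes> p [^] m"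
  using assms(2)
proof (induction n)
  case 0
  then show ?case using assms(1) by (simp add: P_0)
next
  case (Suc n)
  show ?case
  proof (cases "r \<in> P n")
    case True
    then obtain z where z: "z \<in> carrier R" "r = z \<otimes> p [^] n" by (auto simp only: P_mem_iff)
    have "z \<in> Units R"
    proof (rule ccontr)
      assume "z \<notin> Units R"
      then obtain y where "y \<in> carrier R" "z = y \<otimes> p"
        using nonunit_imp_multiple[OF z(1)] by (auto simp: cgenideal_def)
      then have "r = y \<otimes> p [^] Suc n" using z by (simp add: m_ac)
      then show False using Suc.prems \<open>y \<in> carrier R\<close> unfolding P_mem_iff by blast
    qed
    then show ?thesis using z by auto
  next
    case False
    then show ?thesis using Suc.IH less_Suc_eq by blast
  qed
qed

lemma PIdl_unit_multiple:
  assumes "u \<in> Units R"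
  shows "PIdl (u \<otimes> p [^] m) = P m"
proof -
  have uC: "u \<in> carrier R" "inv u \<in> carrier R" using assms by auto
  then have uc: "u \<otimes> p [^] m \<in> carrier R" by simp
  show ?thesis
  proof
    show "PIdl (u \<otimes> p [^] m) \<subseteq> P m"
      by (rule cgenideal_minimal[OF P_ideal]) (use uC in \<open>auto simp only: P_mem_iff\<close>)
    have "inv u \<otimes> (u \<otimes> p [^] m) = (inv u \<otimes> u) \<otimes> p [^] m"
      using uC by (simp add: m_assoc del: Units_l_inv)
    then have "p [^] m = inv u \<otimes> (u \<otimes> p [^] m)" using assms by simp
    then have "p [^] m \<in> PIdl (u \<otimes> p [^] m)"
      using uC unfolding cgenideal_def by blast
    then show "P m \<subseteq> PIdl (u \<otimes> p [^] m)"
      unfolding P_def by (rule cgenideal_minimal[OF cgenideal_ideal[OF uc]])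
  qed
qed

lemma P_Suc_cancel:
  assumes "y \<in> carrier R" "p [^] n \<otimes> y \<in> P (Suc n)"
  shows "y \<in> P 1"
proof -
  obtain z where z: "z \<in> carrier R" "p [^] n \<otimes> y = z \<otimes> p [^] Suc n"
    using assms by (auto simp only: P_mem_iff)
  then have "p [^] n \<otimes> y = p [^] n \<otimes> (z \<otimes> p)" using assms by (simp add: m_ac)
  then have "y = z \<otimes> p" using assms z p_pow_nonzero[of n] by (simp only: m_lcancel nat_pow_closed p_closed m_closed simp_thms)
  then show ?thesis using z unfolding P_1_mem_iff by blast
qed

lemma P_Suc_mono: "x \<in> P (Suc n) \<Longrightarrow> x \<in> P n"
proof -
  assume "x \<in> P (Suc n)"
  then obtain z where z: "z \<in> carrier R" "x = z \<otimes> p [^] Suc n" by (auto simp only: P_mem_iff)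
  then have "x = (z \<otimes> p) \<otimes> p [^] n" by (simp add: m_ac)
  then show ?thesis using z(1) unfolding P_mem_iff by blast
qed

lemma P_diff:
  assumes "x \<in> P n" "y \<in> P n"
  shows "x \<ominus> y \<in> P n"
proof -
  interpret ideal "P n" R by (rule P_ideal)
  show ?thesis using assms by (simp add: a_minus_def)
qed

text \<open>
  Expansion by one more digit: modulo \<open>p\<^sup>n\<^sup>+\<^sup>1\<close> every element is uniquely
  \<open>c + p\<^sup>n c'\<close> with \<open>c\<close> a representative modulo \<open>p\<^sup>n\<close> and \<open>c'\<close> one modulo \<open>p\<close>.
\<close>

lemma quotient_step_bij:
  "\<exists>h. bij_betw h (carrier (R Quot P n) \<times> carrier (R Quot P 1)) (carrier (R Quot P (Suc n)))"
proof -
  define rep :: "'a set \<Rightarrow> 'a" where "rep C = (SOME x. x \<in> C)" for C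
  have rep: "rep (P k +> x) \<in> carrier R" "x \<ominus> rep (P k +> x) \<in> P k" "P k +> rep (P k +> x) = P k +> x"
    if x: "x \<in> carrier R" for k x
  proof -
    interpret ideal "P k" R by (rule P_ideal)
    have "rep (P k +> x) \<in> P k +> x" unfolding rep_def by (rule someI) (rule a_rcos_self[OF x])
    then show 1: "rep (P k +> x) \<in> carrier R" using x a_r_coset_subset_G[OF a_subset x] by blast
    show 3: "P k +> rep (P k +> x) = P k +> x"
      by (rule a_repr_independence'[symmetric]) (use \<open>rep (P k +> x) \<in> P k +> x\<close> x in auto)
    then show "x \<ominus> rep (P k +> x) \<in> P k" using coset_eq_iff[OF P_ideal[of k] x 1] by simp
  qed
  define h where "h = (\<lambda>(C, D). P (Suc n) +> (rep C \<oplus> p [^] n \<otimes> rep D))"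
  have "bij_betw h (carrier (R Quot P n) \<times> carrier (R Quot P 1)) (carrier (R Quot P (Suc n)))"
  proof (rule bij_betw_imageI)
    show "inj_on h (carrier (R Quot P n) \<times> carrier (R Quot P 1))"
    proof (rule inj_onI)
      fix C1 C2 assume "C1 \<in> carrier (R Quot P n) \<times> carrier (R Quot P 1)"
        "C2 \<in> carrier (R Quot P n) \<times> carrier (R Quot P 1)" and eq: "h C1 = h C2"
      then obtain x y x' y' where c: "x \<in> carrier R" "y \<in> carrier R" "x' \<in> carrier R" "y' \<in> carrier R"
        and C1: "C1 = (P n +> x, P 1 +> y)" and C2: "C2 = (P n +> x', P 1 +> y')"
        unfolding carrier_Quot by blast
      define a b a' b' where ab: "a = rep (P n +> x)" "b = rep (P 1 +> y)" "a' = rep (P n +> x')" "b' = rep (P 1 +> y')"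
      have ac: "a \<in> carrier R" "b \<in> carrier R" "a' \<in> carrier R" "b' \<in> carrier R"
        unfolding ab by (intro rep(1) c)+
      have C12: "C1 = (P n +> a, P 1 +> b)" "C2 = (P n +> a', P 1 +> b')"
        unfolding C1 C2 ab by (simp_all add: rep(3) c)
      have d: "(a \<oplus> p [^] n \<otimes> b) \<ominus> (a' \<oplus> p [^] n \<otimes> b') \<in> P (Suc n)"
        using eq coset_eq_iff[OF P_ideal, of "a \<oplus> p [^] n \<otimes> b" "a' \<oplus> p [^] n \<otimes> b'" "Suc n"] ac
        unfolding h_def C1 C2 by (simp add: ab)
      have d_eq: "(a \<oplus> p [^] n \<otimes> b) \<ominus> (a' \<oplus> p [^] n \<otimes> b') = (a \<ominus> a') \<oplus> p [^] n \<otimes> (b \<ominus> b')"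
        by (rule diff_of_sums) (use ac in auto)
      have "a \<ominus> a' = ((a \<oplus> p [^] n \<otimes> b) \<ominus> (a' \<oplus> p [^] n \<otimes> b')) \<ominus> (b \<ominus> b') \<otimes> p [^] n"
        unfolding d_eq m_comm[OF minus_closed[OF ac(2,4)] nat_pow_closed[OF p_closed]]
        by (rule eq_sum_minus) (use ac in auto)
      moreover have "(b \<ominus> b') \<otimes> p [^] n \<in> P n" using ac by (auto simp only: P_mem_iff)
      ultimately have "a \<ominus> a' \<in> P n"
        using P_diff[OF P_Suc_mono[OF d]] by simp
      then have 1: "P n +> a = P n +> a'" using coset_eq_iff[OF P_ideal] ac by simp
      then have "P n +> x = P n +> x'" using rep(3)[OF c(1), of n] rep(3)[OF c(3), of n] by (simp add: ab)
      then have "a = a'" by (simp add: ab)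
      then have "p [^] n \<otimes> (b \<ominus> b') \<in> P (Suc n)"
        using d ac unfolding d_eq by (simp add: a_minus_def r_neg)
      then have "b \<ominus> b' \<in> P 1" by (rule P_Suc_cancel[rotated]) (use ac in auto)
      then have "P 1 +> b = P 1 +> b'" using coset_eq_iff[OF P_ideal] ac by simp
      then show "C1 = C2" using 1 C12 by simp
    qed
    show "h ` (carrier (R Quot P n) \<times> carrier (R Quot P 1)) = carrier (R Quot P (Suc n))"
    proof
      show "h ` (carrier (R Quot P n) \<times> carrier (R Quot P 1)) \<subseteq> carrier (R Quot P (Suc n))"
        unfolding carrier_Quot h_def using rep(1) by auto
      show "carrier (R Quot P (Suc n)) \<subseteq> h ` (carrier (R Quot P n) \<times> carrier (R Quot P 1))"
      proof
        fix E assume "E \<in> carrier (R Quot P (Suc n))"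
        then obtain x where x: "x \<in> carrier R" "E = P (Suc n) +> x" unfolding carrier_Quot by blast
        define a where "a = rep (P n +> x)"
        have a: "a \<in> carrier R" "x \<ominus> a \<in> P n" unfolding a_def using rep(1,2)[OF x(1)] by auto
        then obtain y where y: "y \<in> carrier R" "x \<ominus> a = y \<otimes> p [^] n" by (auto simp only: P_mem_iff)
        define b where "b = rep (P 1 +> y)"
        have b: "b \<in> carrier R" "y \<ominus> b \<in> P 1" unfolding b_def using rep[OF y(1), of 1] by auto
        then obtain z where z: "z \<in> carrier R" "y \<ominus> b = z \<otimes> p" unfolding P_1_mem_iff by blast
        have "x \<ominus> (a \<oplus> p [^] n \<otimes> b) = (x \<ominus> a) \<ominus> p [^] n \<otimes> b"
          by (rule diff_sum_regroup) (use x a b in auto)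
        also have "\<dots> = (y \<ominus> b) \<otimes> p [^] n" unfolding y(2)
          by (rule diff_factor_right) (use y b in auto)
        also have "\<dots> = z \<otimes> p [^] Suc n" unfolding z(2) using z by (simp add: m_ac)
        finally have "x \<ominus> (a \<oplus> p [^] n \<otimes> b) \<in> P (Suc n)" using z by (auto simp only: P_mem_iff)
        then have "E = h (P n +> x, P 1 +> y)"
          using x a b coset_eq_iff[OF P_ideal, of x "a \<oplus> p [^] n \<otimes> b" "Suc n"]
          unfolding h_def by (simp add: a_def[symmetric] b_def[symmetric] del: One_nat_def)
        then show "E \<in> h ` (carrier (R Quot P n) \<times> carrier (R Quot P 1))"
          using x y unfolding carrier_Quot by blast
      qed
    qed
  qed
  then show ?thesis by blast
qed

lemma quotient_by_power:
  assumes "finite (carrier (R Quot P 1))"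
  shows "finite (carrier (R Quot P n)) \<and> card (carrier (R Quot P n)) = card (carrier (R Quot P 1)) ^ n"
proof (induction n)
  case 0
  have "P 0 +> x = P 0 +> \<zero>" if "x \<in> carrier R" for x
    using coset_eq_iff[OF P_ideal[of 0], of x \<zero>] that by (simp add: P_0)
  then have "carrier (R Quot P 0) = {P 0 +> \<zero>}" unfolding carrier_Quot by blast
  then show ?case by simp
next
  case (Suc n)
  obtain h where "bij_betw h (carrier (R Quot P n) \<times> carrier (R Quot P 1)) (carrier (R Quot P (Suc n)))"
    using quotient_step_bij by blast
  note h = this
  have "finite (carrier (R Quot P n) \<times> carrier (R Quot P 1))"
    using Suc.IH assms by (intro finite_cartesian_product) auto
  then have "finite (carrier (R Quot P (Suc n)))" using bij_betw_finite[OF h] by simp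
  moreover have "card (carrier (R Quot P (Suc n))) = card (carrier (R Quot P 1)) ^ Suc n"
    using bij_betw_same_card[OF h] Suc.IH by (simp add: card_cartesian_product mult.commute del: One_nat_def)
  ultimately show ?case ..
qed

lemma residue_card_ge_2:
  assumes "finite (carrier (R Quot P 1))"
  shows "card (carrier (R Quot P 1)) \<ge> 2"
proof -
  have "P 1 +> \<one> \<noteq> P 1 +> \<zero>"
  proof
    assume "P 1 +> \<one> = P 1 +> \<zero>"
    then have "\<one> \<in> P 1" using coset_eq_iff[OF P_ideal, of \<one> \<zero>] by (simp add: a_minus_def)
    then have "P 1 = carrier R" using ideal.one_imp_carrier[OF P_ideal] by blast
    then show False using ideal_eq_carrier_iff[OF p_closed] p_nonunit unfolding P_1 by simp
  qed
  then have "card {P 1 +> \<one>, P 1 +> \<zero>} = 2" by simp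
  moreover have "{P 1 +> \<one>, P 1 +> \<zero>} \<subseteq> carrier (R Quot P 1)" unfolding carrier_Quot by blast
  ultimately show ?thesis using card_mono[OF assms, of "{P 1 +> \<one>, P 1 +> \<zero>}"] by linarith
qed

text \<open>
  A generator of an ideal of finite index cannot lie in all \<open>P n\<close>, because the index of
  \<open>P n\<close> grows without bound. So it is a unit times a power of \<open>p\<close>.
\<close>

lemma finite_quotient_imp_power:
  assumes fin1: "finite (carrier (R Quot P 1))"
    and I: "ideal I R" and fin: "finite (carrier (R Quot I))"
  shows "\<exists>n. I = P n"
proof -
  obtain a where a: "a \<in> carrier R" "I = PIdl a" using exists_gen[OF I] by blast
  have "\<exists>n. a \<notin> P n"
  proof (rule ccontr)
    assume "\<not> (\<exists>n. a \<notin> P n)"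
    then have sub: "I \<subseteq> P n" for n
      unfolding a(2) by (intro cgenideal_minimal P_ideal) blast
    let ?n = "card (carrier (R Quot I))"
    let ?f = "\<lambda>C. P ?n +> (SOME x. x \<in> C)"
    have "carrier (R Quot P ?n) \<subseteq> ?f ` carrier (R Quot I)"
    proof
      fix D assume "D \<in> carrier (R Quot P ?n)"
      then obtain x where x: "x \<in> carrier R" "D = P ?n +> x" unfolding carrier_Quot by blast
      interpret ideal I R by (rule I)
      have s: "(SOME y. y \<in> I +> x) \<in> I +> x" by (rule someI) (rule a_rcos_self[OF x(1)])
      then have c: "(SOME y. y \<in> I +> x) \<in> carrier R" using a_r_coset_subset_G[OF a_subset x(1)] by blast
      have "I +> (SOME y. y \<in> I +> x) = I +> x"
        using a_repr_independence'[OF s x(1)] by simp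
      then have "x \<ominus> (SOME y. y \<in> I +> x) \<in> P ?n" using coset_eq_iff[OF I x(1) c] sub by (metis subsetD)
      then have "D = ?f (I +> x)" using x coset_eq_iff[OF P_ideal x(1) c] by simp
      then show "D \<in> ?f ` carrier (R Quot I)" using x unfolding carrier_Quot by blast
    qed
    then have "card (carrier (R Quot P ?n)) \<le> ?n" by (rule surj_card_le[OF fin])
    moreover have "?n < card (carrier (R Quot P 1)) ^ ?n"
    proof -
      \<comment> \<open>The index of \<open>I\<close> itself serves as the exponent whose power of \<open>q\<close> is too large.\<close>
      have "?n < 2 ^ ?n" by (rule less_exp)
      also have "\<dots> \<le> card (carrier (R Quot P 1)) ^ ?n" using residue_card_ge_2[OF fin1] by (rule power_mono) simp
      finally show ?thesis .
    qed
    moreover have "card (carrier (R Quot P ?n)) = card (carrier (R Quot P 1)) ^ ?n"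
      using quotient_by_power[OF fin1, of ?n] by (rule conjunct2)
    ultimately show False by linarith
  qed
  then obtain n where n: "a \<notin> P n" ..
  obtain m :: nat and u where u: "u \<in> Units R" "a = u \<otimes> p [^] m"
    using not_in_P_imp[OF a(1) n] by blast
  have "I = P m" unfolding a(2) u(2) by (rule PIdl_unit_multiple[OF u(1)])
  then show ?thesis by (rule exI)
qed

text \<open>
  The class of \<open>p\<^sup>n\<^sup>-\<^sup>1\<close> is a multiple of every nonzero class, since a nonzero class has a
  representative \<open>u p\<^sup>m\<close> with \<open>u\<close> a unit and \<open>m < n\<close>. For \<open>n = 0\<close> there is no nonzero class.
\<close>

lemma quotient_socle:
  "\<exists>s\<in>carrier (R Quot P n). \<forall>x\<in>carrier (R Quot P n). x \<noteq> \<zero>\<^bsub>R Quot P n\<^esub> \<longrightarrow>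
     s \<noteq> \<zero>\<^bsub>R Quot P n\<^esub> \<and> (\<exists>c\<in>carrier (R Quot P n). s = c \<otimes>\<^bsub>R Quot P n\<^esub> x)"
proof (rule bexI[of _ "P n +> p [^] (n - 1)"]; (intro ballI impI)?)
  show "P n +> p [^] (n - 1) \<in> carrier (R Quot P n)" unfolding carrier_Quot by simp
  fix C1 assume "C1 \<in> carrier (R Quot P n)" and X0: "C1 \<noteq> \<zero>\<^bsub>R Quot P n\<^esub>"
  then obtain r where r: "r \<in> carrier R" "C1 = P n +> r" unfolding carrier_Quot by blast
  have zero: "\<zero>\<^bsub>R Quot P n\<^esub> = P n +> \<zero>"
    using P_ideal[of n] a_coset_add_zero[OF additive_subgroup.a_subset[OF ideal.axioms(1)[OF P_ideal[of n]]]]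
    by (simp add: FactRing_def)
  have "r \<notin> P n"
    using X0 r coset_eq_iff[OF P_ideal r(1) zero_closed] unfolding zero by (simp add: a_minus_def)
  from not_in_P_imp[OF r(1) this]
  obtain m u where m: "m < n" and u: "u \<in> Units R" and ru: "r = u \<otimes> p [^] m"
    by (elim exE bexE conjE)
  have "p [^] (n - 1) \<notin> P n"
  proof
    assume "p [^] (n - 1) \<in> P n"
    moreover obtain k where k: "n = Suc k" using m by (cases n) auto
    ultimately obtain z where z: "z \<in> carrier R" "p [^] k = z \<otimes> p [^] Suc k"
      by (auto simp only: P_mem_iff diff_Suc_1)
    then have "p [^] k \<otimes> \<one> = p [^] k \<otimes> (z \<otimes> p)" by (simp add: m_ac)
    then have "\<one> = z \<otimes> p"
      using z p_pow_nonzero[of k] by (simp only: m_lcancel nat_pow_closed p_closed m_closed one_closed simp_thms)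
    then have "p \<in> Units R" using z(1) m_comm[OF z(1) p_closed] unfolding Units_def by auto
    then show False using p_nonunit by simp
  qed
  then have 1: "P n +> p [^] (n - 1) \<noteq> \<zero>\<^bsub>R Quot P n\<^esub>"
    unfolding zero using coset_eq_iff[OF P_ideal, of "p [^] (n - 1)" \<zero> n] by (simp add: a_minus_def)
  let ?c = "inv u \<otimes> p [^] (n - 1 - m)"
  have uC: "u \<in> carrier R" "inv u \<in> carrier R" using u by auto
  then have cc: "?c \<in> carrier R" by simp
  have "?c \<otimes> r = (inv u \<otimes> u) \<otimes> (p [^] (n - 1 - m) \<otimes> p [^] m)"
    unfolding ru using uC by (simp add: m_ac del: Units_l_inv Units_r_inv)
  also have "\<dots> = p [^] (n - 1)" using u m by (simp add: nat_pow_mult)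
  finally have "?c \<otimes> r = p [^] (n - 1)" .
  then have "P n +> p [^] (n - 1) = (P n +> ?c) \<otimes>\<^bsub>R Quot P n\<^esub> C1"
    using ideal.rcoset_mult_add[OF P_ideal cc r(1)] r by (simp add: FactRing_def)
  then show "P n +> p [^] (n - 1) \<noteq> \<zero>\<^bsub>R Quot P n\<^esub> \<and>
      (\<exists>c\<in>carrier (R Quot P n). P n +> p [^] (n - 1) = c \<otimes>\<^bsub>R Quot P n\<^esub> C1)"
    using 1 cc unfolding carrier_Quot by blast
qed

end

lemma discrete_valuation_ring_uniformizer:
  fixes R :: "('a, 'x) ring_scheme" (structure)
  assumes "discrete_valuation_ring R"
  shows "\<exists>p. uniformized_domain R p \<and> max_ideal R = PIdl p"
proof -
  interpret principal_domain R using assms unfolding discrete_valuation_ring_def by (rule conjunct1)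
  have nf: "\<not> field R" and ex1: "\<exists>!P. maximalideal P R"
    using assms unfolding discrete_valuation_ring_def by blast+
  have max: "maximalideal (max_ideal R) R"
    unfolding max_ideal_def using ex1 by (rule theI')
  have uniq: "J = max_ideal R" if "maximalideal J R" for J
    unfolding max_ideal_def by (rule the1_equality[OF ex1 that, symmetric])
  have id: "ideal (max_ideal R) R" using max by (rule maximalideal.axioms(1))
  obtain p where p: "p \<in> carrier R" "max_ideal R = PIdl p" using exists_gen[OF id] by blast
  have "uniformized_domain R p"
  proof (intro uniformized_domain.intro uniformized_domain_axioms.intro principal_domain_axioms)
    show "p \<in> carrier R" by (rule p(1))
    show "p \<noteq> \<zero>"
    proof
      assume p0: "p = \<zero>"
      have "PIdl \<zero> = {\<zero>}" unfolding cgenideal_def by (auto intro!: exI[of _ \<zero>])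
      then have "maximalideal {\<zero>} R" using max unfolding p(2) p0 by (rule subst)
      with zeromaximalideal_fieldI have "field R" .
      with nf show False by (rule notE)
    qed
    show "p \<notin> Units R"
      using ideal_eq_carrier_iff[OF p(1)] maximalideal.I_notcarr[OF max] unfolding p(2) by metis
    fix x assume x: "x \<in> carrier R" "x \<notin> Units R"
    show "x \<in> PIdl p"
    proof (cases "x = \<zero>")
      case True
      have "\<zero> \<in> PIdl p"
        by (rule additive_subgroup.zero_closed[OF ideal.axioms(1)[OF cgenideal_ideal[OF p(1)]]])
      with True show ?thesis by simp
    next
      case False
      then have "x \<in> carrier R - {\<zero>}" using x by simp
      then obtain b where b: "b \<in> carrier R" "ring_irreducible b" "b divides x"
        using x(2) by (rule exists_irreducible_divisor)
      have "PIdl b = PIdl p"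
        using uniq[OF irreducible_imp_maximalideal[OF b(1,2)]] unfolding p(2) .
      moreover have "PIdl x \<subseteq> PIdl b" using to_contain_is_to_divide[OF b(1) x(1)] b(3) by simp
      ultimately show ?thesis using cgenideal_self[OF x(1)] by blast
    qed
  qed
  with p(2) show ?thesis by (intro exI conjI)
qed

context uniformized_domain begin

lemma max_ideal_power_eq:
  assumes "max_ideal R = PIdl p"
  shows "max_ideal_power R n = P n"
proof (induction n)
  case 0
  show ?case by (simp add: max_ideal_power_def ideals_set_def P_0)
next
  case (Suc n)
  have "max_ideal_power R (Suc n) = ideal_prod R (P n) (PIdl p)"
    using Suc.IH assms by (simp add: max_ideal_power_def ideals_set_def)
  also have "\<dots> = P (Suc n)"
  proof
    show "ideal_prod R (P n) (PIdl p) \<subseteq> P (Suc n)"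
    proof
      fix x assume "x \<in> ideal_prod R (P n) (PIdl p)"
      then show "x \<in> P (Suc n)"
      proof (induction rule: ideal_prod.induct)
        case (prod i j)
        then obtain y z where "y \<in> carrier R" "i = y \<otimes> p [^] n" "z \<in> carrier R" "j = z \<otimes> p"
          unfolding P_mem_iff cgenideal_def by blast
        moreover from this have "i \<otimes> j = (y \<otimes> z) \<otimes> p [^] Suc n" by (simp add: m_ac)
        ultimately show ?case unfolding P_mem_iff by blast
      next
        case (sum s1 s2)
        then show ?case
          using additive_subgroup.a_closed[OF ideal.axioms(1)[OF P_ideal]] by blast
      qed
    qed
    show "P (Suc n) \<subseteq> ideal_prod R (P n) (PIdl p)"
    proof
      fix x assume "x \<in> P (Suc n)"
      then obtain z where z: "z \<in> carrier R" "x = z \<otimes> p [^] Suc n" unfolding P_mem_iff by blast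
      then have "x = (z \<otimes> p [^] n) \<otimes> p" by (simp add: m_assoc)
      moreover have "z \<otimes> p [^] n \<in> P n" using z unfolding P_mem_iff by blast
      ultimately show "x \<in> ideal_prod R (P n) (PIdl p)"
        using cgenideal_self[OF p_closed] by (simp add: ideal_prod.prod)
    qed
  qed
  finally show ?case .
qed

text \<open>
  The residue classes form an open cover of the ring by disjoint nonempty sets, so a finite
  subcover must contain all of them.
\<close>

lemma compact_imp_finite_residue_ring:
  assumes max: "max_ideal R = PIdl p" and compact: "compact_space (adic_topology R)"
  shows "finite (carrier (R Quot P 1))"
proof -
  interpret ideal "P 1" R by (rule P_ideal)
  let ?B = "{max_ideal_power R n +> x | n x. x \<in> carrier R}"
  have sub: "carrier (R Quot P 1) \<subseteq> ?B"
    unfolding carrier_Quot max_ideal_power_eq[OF max] by blast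
  have op: "openin (adic_topology R) U" if "U \<in> carrier (R Quot P 1)" for U
    unfolding adic_topology_def by (rule topology_generated_by_Basis) (use that sub in blast)
  have "topspace (adic_topology R) \<subseteq> carrier R"
  proof -
    have "P n +> x \<subseteq> carrier R" if "x \<in> carrier R" for n x
      by (rule a_r_coset_subset_G[OF additive_subgroup.a_subset[OF ideal.axioms(1)[OF P_ideal]] that])
    then show ?thesis
      unfolding adic_topology_def max_ideal_power_eq[OF max] by auto
  qed
  also have "\<dots> \<subseteq> \<Union> (carrier (R Quot P 1))"
    unfolding carrier_Quot using a_rcos_self by blast
  finally obtain F where F: "finite F" "F \<subseteq> carrier (R Quot P 1)" "topspace (adic_topology R) \<subseteq> \<Union>F"
    using compact[unfolded compact_space_alt, rule_format, of "carrier (R Quot P 1)"] op by auto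
  have "carrier R \<subseteq> topspace (adic_topology R)"
  proof
    fix x assume x: "x \<in> carrier R"
    then have "openin (adic_topology R) (P 1 +> x)" unfolding carrier_Quot by (intro op) (simp add: carrier_Quot)
    then show "x \<in> topspace (adic_topology R)" using openin_subset a_rcos_self[OF x] by blast
  qed
  then have cov: "carrier R \<subseteq> \<Union>F" using F(3) by blast
  have "carrier (R Quot P 1) \<subseteq> F"
  proof
    fix C assume "C \<in> carrier (R Quot P 1)"
    then obtain x where x: "x \<in> carrier R" "C = P 1 +> x" unfolding carrier_Quot by blast
    then obtain D where D: "D \<in> F" "x \<in> D" using cov by blast
    then obtain y where y: "y \<in> carrier R" "D = P 1 +> y" using F(2) unfolding carrier_Quot by blast
    then have "D = C" using D(2) x(2) a_repr_independence'[of x y] by simp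
    then show "C \<in> F" using D(1) by simp
  qed
  then show ?thesis using F(1) by (rule finite_subset)
qed

end

section \<open>Coordinates on extended modules\<close>

text \<open>
  A module with a basis \<open>b\<close> indexed by the finite set \<open>J\<close> and the dual system \<open>\<kappa>\<close> of coordinate
  functionals. Keeping the functionals as data makes the passage to dual modules symmetric: there
  the roles of \<open>b\<close> and \<open>\<kappa>\<close> are exchanged. Arbitrary index sets allow disjoint unions as index sets of
  direct sums.
\<close>

locale based_module = Module.module R U for R (structure) and U (structure) +
  fixes J :: "'i set" and b :: "'i \<Rightarrow> 'm" and \<kappa> :: "'i \<Rightarrow> 'm \<Rightarrow> 'a"
  constrains R :: "('a, 'x) ring_scheme" and U :: "('a, 'm) module"
  assumes finite_index: "finite J"
    and basis_closed: "i \<in> J \<Longrightarrow> b i \<in> carrier U"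
    and coord_linear: "i \<in> J \<Longrightarrow> \<kappa> i \<in> linear_maps R U (ring_as_module R)"
    and coord_basis: "i \<in> J \<Longrightarrow> j \<in> J \<Longrightarrow> \<kappa> i (b j) = (if j = i then \<one> else \<zero>)"
    and basis_expansion: "u \<in> carrier U \<Longrightarrow> u = (\<Oplus>\<^bsub>U\<^esub>i\<in>J. \<kappa> i u \<odot>\<^bsub>U\<^esub> b i)"

lemma linear_functional_simps:
  fixes R :: "('a, 'x) ring_scheme" (structure) and M :: "('a, 'm) module"
  assumes "f \<in> linear_maps R M (ring_as_module R)"
  shows "x \<in> carrier M \<Longrightarrow> f x \<in> carrier R"
    and "x \<in> carrier M \<Longrightarrow> y \<in> carrier M \<Longrightarrow> f (x \<oplus>\<^bsub>M\<^esub> y) = f x \<oplus> f y"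
    and "r \<in> carrier R \<Longrightarrow> x \<in> carrier M \<Longrightarrow> f (r \<odot>\<^bsub>M\<^esub> x) = r \<otimes> f x"
  using assms by (auto simp: linear_maps_def ring_as_module_def)

lemma linear_functional_finsum:
  fixes R :: "('a, 'x) ring_scheme" (structure) and M :: "('a, 'm) module" (structure)
  assumes "Module.module R M" and f: "f \<in> linear_maps R M (ring_as_module R)" and fin: "finite J"
    and c: "c \<in> J \<rightarrow> carrier R" and b: "b \<in> J \<rightarrow> carrier M"
  shows "f (\<Oplus>\<^bsub>M\<^esub>j\<in>J. c j \<odot>\<^bsub>M\<^esub> b j) = dot R J c (\<lambda>j. f (b j))"
proof -
  interpret Module.module R M by fact
  show ?thesis
    using fin c b unfolding dot_def
  proof (induction J rule: finite_induct)
    case empty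
    have "f \<zero>\<^bsub>M\<^esub> = f (\<zero> \<odot>\<^bsub>M\<^esub> \<zero>\<^bsub>M\<^esub>)" by simp
    also have "\<dots> = \<zero> \<otimes> f \<zero>\<^bsub>M\<^esub>" by (rule linear_functional_simps(3)[OF f]) auto
    also have "\<dots> = \<zero>" by (rule R.l_null) (rule linear_functional_simps(1)[OF f], simp)
    finally show ?case by simp
  next
    case (insert i J)
    then have mem: "c i \<in> carrier R" "b i \<in> carrier M" "c \<in> J \<rightarrow> carrier R" "b \<in> J \<rightarrow> carrier M" by auto
    then have s: "(\<lambda>j. c j \<odot>\<^bsub>M\<^esub> b j) \<in> J \<rightarrow> carrier M" by auto
    have t: "(\<lambda>j. c j \<otimes> f (b j)) \<in> J \<rightarrow> carrier R" using mem linear_functional_simps(1)[OF f] by auto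
    show ?case
      using insert mem s t linear_functional_simps[OF f] M.finsum_closed[OF s]
      by (simp add: M.finsum_insert R.finsum_insert)
  qed
qed

lemma (in based_module) is_module: "Module.module R U"
  by unfold_locales

lemma (in based_module) linear_functional_expansion:
  assumes f: "f \<in> linear_maps R U (ring_as_module R)" and u: "u \<in> carrier U"
  shows "f u = dot R J (\<lambda>i. \<kappa> i u) (\<lambda>i. f (b i))"
proof -
  have "f u = f (\<Oplus>\<^bsub>U\<^esub>i\<in>J. \<kappa> i u \<odot>\<^bsub>U\<^esub> b i)" using basis_expansion[OF u] by simp
  also have "\<dots> = dot R J (\<lambda>i. \<kappa> i u) (\<lambda>i. f (b i))"
    by (rule linear_functional_finsum[OF is_module f finite_index])
      (use linear_functional_simps(1)[OF coord_linear] u basis_closed in auto)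
  finally show ?thesis .
qed

locale based_extension = based_module R U J b \<kappa> + A: cring A + \<phi>: ring_hom_ring R A \<phi>
  for R :: "('a, 'x) ring_scheme" (structure) and U :: "('a, 'm) module" (structure)
    and J :: "'i set" and b and \<kappa> and A :: "('b, 'y) ring_scheme" (structure) and \<phi> :: "'a \<Rightarrow> 'b"
begin

abbreviation "F \<equiv> tensor_free U A"
abbreviation "T \<equiv> tensor_rel_subgroup R A \<phi> U"

lemma F_mem_iff: "f \<in> carrier F \<longleftrightarrow> Poly_Mapping.keys f \<subseteq> carrier U \<times> carrier A"
  by (simp add: tensor_free_def)

lemma F_mult: "f \<otimes>\<^bsub>F\<^esub> g = f + g"
  by (simp add: tensor_free_def)

lemma F_one: "\<one>\<^bsub>F\<^esub> = 0"
  by (simp add: tensor_free_def)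

lemma F_comm_group: "comm_group F"
  unfolding tensor_free_def by (rule abelian_free_Abelian_group)

lemma F_inv: "f \<in> carrier F \<Longrightarrow> inv\<^bsub>F\<^esub> f = - f"
  unfolding F_mem_iff by (simp add: tensor_free_def)

lemma F_of [simp, intro]: "u \<in> carrier U \<Longrightarrow> a \<in> carrier A \<Longrightarrow> frag_of (u, a) \<in> carrier F"
  by (simp add: tensor_free_def)

lemma F_zero [simp, intro]: "0 \<in> carrier F"
  by (simp add: F_mem_iff)

lemma F_add [intro]: "f \<in> carrier F \<Longrightarrow> g \<in> carrier F \<Longrightarrow> f + g \<in> carrier F"
  unfolding F_mem_iff using keys_add[of f g] by blast

lemma F_diff [intro]: "f \<in> carrier F \<Longrightarrow> g \<in> carrier F \<Longrightarrow> f - g \<in> carrier F"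
  unfolding F_mem_iff using keys_diff[of f g] by blast

lemma F_sum [intro]: "(\<And>i. i \<in> S \<Longrightarrow> f i \<in> carrier F) \<Longrightarrow> (\<Sum>i\<in>S. f i) \<in> carrier F"
  by (induction S rule: infinite_finite_induct) (auto intro: F_add)

lemma relators_closed: "tensor_relators R A \<phi> U \<subseteq> carrier F"
  unfolding tensor_relators_def
  by (auto intro!: F_diff F_of)

lemma relations_subgroup: "subgroup T F"
proof -
  interpret F: comm_group F by (rule F_comm_group)
  show ?thesis unfolding tensor_rel_subgroup_def by (rule F.generate_is_subgroup[OF relators_closed])
qed

lemma relations_closed: "f \<in> T \<Longrightarrow> f \<in> carrier F"
  using subgroup.mem_carrier[OF relations_subgroup] .

lemma relations_zero: "0 \<in> T"
  using subgroup.one_closed[OF relations_subgroup] by (simp add: F_one)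

lemma relations_add: "f \<in> T \<Longrightarrow> g \<in> T \<Longrightarrow> f + g \<in> T"
  using subgroup.m_closed[OF relations_subgroup] by (simp add: F_mult)

lemma relations_neg: "f \<in> T \<Longrightarrow> - f \<in> T"
  using subgroup.m_inv_closed[OF relations_subgroup, of f] F_inv[OF relations_closed, of f] by simp

lemma relations_diff: "f \<in> T \<Longrightarrow> g \<in> T \<Longrightarrow> f - g \<in> T"
  using relations_add[of f "- g"] relations_neg[of g] by simp

lemma relations_sum: "(\<And>i. i \<in> S \<Longrightarrow> f i \<in> T) \<Longrightarrow> (\<Sum>i\<in>S. f i) \<in> T"
  by (induction S rule: infinite_finite_induct) (auto intro: relations_add relations_zero)

lemma relations_relator: "f \<in> tensor_relators R A \<phi> U \<Longrightarrow> f \<in> T"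
  unfolding tensor_rel_subgroup_def by (rule generate.incl)

lemma relations_add_left:
  assumes "u \<in> carrier U" "u' \<in> carrier U" "a \<in> carrier A"
  shows "frag_of (u \<oplus>\<^bsub>U\<^esub> u', a) - frag_of (u, a) - frag_of (u', a) \<in> T"
  by (rule relations_relator) (use assms in \<open>auto simp: tensor_relators_def\<close>)

lemma relations_add_right:
  assumes "u \<in> carrier U" "a \<in> carrier A" "a' \<in> carrier A"
  shows "frag_of (u, a \<oplus>\<^bsub>A\<^esub> a') - frag_of (u, a) - frag_of (u, a') \<in> T"
  by (rule relations_relator) (use assms in \<open>auto simp: tensor_relators_def\<close>)

lemma relations_smult:
  assumes "r \<in> carrier R" "u \<in> carrier U" "a \<in> carrier A"
  shows "frag_of (r \<odot>\<^bsub>U\<^esub> u, a) - frag_of (u, \<phi> r \<otimes>\<^bsub>A\<^esub> a) \<in> T"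
  by (rule relations_relator) (use assms in \<open>auto simp: tensor_relators_def\<close>)

lemma relations_zero_left: "a \<in> carrier A \<Longrightarrow> frag_of (\<zero>\<^bsub>U\<^esub>, a) \<in> T"
  using relations_neg[OF relations_add_left[of "\<zero>\<^bsub>U\<^esub>" "\<zero>\<^bsub>U\<^esub>" a]] by simp

lemma relations_zero_right: "u \<in> carrier U \<Longrightarrow> frag_of (u, \<zero>\<^bsub>A\<^esub>) \<in> T"
  using relations_neg[OF relations_add_right[of u "\<zero>\<^bsub>A\<^esub>" "\<zero>\<^bsub>A\<^esub>"]] by simp

lemma relations_diff_right:
  assumes "u \<in> carrier U" "a \<in> carrier A" "a' \<in> carrier A"
  shows "frag_of (u, a) - frag_of (u, a') - frag_of (u, a \<ominus>\<^bsub>A\<^esub> a') \<in> T"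
proof -
  have "(a \<ominus>\<^bsub>A\<^esub> a') \<oplus>\<^bsub>A\<^esub> a' = a"
    using assms by (simp add: A.minus_eq A.a_assoc A.l_neg)
  then show ?thesis using relations_add_right[of u "a \<ominus>\<^bsub>A\<^esub> a'" a'] assms by (simp add: algebra_simps)
qed

lemma relations_finsum_left:
  assumes "finite S" "v \<in> S \<rightarrow> carrier U" "a \<in> carrier A"
  shows "frag_of (\<Oplus>\<^bsub>U\<^esub>i\<in>S. v i, a) - (\<Sum>i\<in>S. frag_of (v i, a)) \<in> T"
  using assms
proof (induction S rule: finite_induct)
  case empty
  then show ?case by (simp add: relations_zero_left)
next
  case (insert i S)
  then have "(\<Oplus>\<^bsub>U\<^esub>i\<in>S. v i) \<in> carrier U" by (intro M.finsum_closed) auto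
  then have "frag_of (v i \<oplus>\<^bsub>U\<^esub> (\<Oplus>\<^bsub>U\<^esub>i\<in>S. v i), a) - frag_of (v i, a) - frag_of (\<Oplus>\<^bsub>U\<^esub>i\<in>S. v i, a) \<in> T"
    using insert.prems by (intro relations_add_left) auto
  from relations_add[OF this insert.IH] show ?case
    using insert by (simp add: M.finsum_insert algebra_simps)
qed

text \<open>
  The extension of the \<open>i\<close>-th coordinate functional to formal sums of pairs \<open>(u, a)\<close>, obtained
  from the universal property of the free abelian group.
\<close>

definition ecoord :: "'i \<Rightarrow> ('m \<times> 'b \<Rightarrow>\<^sub>0 int) \<Rightarrow> 'b" where
  "ecoord i = (SOME h. h \<in> hom F (add_monoid A) \<and>
     (\<forall>u\<in>carrier U. \<forall>a\<in>carrier A. h (frag_of (u, a)) = \<phi> (\<kappa> i u) \<otimes>\<^bsub>A\<^esub> a))"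

lemma coord_closed: "i \<in> J \<Longrightarrow> u \<in> carrier U \<Longrightarrow> \<kappa> i u \<in> carrier R"
  using linear_functional_simps(1)[OF coord_linear] by blast

lemma ecoord:
  assumes i: "i \<in> J"
  shows "ecoord i \<in> hom F (add_monoid A)"
    and "u \<in> carrier U \<Longrightarrow> a \<in> carrier A \<Longrightarrow> ecoord i (frag_of (u, a)) = \<phi> (\<kappa> i u) \<otimes>\<^bsub>A\<^esub> a"
proof -
  have "(\<lambda>(u, a). \<phi> (\<kappa> i u) \<otimes>\<^bsub>A\<^esub> a) ` (carrier U \<times> carrier A) \<subseteq> carrier (add_monoid A)"
    using coord_closed[OF i] by auto
  then obtain h where "h \<in> hom F (add_monoid A)"
    "\<And>x. x \<in> carrier U \<times> carrier A \<Longrightarrow> h (frag_of x) = (\<lambda>(u, a). \<phi> (\<kappa> i u) \<otimes>\<^bsub>A\<^esub> a) x"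
    by (rule comm_group.free_Abelian_group_universal[OF A.a_comm_group,
          where S = "carrier U \<times> carrier A", folded tensor_free_def]) (rule that, assumption, blast)
  then have "\<exists>h. h \<in> hom F (add_monoid A) \<and>
     (\<forall>u\<in>carrier U. \<forall>a\<in>carrier A. h (frag_of (u, a)) = \<phi> (\<kappa> i u) \<otimes>\<^bsub>A\<^esub> a)" by auto
  then have *: "ecoord i \<in> hom F (add_monoid A) \<and>
     (\<forall>u\<in>carrier U. \<forall>a\<in>carrier A. ecoord i (frag_of (u, a)) = \<phi> (\<kappa> i u) \<otimes>\<^bsub>A\<^esub> a)"
    unfolding ecoord_def by (rule someI_ex)
  then show "ecoord i \<in> hom F (add_monoid A)" by blast
  show "u \<in> carrier U \<Longrightarrow> a \<in> carrier A \<Longrightarrow> ecoord i (frag_of (u, a)) = \<phi> (\<kappa> i u) \<otimes>\<^bsub>A\<^esub> a"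
    using * by blast
qed

lemma ecoord_closed [intro]: "i \<in> J \<Longrightarrow> f \<in> carrier F \<Longrightarrow> ecoord i f \<in> carrier A"
  using hom_in_carrier[OF ecoord(1)] by force

lemma ecoord_add:
  "i \<in> J \<Longrightarrow> f \<in> carrier F \<Longrightarrow> g \<in> carrier F \<Longrightarrow> ecoord i (f + g) = ecoord i f \<oplus>\<^bsub>A\<^esub> ecoord i g"
  using hom_mult[OF ecoord(1)] by (simp add: F_mult)

lemma ecoord_group_hom: "i \<in> J \<Longrightarrow> group_hom F (add_monoid A) (ecoord i)"
  using F_comm_group A.a_comm_group ecoord(1)
  by (simp add: group_hom_def group_hom_axioms_def comm_group_def)

lemma ecoord_zero: "i \<in> J \<Longrightarrow> ecoord i 0 = \<zero>\<^bsub>A\<^esub>"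
  using group_hom.hom_one[OF ecoord_group_hom] by (simp add: F_one)

lemma ecoord_diff:
  assumes "i \<in> J" "f \<in> carrier F" "g \<in> carrier F"
  shows "ecoord i (f - g) = ecoord i f \<ominus>\<^bsub>A\<^esub> ecoord i g"
proof -
  have "ecoord i f = ecoord i (f - g) \<oplus>\<^bsub>A\<^esub> ecoord i g"
    using ecoord_add[of i "f - g" g] assms by (simp add: F_diff)
  then show ?thesis
    using assms ecoord_closed F_diff by (simp add: A.minus_eq A.a_assoc A.r_neg)
qed

lemma ecoord_relator:
  assumes i: "i \<in> J" and f: "f \<in> tensor_relators R A \<phi> U"
  shows "ecoord i f = \<zero>\<^bsub>A\<^esub>"
proof -
  have diff3: "(x \<oplus>\<^bsub>A\<^esub> y) \<ominus>\<^bsub>A\<^esub> x \<ominus>\<^bsub>A\<^esub> y = \<zero>\<^bsub>A\<^esub>" if "x \<in> carrier A" "y \<in> carrier A" for x y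
    using that by (simp add: A.a_comm[of x y]) (simp add: A.minus_eq A.a_assoc A.r_neg)
  note lin = linear_functional_simps[OF coord_linear[OF i]]
  from f consider
    (1) u u' a where "f = frag_of (u \<oplus>\<^bsub>U\<^esub> u', a) - frag_of (u, a) - frag_of (u', a)"
      "u \<in> carrier U" "u' \<in> carrier U" "a \<in> carrier A"
  | (2) u a a' where "f = frag_of (u, a \<oplus>\<^bsub>A\<^esub> a') - frag_of (u, a) - frag_of (u, a')"
      "u \<in> carrier U" "a \<in> carrier A" "a' \<in> carrier A"
  | (3) r u a where "f = frag_of (r \<odot>\<^bsub>U\<^esub> u, a) - frag_of (u, \<phi> r \<otimes>\<^bsub>A\<^esub> a)"
      "r \<in> carrier R" "u \<in> carrier U" "a \<in> carrier A"
    unfolding tensor_relators_def by blast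
  then show ?thesis
  proof cases
    case 1
    then show ?thesis using i lin
      by (simp add: ecoord_diff F_diff ecoord(2) A.l_distr diff3)
  next
    case 2
    then show ?thesis using i lin
      by (simp add: ecoord_diff F_diff ecoord(2) A.r_distr diff3)
  next
    case 3
    then show ?thesis using i lin
      by (simp add: ecoord_diff ecoord(2) A.m_ac A.minus_eq A.r_neg)
  qed
qed

lemma ecoord_relations:
  assumes i: "i \<in> J" and f: "f \<in> T"
  shows "ecoord i f = \<zero>\<^bsub>A\<^esub>"
proof -
  interpret h: group_hom F "add_monoid A" "ecoord i" by (rule ecoord_group_hom[OF i])
  have "T \<subseteq> kernel F (add_monoid A) (ecoord i)"
    unfolding tensor_rel_subgroup_def
    by (rule h.G.generate_subgroup_incl[OF _ h.subgroup_kernel])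
      (use relators_closed ecoord_relator[OF i] in \<open>auto simp: kernel_def\<close>)
  then show ?thesis using f by (auto simp: kernel_def)
qed

text \<open>
  Every tensor is a sum of elements \<open>b i \<otimes> a\<^sub>i\<close>: expand \<open>u\<close> in the basis and move the scalars
  to the second factor.
\<close>

lemma normal_form:
  assumes "f \<in> carrier F"
  shows "f - (\<Sum>i\<in>J. frag_of (b i, ecoord i f)) \<in> T"
proof -
  have "Poly_Mapping.keys f \<subseteq> carrier U \<times> carrier A" using assms by (simp add: F_mem_iff)
  then show ?thesis
  proof (rule free_Abelian_group_induct)
    have "(\<Sum>i\<in>J. frag_of (b i, ecoord i 0)) \<in> T"
      by (intro relations_sum) (simp add: ecoord_zero relations_zero_right basis_closed)
    then show "0 - (\<Sum>i\<in>J. frag_of (b i, ecoord i 0)) \<in> T" using relations_neg by simp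
  next
    fix x y :: "'m \<times> 'b \<Rightarrow>\<^sub>0 int"
    assume k: "Poly_Mapping.keys x \<subseteq> carrier U \<times> carrier A" "Poly_Mapping.keys y \<subseteq> carrier U \<times> carrier A"
    assume x: "x - (\<Sum>i\<in>J. frag_of (b i, ecoord i x)) \<in> T" and y: "y - (\<Sum>i\<in>J. frag_of (b i, ecoord i y)) \<in> T"
    have xy: "x \<in> carrier F" "y \<in> carrier F" using k by (simp_all add: F_mem_iff)
    have "(\<Sum>i\<in>J. frag_of (b i, ecoord i x) - frag_of (b i, ecoord i y) - frag_of (b i, ecoord i (x - y))) \<in> T"
      by (intro relations_sum) (use xy in \<open>simp add: ecoord_diff relations_diff_right basis_closed ecoord_closed\<close>)
    then have "(\<Sum>i\<in>J. frag_of (b i, ecoord i x)) - (\<Sum>i\<in>J. frag_of (b i, ecoord i y))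
        - (\<Sum>i\<in>J. frag_of (b i, ecoord i (x - y))) \<in> T"
      by (simp only: sum_subtractf)
    from relations_add[OF relations_diff[OF x y] this]
    show "(x - y) - (\<Sum>i\<in>J. frag_of (b i, ecoord i (x - y))) \<in> T"
      by (simp add: algebra_simps)
  next
    fix p assume "p \<in> carrier U \<times> carrier A"
    then obtain u a where p: "p = (u, a)" and u: "u \<in> carrier U" and a: "a \<in> carrier A" by auto
    have "frag_of (\<Oplus>\<^bsub>U\<^esub>i\<in>J. \<kappa> i u \<odot>\<^bsub>U\<^esub> b i, a) - (\<Sum>i\<in>J. frag_of (\<kappa> i u \<odot>\<^bsub>U\<^esub> b i, a)) \<in> T"
      by (rule relations_finsum_left[OF finite_index]) (use u a coord_closed basis_closed in auto)
    then have 1: "frag_of (u, a) - (\<Sum>i\<in>J. frag_of (\<kappa> i u \<odot>\<^bsub>U\<^esub> b i, a)) \<in> T"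
      using basis_expansion[OF u] by simp
    have 2: "(\<Sum>i\<in>J. frag_of (\<kappa> i u \<odot>\<^bsub>U\<^esub> b i, a) - frag_of (b i, \<phi> (\<kappa> i u) \<otimes>\<^bsub>A\<^esub> a)) \<in> T"
      by (intro relations_sum relations_smult) (use u a coord_closed basis_closed in auto)
    have "(\<Sum>i\<in>J. frag_of (b i, ecoord i (frag_of p))) = (\<Sum>i\<in>J. frag_of (b i, \<phi> (\<kappa> i u) \<otimes>\<^bsub>A\<^esub> a))"
      by (rule sum.cong) (simp_all add: p ecoord(2) u a)
    then show "frag_of p - (\<Sum>i\<in>J. frag_of (b i, ecoord i (frag_of p))) \<in> T"
      using relations_add[OF 1 2] by (simp add: p sum_subtractf)
  qed
qed

text \<open>
  The relations lie in the kernel of every coordinate, and conversely the normal form is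
  determined by the coordinates. This is what makes the tensor product of a free module concrete.
\<close>

lemma relations_iff:
  assumes f: "f \<in> carrier F" and g: "g \<in> carrier F"
  shows "g - f \<in> T \<longleftrightarrow> (\<forall>i\<in>J. ecoord i g = ecoord i f)"
proof
  assume T: "g - f \<in> T"
  show "\<forall>i\<in>J. ecoord i g = ecoord i f"
  proof
    fix i assume i: "i \<in> J"
    have "ecoord i g = ecoord i (g - f) \<oplus>\<^bsub>A\<^esub> ecoord i f"
      using ecoord_add[OF i F_diff[OF g f] f] by simp
    then show "ecoord i g = ecoord i f" using ecoord_relations[OF i T] i f by (simp add: ecoord_closed)
  qed
next
  assume "\<forall>i\<in>J. ecoord i g = ecoord i f"
  then have "(\<Sum>i\<in>J. frag_of (b i, ecoord i g)) = (\<Sum>i\<in>J. frag_of (b i, ecoord i f))" by simp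
  then show "g - f \<in> T" using relations_diff[OF normal_form[OF g] normal_form[OF f]] by simp
qed

lemma tensor_class_eq:
  assumes f: "f \<in> carrier F"
  shows "tensor_class R A \<phi> U f = {g \<in> carrier F. \<forall>i\<in>J. ecoord i g = ecoord i f}"
proof -
  have "tensor_class R A \<phi> U f = {g \<in> carrier F. g - f \<in> T}"
    unfolding tensor_class_def r_coset_def using f relations_closed
    by (auto simp: F_mult intro: F_add intro!: bexI[where x = "_ - f"])
  then show ?thesis using relations_iff[OF f] by auto
qed

end

context based_extension begin

abbreviation "UA \<equiv> extend_module R A \<phi> U"

text \<open>
  The coordinates are constant on each class, so any representative may be chosen.
\<close>

definition vcoord :: "('m \<times> 'b \<Rightarrow>\<^sub>0 int) set \<Rightarrow> 'i \<Rightarrow> 'b" where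
  "vcoord \<xi> = (\<lambda>i\<in>J. ecoord i (SOME f. f \<in> \<xi>))"

lemma extend_carrier: "carrier UA = tensor_class R A \<phi> U ` carrier F"
  unfolding extend_module_def Let_def tensor_class_def
  by (auto simp: FactGroup_def RCOSETS_def)

lemma mem_extend_carrier:
  assumes "\<xi> \<in> carrier UA" "f \<in> \<xi>"
  shows "f \<in> carrier F" "\<xi> = tensor_class R A \<phi> U f"
  using assms tensor_class_eq unfolding extend_carrier by auto

lemma tensor_class_closed: "f \<in> carrier F \<Longrightarrow> tensor_class R A \<phi> U f \<in> carrier UA"
  by (simp add: extend_carrier)

lemma tensor_class_self: "f \<in> carrier F \<Longrightarrow> f \<in> tensor_class R A \<phi> U f"
  by (simp add: tensor_class_eq)

lemma vcoord_class:
  assumes f: "f \<in> carrier F"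
  shows "vcoord (tensor_class R A \<phi> U f) = (\<lambda>i\<in>J. ecoord i f)"
proof -
  have "(SOME g. g \<in> tensor_class R A \<phi> U f) \<in> tensor_class R A \<phi> U f"
    by (rule someI) (rule tensor_class_self[OF f])
  then show ?thesis
    unfolding vcoord_def tensor_class_eq[OF f] by (intro restrict_ext) simp
qed

lemma vcoord_mem:
  assumes "\<xi> \<in> carrier UA" "f \<in> \<xi>"
  shows "vcoord \<xi> = (\<lambda>i\<in>J. ecoord i f)"
  using vcoord_class mem_extend_carrier[OF assms] by metis

lemma ecoord_basis_sum:
  assumes i: "i \<in> J" and v: "v \<in> J \<rightarrow> carrier A"
  shows "ecoord i (\<Sum>k\<in>J. frag_of (b k, v k)) = v i"
proof -
  have "ecoord i (\<Sum>k\<in>S. frag_of (b k, v k)) = dot A S (\<lambda>k. if k = i then \<one>\<^bsub>A\<^esub> else \<zero>\<^bsub>A\<^esub>) v"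
    if "finite S" "S \<subseteq> J" for S
    using that
  proof (induction S rule: finite_induct)
    case empty
    then show ?case by (simp add: ecoord_zero[OF i] dot_def)
  next
    case (insert k S)
    have cl: "frag_of (b j, v j) \<in> carrier F" if "j \<in> insert k S" for j
      using that insert.prems v basis_closed by auto
    have vS: "v j \<in> carrier A" if "j \<in> insert k S" for j
      using that insert.prems v by auto
    have "ecoord i (\<Sum>k\<in>insert k S. frag_of (b k, v k))
        = ecoord i (frag_of (b k, v k)) \<oplus>\<^bsub>A\<^esub> ecoord i (\<Sum>k\<in>S. frag_of (b k, v k))"
      using insert.hyps cl by (simp add: ecoord_add[OF i] F_sum)
    also have "ecoord i (frag_of (b k, v k)) = (if k = i then \<one>\<^bsub>A\<^esub> else \<zero>\<^bsub>A\<^esub>) \<otimes>\<^bsub>A\<^esub> v k"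
      using insert.prems i by (subst ecoord(2)[OF i basis_closed vS]) (auto simp: coord_basis)
    also have "\<dots> \<oplus>\<^bsub>A\<^esub> ecoord i (\<Sum>k\<in>S. frag_of (b k, v k))
        = dot A (insert k S) (\<lambda>k. if k = i then \<one>\<^bsub>A\<^esub> else \<zero>\<^bsub>A\<^esub>) v"
      using insert vS unfolding dot_def by (subst A.finsum_insert) (auto simp: dot_def)
    finally show ?case .
  qed
  from this[OF finite_index subset_refl] show ?thesis using A.dot_unit[OF finite_index i v] by simp
qed

text \<open>
  Injectivity holds because a class is determined by its coordinates; the class of
  \<open>\<Sum>k. b k \<otimes> v k\<close> has the coordinates \<open>v\<close>.
\<close>

lemma vcoord_bij: "bij_betw vcoord (carrier UA) (vectors J A)"
proof (rule bij_betw_imageI)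
  show "inj_on vcoord (carrier UA)"
  proof (rule inj_onI)
    fix \<xi> \<eta> assume "\<xi> \<in> carrier UA" "\<eta> \<in> carrier UA" and eq: "vcoord \<xi> = vcoord \<eta>"
    then obtain f g where f: "f \<in> carrier F" "\<xi> = tensor_class R A \<phi> U f"
      and g: "g \<in> carrier F" "\<eta> = tensor_class R A \<phi> U g"
      unfolding extend_carrier by blast
    have "ecoord i f = ecoord i g" if "i \<in> J" for i
      using fun_cong[OF eq, of i] that by (simp add: f g vcoord_class)
    then show "\<xi> = \<eta>" by (simp add: f g tensor_class_eq)
  qed
  show "vcoord ` carrier UA = vectors J A"
  proof
    show "vcoord ` carrier UA \<subseteq> vectors J A"
      unfolding extend_carrier by (auto simp: vcoord_class vectors_def ecoord_closed)
    show "vectors J A \<subseteq> vcoord ` carrier UA"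
    proof
      fix v assume v: "v \<in> vectors J A"
      then have vJ: "v \<in> J \<rightarrow> carrier A" by (auto simp: vectors_def)
      let ?f = "\<Sum>k\<in>J. frag_of (b k, v k)"
      have f: "?f \<in> carrier F" by (rule F_sum) (use vJ basis_closed in auto)
      have eq: "vcoord (tensor_class R A \<phi> U ?f) = v"
        unfolding vcoord_class[OF f] using v
        by (auto simp: ecoord_basis_sum[OF _ vJ] vectors_def PiE_iff extensional_def)
      have "vcoord (tensor_class R A \<phi> U ?f) \<in> vcoord ` carrier UA"
        by (rule imageI[OF tensor_class_closed[OF f]])
      then show "v \<in> vcoord ` carrier UA" unfolding eq .
    qed
  qed
qed

lemma vcoord_closed: "\<xi> \<in> carrier UA \<Longrightarrow> vcoord \<xi> \<in> vectors J A"
  using vcoord_bij by (rule bij_betw_apply)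

lemma vcoord_inj: "\<xi> \<in> carrier UA \<Longrightarrow> \<eta> \<in> carrier UA \<Longrightarrow> (\<And>i. i \<in> J \<Longrightarrow> vcoord \<xi> i = vcoord \<eta> i) \<Longrightarrow> \<xi> = \<eta>"
  by (rule inj_onD[OF bij_betw_imp_inj_on[OF vcoord_bij]])
    (auto intro!: PiE_ext[OF vcoord_closed[unfolded vectors_def] vcoord_closed[unfolded vectors_def]])

lemma card_extend: "card (carrier UA) = card (carrier A) ^ card J"
  using bij_betw_same_card[OF vcoord_bij] card_vectors[OF finite_index] by simp

lemma relations_normal: "T \<lhd> F"
  using F_comm_group relations_subgroup by (simp add: comm_group.subgroup_imp_normal)

lemma extend_zero: "\<zero>\<^bsub>UA\<^esub> = tensor_class R A \<phi> U 0"
proof -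
  interpret F: comm_group F by (rule F_comm_group)
  have "\<zero>\<^bsub>UA\<^esub> = T" by (simp add: extend_module_def Let_def FactGroup_def)
  also have "\<dots> = T #>\<^bsub>F\<^esub> 0"
    using F.coset_mult_one[of T] subgroup.subset[OF relations_subgroup] by (simp add: F_one)
  finally show ?thesis by (simp add: tensor_class_def)
qed

lemma extend_add:
  assumes "f \<in> carrier F" "g \<in> carrier F"
  shows "tensor_class R A \<phi> U f \<oplus>\<^bsub>UA\<^esub> tensor_class R A \<phi> U g = tensor_class R A \<phi> U (f + g)"
  using normal.rcos_sum[OF relations_normal assms]
  by (simp add: extend_module_def Let_def FactGroup_def tensor_class_def F_mult)

lemma extend_abelian_group: "abelian_group UA"
proof (rule abelian_groupI)
  show "\<zero>\<^bsub>UA\<^esub> \<in> carrier UA" by (simp add: extend_zero tensor_class_closed)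
  fix \<xi> \<eta> assume "\<xi> \<in> carrier UA" "\<eta> \<in> carrier UA"
  then obtain f g where f: "f \<in> carrier F" "\<xi> = tensor_class R A \<phi> U f"
    and g: "g \<in> carrier F" "\<eta> = tensor_class R A \<phi> U g"
    unfolding extend_carrier by blast
  then show "\<xi> \<oplus>\<^bsub>UA\<^esub> \<eta> \<in> carrier UA" by (simp add: extend_add tensor_class_closed F_add)
  show "\<xi> \<oplus>\<^bsub>UA\<^esub> \<eta> = \<eta> \<oplus>\<^bsub>UA\<^esub> \<xi>" using f g by (simp add: extend_add add.commute)
  show "\<zero>\<^bsub>UA\<^esub> \<oplus>\<^bsub>UA\<^esub> \<xi> = \<xi>" using f by (simp add: extend_zero extend_add)
  have "- f \<in> carrier F" using F_diff[of 0 f] f by simp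
  then show "\<exists>y\<in>carrier UA. y \<oplus>\<^bsub>UA\<^esub> \<xi> = \<zero>\<^bsub>UA\<^esub>"
    using f by (intro bexI[of _ "tensor_class R A \<phi> U (- f)"]) (simp_all add: extend_add extend_zero tensor_class_closed)
  fix \<rho> assume "\<rho> \<in> carrier UA"
  then obtain h where "h \<in> carrier F" "\<rho> = tensor_class R A \<phi> U h"
    unfolding extend_carrier by blast
  then show "(\<xi> \<oplus>\<^bsub>UA\<^esub> \<eta>) \<oplus>\<^bsub>UA\<^esub> \<rho> = \<xi> \<oplus>\<^bsub>UA\<^esub> (\<eta> \<oplus>\<^bsub>UA\<^esub> \<rho>)"
    using f g by (simp add: extend_add F_add add.assoc)
qed

lemma vcoord_zero: "i \<in> J \<Longrightarrow> vcoord \<zero>\<^bsub>UA\<^esub> i = \<zero>\<^bsub>A\<^esub>"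
  by (simp add: extend_zero vcoord_class ecoord_zero)

lemma vcoord_add:
  assumes "\<xi> \<in> carrier UA" "\<eta> \<in> carrier UA" "i \<in> J"
  shows "vcoord (\<xi> \<oplus>\<^bsub>UA\<^esub> \<eta>) i = vcoord \<xi> i \<oplus>\<^bsub>A\<^esub> vcoord \<eta> i"
proof -
  obtain f g where "f \<in> carrier F" "\<xi> = tensor_class R A \<phi> U f"
      and "g \<in> carrier F" "\<eta> = tensor_class R A \<phi> U g"
    using assms unfolding extend_carrier by blast
  then show ?thesis using assms(3) by (simp add: extend_add vcoord_class F_add ecoord_add)
qed

lemma vcoord_eq_zero_iff:
  assumes "\<xi> \<in> carrier UA"
  shows "\<xi> = \<zero>\<^bsub>UA\<^esub> \<longleftrightarrow> (\<forall>i\<in>J. vcoord \<xi> i = \<zero>\<^bsub>A\<^esub>)"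
proof
  assume "\<forall>i\<in>J. vcoord \<xi> i = \<zero>\<^bsub>A\<^esub>"
  then show "\<xi> = \<zero>\<^bsub>UA\<^esub>"
    by (intro vcoord_inj[OF assms])
      (simp_all add: vcoord_zero abelian_group.axioms abelian_monoid.zero_closed[OF abelian_group.axioms(1)[OF extend_abelian_group]])
qed (simp add: vcoord_zero)

end

section \<open>Extended representations in coordinates\<close>

text \<open>
  The map \<open>B\<close> is the extended representation in coordinates. It is prescribed only on pure
  tensors (\<open>B_pure\<close>) and required to be compatible with differences in both arguments, which
  suffices because formal sums are generated by pairs under differences. The same locale then
  serves a representation, its bullet and alternating hulls.
\<close>

locale coordinate_form =
  M: based_extension R "rep_par \<theta>" I bm \<kappa>m A \<phi> +
  V: based_extension R "rep_dom \<theta>" J bv \<kappa>v A \<phi> +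
  W: based_extension R "rep_cod \<theta>" K bw \<kappa>w A \<phi>
  for R :: "('a, 'x) ring_scheme" (structure) and \<theta> :: "('a, 'm, 'v, 'w) module_rep"
    and I :: "'i set" and bm \<kappa>m and J :: "'j set" and bv \<kappa>v and K :: "'k set" and bw \<kappa>w
    and A :: "('b, 'y) ring_scheme" (structure) and \<phi> :: "'a \<Rightarrow> 'b" +
  fixes B :: "('i \<Rightarrow> 'b) \<Rightarrow> ('j \<Rightarrow> 'b) \<Rightarrow> 'k \<Rightarrow> 'b"
  assumes map_closed: "\<And>a x. \<lbrakk>a \<in> carrier (rep_par \<theta>); x \<in> carrier (rep_dom \<theta>)\<rbrakk> \<Longrightarrow> rep_map \<theta> a x \<in> carrier (rep_cod \<theta>)"
    and B_closed: "\<And>a x k. \<lbrakk>a \<in> vectors I A; x \<in> vectors J A; k \<in> K\<rbrakk> \<Longrightarrow> B a x k \<in> carrier A"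
    and B_diff_left: "\<And>a a' x k. \<lbrakk>a \<in> vectors I A; a' \<in> vectors I A; x \<in> vectors J A; k \<in> K\<rbrakk> \<Longrightarrow>
        B (\<lambda>i\<in>I. a i \<ominus>\<^bsub>A\<^esub> a' i) x k = B a x k \<ominus>\<^bsub>A\<^esub> B a' x k"
    and B_diff_right: "\<And>a x x' k. \<lbrakk>a \<in> vectors I A; x \<in> vectors J A; x' \<in> vectors J A; k \<in> K\<rbrakk> \<Longrightarrow>
        B a (\<lambda>j\<in>J. x j \<ominus>\<^bsub>A\<^esub> x' j) k = B a x k \<ominus>\<^bsub>A\<^esub> B a x' k"
    and B_pure: "\<And>a x \<alpha> \<beta> k. \<lbrakk>a \<in> carrier (rep_par \<theta>); x \<in> carrier (rep_dom \<theta>); \<alpha> \<in> carrier A; \<beta> \<in> carrier A; k \<in> K\<rbrakk> \<Longrightarrow>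
        B (\<lambda>i\<in>I. \<phi> (\<kappa>m i a) \<otimes>\<^bsub>A\<^esub> \<alpha>) (\<lambda>j\<in>J. \<phi> (\<kappa>v j x) \<otimes>\<^bsub>A\<^esub> \<beta>) k
          = \<phi> (\<kappa>w k (rep_map \<theta> a x)) \<otimes>\<^bsub>A\<^esub> (\<alpha> \<otimes>\<^bsub>A\<^esub> \<beta>)"
begin

abbreviation "Mcoords g \<equiv> (\<lambda>i\<in>I. M.ecoord i g)"
abbreviation "Vcoords f \<equiv> (\<lambda>j\<in>J. V.ecoord j f)"

text \<open>
  The map on formal sums that underlies the extended representation, before passing to
  classes.
\<close>

definition frag_map :: "('m \<times> 'b \<Rightarrow>\<^sub>0 int) \<Rightarrow> ('v \<times> 'b \<Rightarrow>\<^sub>0 int) \<Rightarrow> ('w \<times> 'b \<Rightarrow>\<^sub>0 int)" where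
  "frag_map g f = frag_extend (\<lambda>(a, \<alpha>). frag_extend (\<lambda>(x, \<beta>). frag_of (rep_map \<theta> a x, \<alpha> \<otimes>\<^bsub>A\<^esub> \<beta>)) f) g"

definition evaluates_to :: "('w \<times> 'b \<Rightarrow>\<^sub>0 int) \<Rightarrow> ('i \<Rightarrow> 'b) \<Rightarrow> ('j \<Rightarrow> 'b) \<Rightarrow> bool" where
  "evaluates_to h a x \<longleftrightarrow> h \<in> carrier W.F \<and> (\<forall>k\<in>K. W.ecoord k h = B a x k)"

lemma Mcoords_closed: "g \<in> carrier M.F \<Longrightarrow> Mcoords g \<in> vectors I A"
  by (auto simp: vectors_def)

lemma Vcoords_closed: "f \<in> carrier V.F \<Longrightarrow> Vcoords f \<in> vectors J A"
  by (auto simp: vectors_def)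

lemma B_zero_left:
  assumes "x \<in> vectors J A" "k \<in> K"
  shows "B (\<lambda>i\<in>I. \<zero>\<^bsub>A\<^esub>) x k = \<zero>\<^bsub>A\<^esub>"
proof -
  have z: "(\<lambda>i\<in>I. \<zero>\<^bsub>A\<^esub>) \<in> vectors I A" by (auto simp: vectors_def)
  have "(\<lambda>i\<in>I. (\<lambda>i\<in>I. \<zero>\<^bsub>A\<^esub>) i \<ominus>\<^bsub>A\<^esub> (\<lambda>i\<in>I. \<zero>\<^bsub>A\<^esub>) i) = (\<lambda>i\<in>I. \<zero>\<^bsub>A\<^esub>)"
    by (rule restrict_ext) (simp add: M.A.minus_eq)
  then show ?thesis using B_diff_left[OF z z assms] B_closed[OF z assms]
    by (simp add: M.A.minus_eq M.A.r_neg)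
qed

lemma B_zero_right:
  assumes "a \<in> vectors I A" "k \<in> K"
  shows "B a (\<lambda>j\<in>J. \<zero>\<^bsub>A\<^esub>) k = \<zero>\<^bsub>A\<^esub>"
proof -
  have z: "(\<lambda>j\<in>J. \<zero>\<^bsub>A\<^esub>) \<in> vectors J A" by (auto simp: vectors_def)
  have "(\<lambda>j\<in>J. (\<lambda>j\<in>J. \<zero>\<^bsub>A\<^esub>) j \<ominus>\<^bsub>A\<^esub> (\<lambda>j\<in>J. \<zero>\<^bsub>A\<^esub>) j) = (\<lambda>j\<in>J. \<zero>\<^bsub>A\<^esub>)"
    by (rule restrict_ext) (simp add: M.A.minus_eq)
  then show ?thesis using B_diff_right[OF assms(1) z z assms(2)] B_closed[OF assms(1) z assms(2)]
    by (simp add: M.A.minus_eq M.A.r_neg)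
qed

lemma Mcoords_diff:
  assumes "g \<in> carrier M.F" "g' \<in> carrier M.F"
  shows "Mcoords (g - g') = (\<lambda>i\<in>I. Mcoords g i \<ominus>\<^bsub>A\<^esub> Mcoords g' i)"
  by (rule restrict_ext) (simp add: M.ecoord_diff assms)

lemma Vcoords_diff:
  assumes "g \<in> carrier V.F" "g' \<in> carrier V.F"
  shows "Vcoords (g - g') = (\<lambda>i\<in>J. Vcoords g i \<ominus>\<^bsub>A\<^esub> Vcoords g' i)"
  by (rule restrict_ext) (simp add: V.ecoord_diff assms)

lemma evaluates_to_diff:
  assumes "evaluates_to h a x" "evaluates_to h' a' x'"
    and "\<And>k. k \<in> K \<Longrightarrow> B a'' x'' k = B a x k \<ominus>\<^bsub>A\<^esub> B a' x' k"
  shows "evaluates_to (h - h') a'' x''"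
  using assms unfolding evaluates_to_def by (auto simp: W.ecoord_diff)

lemma frag_map_pure_left:
  assumes a: "a \<in> carrier (rep_par \<theta>)" and \<alpha>: "\<alpha> \<in> carrier A" and f: "f \<in> carrier V.F"
  shows "evaluates_to (frag_map (frag_of (a, \<alpha>)) f) (Mcoords (frag_of (a, \<alpha>))) (Vcoords f)"
proof -
  let ?v = "Mcoords (frag_of (a, \<alpha>))"
  have g: "?v \<in> vectors I A" using a \<alpha> by (intro Mcoords_closed) auto
  have gc: "?v = (\<lambda>i\<in>I. \<phi> (\<kappa>m i a) \<otimes>\<^bsub>A\<^esub> \<alpha>)"
    by (rule restrict_ext) (simp add: M.ecoord(2) a \<alpha>)
  define h where "h = frag_map (frag_of (a, \<alpha>))"
  have h: "h f = frag_extend (\<lambda>(x, \<beta>). frag_of (rep_map \<theta> a x, \<alpha> \<otimes>\<^bsub>A\<^esub> \<beta>)) f" for f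
    by (simp add: h_def frag_map_def)
  have "Poly_Mapping.keys f \<subseteq> carrier (rep_dom \<theta>) \<times> carrier A" using f by (simp add: V.F_mem_iff)
  then have "evaluates_to (h f) ?v (Vcoords f)"
  proof (rule free_Abelian_group_induct)
    have "Vcoords 0 = (\<lambda>j\<in>J. \<zero>\<^bsub>A\<^esub>)" by (rule restrict_ext) (simp add: V.ecoord_zero)
    then show "evaluates_to (h 0) ?v (Vcoords 0)"
      using g by (simp add: evaluates_to_def h W.ecoord_zero B_zero_right)
  next
    fix x y :: "'v \<times> 'b \<Rightarrow>\<^sub>0 int"
    assume k: "Poly_Mapping.keys x \<subseteq> carrier (rep_dom \<theta>) \<times> carrier A"
      "Poly_Mapping.keys y \<subseteq> carrier (rep_dom \<theta>) \<times> carrier A"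
    assume x: "evaluates_to (h x) ?v (Vcoords x)" and y: "evaluates_to (h y) ?v (Vcoords y)"
    have xy: "x \<in> carrier V.F" "y \<in> carrier V.F" using k by (simp_all add: V.F_mem_iff)
    have hd: "h (x - y) = h x - h y" by (simp add: h frag_extend_diff)
    show "evaluates_to (h (x - y)) ?v (Vcoords (x - y))"
      unfolding hd Vcoords_diff[OF xy]
      by (rule evaluates_to_diff[OF x y]) (rule B_diff_right[OF g Vcoords_closed[OF xy(1)] Vcoords_closed[OF xy(2)]])
  next
    fix p assume "p \<in> carrier (rep_dom \<theta>) \<times> carrier A"
    then obtain x \<beta> where p: "p = (x, \<beta>)" and x: "x \<in> carrier (rep_dom \<theta>)" and \<beta>: "\<beta> \<in> carrier A" by auto
    have fc: "Vcoords (frag_of p) = (\<lambda>j\<in>J. \<phi> (\<kappa>v j x) \<otimes>\<^bsub>A\<^esub> \<beta>)"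
      by (rule restrict_ext) (simp add: p V.ecoord(2) x \<beta>)
    show "evaluates_to (h (frag_of p)) ?v (Vcoords (frag_of p))"
      unfolding gc fc using a x \<alpha> \<beta> by (simp add: evaluates_to_def h p map_closed B_pure W.ecoord(2))
  qed
  then show ?thesis by (simp add: h_def)
qed

lemma frag_map:
  assumes g: "g \<in> carrier M.F" and f: "f \<in> carrier V.F"
  shows "evaluates_to (frag_map g f) (Mcoords g) (Vcoords f)"
proof -
  have fv: "Vcoords f \<in> vectors J A" by (rule Vcoords_closed[OF f])
  have "Poly_Mapping.keys g \<subseteq> carrier (rep_par \<theta>) \<times> carrier A" using g by (simp add: M.F_mem_iff)
  then show ?thesis
  proof (rule free_Abelian_group_induct)
    have "Mcoords 0 = (\<lambda>j\<in>I. \<zero>\<^bsub>A\<^esub>)" by (rule restrict_ext) (simp add: M.ecoord_zero)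
    then show "evaluates_to (frag_map 0 f) (Mcoords 0) (Vcoords f)"
      using fv by (simp add: evaluates_to_def frag_map_def W.ecoord_zero B_zero_left)
  next
    fix x y :: "'m \<times> 'b \<Rightarrow>\<^sub>0 int"
    assume k: "Poly_Mapping.keys x \<subseteq> carrier (rep_par \<theta>) \<times> carrier A"
      "Poly_Mapping.keys y \<subseteq> carrier (rep_par \<theta>) \<times> carrier A"
    assume x: "evaluates_to (frag_map x f) (Mcoords x) (Vcoords f)"
      and y: "evaluates_to (frag_map y f) (Mcoords y) (Vcoords f)"
    have xy: "x \<in> carrier M.F" "y \<in> carrier M.F" using k by (simp_all add: M.F_mem_iff)
    have hd: "frag_map (x - y) f = frag_map x f - frag_map y f" by (simp add: frag_map_def frag_extend_diff)
    show "evaluates_to (frag_map (x - y) f) (Mcoords (x - y)) (Vcoords f)"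
      unfolding hd Mcoords_diff[OF xy]
      by (rule evaluates_to_diff[OF x y]) (rule B_diff_left[OF Mcoords_closed[OF xy(1)] Mcoords_closed[OF xy(2)] fv])
  next
    fix p assume "p \<in> carrier (rep_par \<theta>) \<times> carrier A"
    then show "evaluates_to (frag_map (frag_of p) f) (Mcoords (frag_of p)) (Vcoords f)"
      using frag_map_pure_left[OF _ _ f] by (cases p) auto
  qed
qed

abbreviation "\<theta>A \<equiv> extend_rep R A \<phi> \<theta>"

lemma extend_rep_simps [simp]:
  "rep_par \<theta>A = M.UA" "rep_dom \<theta>A = V.UA" "rep_cod \<theta>A = W.UA"
  by (simp_all add: extend_rep_def)

text \<open>
  The union over all representatives in the definition of the extended map is a single
  class, since the coordinates of the value depend only on the coordinates of the arguments.
\<close>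

lemma extend_rep_map_eq:
  assumes \<mu>: "\<mu> \<in> carrier M.UA" and \<xi>: "\<xi> \<in> carrier V.UA" and g: "g \<in> \<mu>" and f: "f \<in> \<xi>"
  shows "rep_map \<theta>A \<mu> \<xi> = tensor_class R A \<phi> (rep_cod \<theta>) (frag_map g f)"
proof -
  have "tensor_class R A \<phi> (rep_cod \<theta>) (frag_map g' f') = tensor_class R A \<phi> (rep_cod \<theta>) (frag_map g f)"
    if g': "g' \<in> \<mu>" and f': "f' \<in> \<xi>" for g' f'
  proof -
    have "Mcoords g' = Mcoords g" using M.vcoord_mem[OF \<mu> g] M.vcoord_mem[OF \<mu> g'] by simp
    moreover have "Vcoords f' = Vcoords f" using V.vcoord_mem[OF \<xi> f] V.vcoord_mem[OF \<xi> f'] by simp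
    moreover note frag_map[OF M.mem_extend_carrier(1)[OF \<mu> g] V.mem_extend_carrier(1)[OF \<xi> f]]
      frag_map[OF M.mem_extend_carrier(1)[OF \<mu> g'] V.mem_extend_carrier(1)[OF \<xi> f']]
    ultimately show ?thesis by (simp add: evaluates_to_def W.tensor_class_eq)
  qed
  then have "(\<Union>g'\<in>\<mu>. \<Union>f'\<in>\<xi>. tensor_class R A \<phi> (rep_cod \<theta>) (frag_map g' f'))
      = tensor_class R A \<phi> (rep_cod \<theta>) (frag_map g f)"
    using g f by blast
  then show ?thesis using \<mu> \<xi> by (simp add: extend_rep_def frag_map_def)
qed

lemma extend_rep_map:
  assumes \<mu>: "\<mu> \<in> carrier M.UA" and \<xi>: "\<xi> \<in> carrier V.UA"
  shows "rep_map \<theta>A \<mu> \<xi> \<in> carrier W.UA"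
    and "k \<in> K \<Longrightarrow> W.vcoord (rep_map \<theta>A \<mu> \<xi>) k = B (M.vcoord \<mu>) (V.vcoord \<xi>) k"
proof -
  obtain g f where g: "g \<in> \<mu>" and f: "f \<in> \<xi>"
    using \<mu> \<xi> M.tensor_class_self V.tensor_class_self unfolding M.extend_carrier V.extend_carrier by blast
  note eq = extend_rep_map_eq[OF \<mu> \<xi> g f]
  note fm = frag_map[OF M.mem_extend_carrier(1)[OF \<mu> g] V.mem_extend_carrier(1)[OF \<xi> f]]
  show "rep_map \<theta>A \<mu> \<xi> \<in> carrier W.UA" unfolding eq using fm by (simp add: evaluates_to_def W.tensor_class_closed)
  show "W.vcoord (rep_map \<theta>A \<mu> \<xi>) k = B (M.vcoord \<mu>) (V.vcoord \<xi>) k" if "k \<in> K"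
    unfolding eq using fm that by (simp add: evaluates_to_def W.vcoord_class M.vcoord_mem[OF \<mu> g] V.vcoord_mem[OF \<xi> f])
qed

lemma extend_rep_map_zero_iff:
  assumes "\<mu> \<in> carrier M.UA" "\<xi> \<in> carrier V.UA"
  shows "rep_map \<theta>A \<mu> \<xi> = \<zero>\<^bsub>W.UA\<^esub> \<longleftrightarrow> (\<forall>k\<in>K. B (M.vcoord \<mu>) (V.vcoord \<xi>) k = \<zero>\<^bsub>A\<^esub>)"
  using W.vcoord_eq_zero_iff[OF extend_rep_map(1)[OF assms]] extend_rep_map(2)[OF assms] by simp

lemma ask_extend_rep:
  "ask m \<theta>A = (\<Sum>a\<in>vectors I A. of_nat (card {x \<in> vectors J A. \<forall>k\<in>K. B a x k = \<zero>\<^bsub>A\<^esub>}) ^ m)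
      / of_nat (card (carrier A)) ^ card I"
proof -
  have "card {\<xi> \<in> carrier V.UA. rep_map \<theta>A \<mu> \<xi> = \<zero>\<^bsub>W.UA\<^esub>}
      = card {x \<in> vectors J A. \<forall>k\<in>K. B (M.vcoord \<mu>) x k = \<zero>\<^bsub>A\<^esub>}" if \<mu>: "\<mu> \<in> carrier M.UA" for \<mu>
    by (rule card_filter_bij[OF V.vcoord_bij]) (rule extend_rep_map_zero_iff[OF \<mu>])
  then have "(\<Sum>\<mu>\<in>carrier M.UA. of_nat (card {\<xi> \<in> carrier V.UA. rep_map \<theta>A \<mu> \<xi> = \<zero>\<^bsub>W.UA\<^esub>}) ^ m :: rat)
     = (\<Sum>\<mu>\<in>carrier M.UA. of_nat (card {x \<in> vectors J A. \<forall>k\<in>K. B (M.vcoord \<mu>) x k = \<zero>\<^bsub>A\<^esub>}) ^ m)"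
    by simp
  also have "\<dots> = (\<Sum>a\<in>vectors I A. of_nat (card {x \<in> vectors J A. \<forall>k\<in>K. B a x k = \<zero>\<^bsub>A\<^esub>}) ^ m)"
    by (rule sum.reindex_bij_betw[OF M.vcoord_bij])
  finally show ?thesis by (simp add: ask_def M.card_extend)
qed

end

section \<open>Bases of free modules, of duals and of direct sums\<close>

text \<open>
  Uniqueness of coefficients makes the coordinate functions linear.
\<close>

lemma free_of_rank_imp_based_module:
  fixes R :: "('a, 'x) ring_scheme" (structure) and U :: "('a, 'm) module" (structure)
  assumes "Module.module R U" and free: "free_of_rank R U n"
  shows "\<exists>b \<kappa>. based_module R U {..<n} b \<kappa>"
proof -
  interpret Module.module R U by fact
  obtain b where b: "b \<in> {..<n} \<rightarrow> carrier U"
    and ex1: "\<And>x. x \<in> carrier U \<Longrightarrow>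
      \<exists>!c. c \<in> {..<n} \<rightarrow>\<^sub>E carrier R \<and> x = (\<Oplus>\<^bsub>U\<^esub>i\<in>{..<n}. c i \<odot>\<^bsub>U\<^esub> b i)"
    using free unfolding free_of_rank_def by (elim bexE) (rule that, assumption, erule bspec)
  define comb where "comb c = (\<Oplus>\<^bsub>U\<^esub>i\<in>{..<n}. c i \<odot>\<^bsub>U\<^esub> b i)" for c
  define co where "co x = (THE c. c \<in> {..<n} \<rightarrow>\<^sub>E carrier R \<and> x = comb c)" for x
  have co: "co x \<in> {..<n} \<rightarrow>\<^sub>E carrier R" "x = comb (co x)" if "x \<in> carrier U" for x
    using theI'[OF ex1[OF that]] unfolding co_def comb_def by auto
  have co_unique: "co x = c" if "x \<in> carrier U" "c \<in> {..<n} \<rightarrow>\<^sub>E carrier R" "x = comb c" for x c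
    unfolding co_def comb_def by (rule the1_equality[OF ex1[OF that(1)]]) (use that(2,3) comb_def in simp)
  have bi: "b i \<in> carrier U" if "i < n" for i using b that by auto
  have summand: "(\<lambda>i. c i \<odot>\<^bsub>U\<^esub> b i) \<in> {..<n} \<rightarrow> carrier U" if "c \<in> {..<n} \<rightarrow> carrier R" for c
    using that bi by auto
  have comb_restrict: "comb (\<lambda>i\<in>{..<n}. c i) = comb c" if "c \<in> {..<n} \<rightarrow> carrier R" for c
    unfolding comb_def by (rule M.finsum_cong') (use summand[OF that] in auto)
  have comb_add: "comb (\<lambda>i. c i \<oplus> d i) = comb c \<oplus>\<^bsub>U\<^esub> comb d"
    if "c \<in> {..<n} \<rightarrow> carrier R" "d \<in> {..<n} \<rightarrow> carrier R" for c d
  proof -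
    have "comb (\<lambda>i. c i \<oplus> d i) = (\<Oplus>\<^bsub>U\<^esub>i\<in>{..<n}. c i \<odot>\<^bsub>U\<^esub> b i \<oplus>\<^bsub>U\<^esub> d i \<odot>\<^bsub>U\<^esub> b i)"
      unfolding comb_def by (rule M.finsum_cong') (use that bi in \<open>auto simp: Pi_def smult_l_distr\<close>)
    also have "\<dots> = comb c \<oplus>\<^bsub>U\<^esub> comb d"
      unfolding comb_def by (rule M.finsum_addf) (use summand that in auto)
    finally show ?thesis .
  qed
  have comb_smult: "comb (\<lambda>i. r \<otimes> c i) = r \<odot>\<^bsub>U\<^esub> comb c"
    if "r \<in> carrier R" "c \<in> {..<n} \<rightarrow> carrier R" for r c
  proof -
    have "comb (\<lambda>i. r \<otimes> c i) = (\<Oplus>\<^bsub>U\<^esub>i\<in>{..<n}. r \<odot>\<^bsub>U\<^esub> (c i \<odot>\<^bsub>U\<^esub> b i))"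
      unfolding comb_def by (rule M.finsum_cong') (use that bi in \<open>auto simp: Pi_def smult_assoc1\<close>)
    also have "\<dots> = r \<odot>\<^bsub>U\<^esub> comb c"
      unfolding comb_def by (rule finsum_smult_ldistr[symmetric]) (use summand that in auto)
    finally show ?thesis .
  qed
  have comb_unit: "comb (\<lambda>i. if i = j then \<one> else \<zero>) = b j" if "j < n" for j
  proof -
    have "comb (\<lambda>i. if i = j then \<one> else \<zero>) = (\<Oplus>\<^bsub>U\<^esub>i\<in>{..<n}. if j = i then b i else \<zero>\<^bsub>U\<^esub>)"
      unfolding comb_def by (rule M.finsum_cong') (use bi in auto)
    also have "\<dots> = b j" by (rule M.finsum_singleton) (use that b in auto)
    finally show ?thesis .
  qed
  have coP: "co x \<in> {..<n} \<rightarrow> carrier R" if "x \<in> carrier U" for x using co(1)[OF that] by auto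
  have "based_module R U {..<n} b (\<lambda>i x. co x i)"
  proof
    fix i assume i: "i \<in> {..<n}"
    show "b i \<in> carrier U" using bi i by simp
    show "(\<lambda>x. co x i) \<in> linear_maps R U (ring_as_module R)"
      unfolding linear_maps_def ring_as_module_def
    proof (simp, intro conjI ballI)
      show "(\<lambda>x. co x i) \<in> carrier U \<rightarrow> carrier R" using coP i by auto
      fix x assume x: "x \<in> carrier U"
      { fix y assume y: "y \<in> carrier U"
        have "co (x \<oplus>\<^bsub>U\<^esub> y) = (\<lambda>i\<in>{..<n}. co x i \<oplus> co y i)"
        proof (rule co_unique)
          show "x \<oplus>\<^bsub>U\<^esub> y \<in> carrier U" using x y by simp
          show "(\<lambda>i\<in>{..<n}. co x i \<oplus> co y i) \<in> {..<n} \<rightarrow>\<^sub>E carrier R" using coP x y by auto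
          have "comb (\<lambda>i\<in>{..<n}. co x i \<oplus> co y i) = comb (co x) \<oplus>\<^bsub>U\<^esub> comb (co y)"
            using coP[OF x] coP[OF y] by (subst comb_restrict) (auto intro: comb_add)
          then show "x \<oplus>\<^bsub>U\<^esub> y = comb (\<lambda>i\<in>{..<n}. co x i \<oplus> co y i)" using co(2)[OF x] co(2)[OF y] by simp
        qed
        then show "co (x \<oplus>\<^bsub>U\<^esub> y) i = co x i \<oplus> co y i" using i by simp }
      fix r assume r: "r \<in> carrier R"
      have "co (r \<odot>\<^bsub>U\<^esub> x) = (\<lambda>i\<in>{..<n}. r \<otimes> co x i)"
      proof (rule co_unique)
        show "r \<odot>\<^bsub>U\<^esub> x \<in> carrier U" using x r by simp
        show "(\<lambda>i\<in>{..<n}. r \<otimes> co x i) \<in> {..<n} \<rightarrow>\<^sub>E carrier R" using coP x r by auto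
        have "comb (\<lambda>i\<in>{..<n}. r \<otimes> co x i) = r \<odot>\<^bsub>U\<^esub> comb (co x)"
          using coP[OF x] r by (subst comb_restrict) (auto intro: comb_smult)
        then show "r \<odot>\<^bsub>U\<^esub> x = comb (\<lambda>i\<in>{..<n}. r \<otimes> co x i)" using co(2)[OF x] by simp
      qed
      then show "co (r \<odot>\<^bsub>U\<^esub> x) i = r \<otimes> co x i" using i by simp
    qed
    fix j assume j: "j \<in> {..<n}"
    have "co (b j) = (\<lambda>i\<in>{..<n}. if i = j then \<one> else \<zero>)"
    proof (rule co_unique)
      show "b j \<in> carrier U" using bi j by simp
      show "(\<lambda>i\<in>{..<n}. if i = j then \<one> else \<zero>) \<in> {..<n} \<rightarrow>\<^sub>E carrier R" by auto
      show "b j = comb (\<lambda>i\<in>{..<n}. if i = j then \<one> else \<zero>)"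
        using comb_unit j by (subst comb_restrict) auto
    qed
    then show "co (b j) i = (if j = i then \<one> else \<zero>)" using i by auto
  next
    fix x assume "x \<in> carrier U"
    then show "x = (\<Oplus>\<^bsub>U\<^esub>i\<in>{..<n}. co x i \<odot>\<^bsub>U\<^esub> b i)" using co(2) unfolding comb_def by blast
  qed simp
  then show ?thesis by blast
qed

lemma dual_module_simps:
  "carrier (dual_module R U) = linear_maps R U (ring_as_module R) \<inter> extensional (carrier U)"
  "\<zero>\<^bsub>dual_module R U\<^esub> = (\<lambda>x\<in>carrier U. \<zero>\<^bsub>R\<^esub>)"
  "f \<oplus>\<^bsub>dual_module R U\<^esub> g = (\<lambda>x\<in>carrier U. f x \<oplus>\<^bsub>R\<^esub> g x)"
  "r \<odot>\<^bsub>dual_module R U\<^esub> f = (\<lambda>x\<in>carrier U. r \<otimes>\<^bsub>R\<^esub> f x)"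
  by (simp_all add: dual_module_def hom_module_def ring_as_module_def)

lemma mem_dual_iff:
  "f \<in> carrier (dual_module R U) \<longleftrightarrow> f \<in> extensional (carrier U) \<and>
    (\<forall>x\<in>carrier U. f x \<in> carrier R) \<and>
    (\<forall>x\<in>carrier U. \<forall>y\<in>carrier U. f (x \<oplus>\<^bsub>U\<^esub> y) = f x \<oplus>\<^bsub>R\<^esub> f y) \<and>
    (\<forall>r\<in>carrier R. \<forall>x\<in>carrier U. f (r \<odot>\<^bsub>U\<^esub> x) = r \<otimes>\<^bsub>R\<^esub> f x)"
  by (auto simp: dual_module_simps linear_maps_def ring_as_module_def Pi_iff)

lemma dual_module_module:
  fixes R :: "('a, 'x) ring_scheme" (structure) and U :: "('a, 'm) module" (structure)
  assumes "Module.module R U"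
  shows "Module.module R (dual_module R U)"
proof -
  interpret Module.module R U by fact
  let ?D = "dual_module R U"
  have ext: "f = g" if "f \<in> carrier ?D" "g \<in> carrier ?D" "\<And>x. x \<in> carrier U \<Longrightarrow> f x = g x" for f g
    using that unfolding mem_dual_iff by (auto intro: extensionalityI)
  have add: "f \<oplus>\<^bsub>?D\<^esub> g \<in> carrier ?D" if "f \<in> carrier ?D" "g \<in> carrier ?D" for f g
    using that unfolding dual_module_simps(3) mem_dual_iff
    by (auto simp: R.r_distr R.a_ac)
  have smult: "r \<odot>\<^bsub>?D\<^esub> f \<in> carrier ?D" if "r \<in> carrier R" "f \<in> carrier ?D" for r f
    using that unfolding dual_module_simps(4) mem_dual_iff
    by (auto simp: R.r_distr R.m_lcomm)
  have zero: "\<zero>\<^bsub>?D\<^esub> \<in> carrier ?D"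
    unfolding dual_module_simps(2) mem_dual_iff by auto
  have val: "f x \<in> carrier R" if "f \<in> carrier ?D" "x \<in> carrier U" for f x
    using that unfolding mem_dual_iff by blast
  have ab: "abelian_group ?D"
  proof (rule abelian_groupI)
    fix f assume f: "f \<in> carrier ?D"
    show "\<zero>\<^bsub>?D\<^esub> \<oplus>\<^bsub>?D\<^esub> f = f"
      by (rule ext[OF add[OF zero f] f]) (simp add: dual_module_simps val[OF f])
    have m: "(\<ominus> \<one>) \<odot>\<^bsub>?D\<^esub> f \<in> carrier ?D" by (rule smult[OF _ f]) simp
    have "(\<ominus> \<one>) \<odot>\<^bsub>?D\<^esub> f \<oplus>\<^bsub>?D\<^esub> f = \<zero>\<^bsub>?D\<^esub>"
      by (rule ext[OF add[OF m f] zero]) (simp add: dual_module_simps val[OF f] R.l_minus R.l_neg)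
    then show "\<exists>g\<in>carrier ?D. g \<oplus>\<^bsub>?D\<^esub> f = \<zero>\<^bsub>?D\<^esub>" using m by blast
    fix g assume g: "g \<in> carrier ?D"
    show "f \<oplus>\<^bsub>?D\<^esub> g = g \<oplus>\<^bsub>?D\<^esub> f"
      by (rule ext[OF add[OF f g] add[OF g f]]) (simp add: dual_module_simps val[OF f] val[OF g] R.a_comm)
    fix h assume h: "h \<in> carrier ?D"
    show "(f \<oplus>\<^bsub>?D\<^esub> g) \<oplus>\<^bsub>?D\<^esub> h = f \<oplus>\<^bsub>?D\<^esub> (g \<oplus>\<^bsub>?D\<^esub> h)"
      by (rule ext[OF add[OF add[OF f g] h] add[OF f add[OF g h]]])
        (simp add: dual_module_simps val[OF f] val[OF g] val[OF h] R.a_assoc)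
  qed (rule add zero; assumption?)+
  show ?thesis
  proof (rule moduleI[OF R.is_cring ab smult])
    fix r s f assume r: "r \<in> carrier R" and s: "s \<in> carrier R" and f: "f \<in> carrier ?D"
    show "(r \<oplus> s) \<odot>\<^bsub>?D\<^esub> f = r \<odot>\<^bsub>?D\<^esub> f \<oplus>\<^bsub>?D\<^esub> s \<odot>\<^bsub>?D\<^esub> f"
      by (rule ext[OF smult[OF R.a_closed[OF r s] f] add[OF smult[OF r f] smult[OF s f]]])
        (simp add: dual_module_simps val[OF f] r s R.l_distr)
    show "(r \<otimes> s) \<odot>\<^bsub>?D\<^esub> f = r \<odot>\<^bsub>?D\<^esub> (s \<odot>\<^bsub>?D\<^esub> f)"
      by (rule ext[OF smult[OF R.m_closed[OF r s] f] smult[OF r smult[OF s f]]])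
        (simp add: dual_module_simps val[OF f] r s R.m_assoc)
  next
    fix r f g assume r: "r \<in> carrier R" and f: "f \<in> carrier ?D" and g: "g \<in> carrier ?D"
    show "r \<odot>\<^bsub>?D\<^esub> (f \<oplus>\<^bsub>?D\<^esub> g) = r \<odot>\<^bsub>?D\<^esub> f \<oplus>\<^bsub>?D\<^esub> r \<odot>\<^bsub>?D\<^esub> g"
      by (rule ext[OF smult[OF r add[OF f g]] add[OF smult[OF r f] smult[OF r g]]])
        (simp add: dual_module_simps val[OF f] val[OF g] r R.r_distr)
  next
    fix f assume f: "f \<in> carrier ?D"
    show "\<one> \<odot>\<^bsub>?D\<^esub> f = f"
      by (rule ext[OF smult[OF R.one_closed f] f]) (simp add: dual_module_simps val[OF f])
  qed
qed

lemma dual_finsum_apply: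
  fixes R :: "('a, 'x) ring_scheme" (structure) and U :: "('a, 'm) module" (structure)
  assumes "Module.module R U" "finite S" "f \<in> S \<rightarrow> carrier (dual_module R U)" and x: "x \<in> carrier U"
  shows "(\<Oplus>\<^bsub>dual_module R U\<^esub>i\<in>S. f i) x = (\<Oplus>i\<in>S. f i x)"
proof -
  interpret Module.module R U by fact
  interpret D: Module.module R "dual_module R U" by (rule dual_module_module) fact
  show ?thesis
    using assms(2,3)
  proof (induction S rule: finite_induct)
    case empty
    then show ?case using x by (simp add: dual_module_simps)
  next
    case (insert i S)
    have "f j x \<in> carrier R" if "j \<in> insert i S" for j
      using insert.prems that x unfolding Pi_iff mem_dual_iff by blast
    then show ?case
      using insert x by (subst D.M.finsum_insert) (auto simp: dual_module_simps(3))
  qed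
qed

text \<open>
  Evaluation at the basis vectors gives the coordinates of a functional with respect to the
  dual basis.
\<close>

lemma (in based_module) dual_based_module:
  "based_module R (dual_module R U) J (\<lambda>i. \<lambda>u\<in>carrier U. \<kappa> i u) (\<lambda>i \<psi>. \<psi> (b i))"
proof -
  let ?D = "dual_module R U"
  interpret D: Module.module R ?D by (rule dual_module_module) (rule is_module)
  have d: "(\<lambda>u\<in>carrier U. \<kappa> i u) \<in> carrier ?D" if "i \<in> J" for i
    using linear_functional_simps[OF coord_linear[OF that]] unfolding mem_dual_iff by auto
  show ?thesis
  proof
    show "finite J" by (rule finite_index)
    show "(\<lambda>u\<in>carrier U. \<kappa> i u) \<in> carrier ?D" if "i \<in> J" for i by (rule d[OF that])
    show "(\<lambda>\<psi>. \<psi> (b i)) \<in> linear_maps R ?D (ring_as_module R)" if "i \<in> J" for i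
      unfolding linear_maps_def ring_as_module_def
      using basis_closed[OF that] by (auto simp: dual_module_simps(3,4) mem_dual_iff)
    show "(\<lambda>u\<in>carrier U. \<kappa> j u) (b i) = (if j = i then \<one> else \<zero>)" if "i \<in> J" "j \<in> J" for i j
      using basis_closed coord_basis that by auto
    show "\<psi> = (\<Oplus>\<^bsub>?D\<^esub>i\<in>J. \<psi> (b i) \<odot>\<^bsub>?D\<^esub> (\<lambda>u\<in>carrier U. \<kappa> i u))" if \<psi>: "\<psi> \<in> carrier ?D" for \<psi>
    proof -
      have lin: "\<psi> \<in> linear_maps R U (ring_as_module R)" using \<psi> by (simp add: dual_module_simps)
      have vb: "\<psi> (b i) \<in> carrier R" if "i \<in> J" for i
        using \<psi> basis_closed[OF that] unfolding mem_dual_iff by blast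
      have t: "(\<lambda>i. \<psi> (b i) \<odot>\<^bsub>?D\<^esub> (\<lambda>u\<in>carrier U. \<kappa> i u)) \<in> J \<rightarrow> carrier ?D"
        using vb d by auto
      show ?thesis
      proof (rule extensionalityI[of _ "carrier U"])
        show "\<psi> \<in> extensional (carrier U)" using \<psi> unfolding mem_dual_iff by blast
        show "(\<Oplus>\<^bsub>?D\<^esub>i\<in>J. \<psi> (b i) \<odot>\<^bsub>?D\<^esub> (\<lambda>u\<in>carrier U. \<kappa> i u)) \<in> extensional (carrier U)"
          using D.M.finsum_closed[OF t] unfolding mem_dual_iff by blast
        fix u assume u: "u \<in> carrier U"
        have "(\<Oplus>\<^bsub>?D\<^esub>i\<in>J. \<psi> (b i) \<odot>\<^bsub>?D\<^esub> (\<lambda>u\<in>carrier U. \<kappa> i u)) u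
            = dot R J (\<lambda>i. \<psi> (b i)) (\<lambda>i. \<kappa> i u)"
          unfolding dual_finsum_apply[OF is_module finite_index t u] dot_def
          by (simp add: dual_module_simps u)
        also have "\<dots> = dot R J (\<lambda>i. \<kappa> i u) (\<lambda>i. \<psi> (b i))"
          by (rule R.dot_commute) (use vb linear_functional_simps(1)[OF coord_linear] u in auto)
        also have "\<dots> = \<psi> u" using linear_functional_expansion[OF lin u] by simp
        finally show "\<psi> u = (\<Oplus>\<^bsub>?D\<^esub>i\<in>J. \<psi> (b i) \<odot>\<^bsub>?D\<^esub> (\<lambda>u\<in>carrier U. \<kappa> i u)) u" by simp
      qed
    qed
  qed
qed

lemma direct_sum_simps [simp]:
  "carrier (direct_sum_module U U') = carrier U \<times> carrier U'"
  "\<zero>\<^bsub>direct_sum_module U U'\<^esub> = (\<zero>\<^bsub>U\<^esub>, \<zero>\<^bsub>U'\<^esub>)"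
  "(x, y) \<oplus>\<^bsub>direct_sum_module U U'\<^esub> (x', y') = (x \<oplus>\<^bsub>U\<^esub> x', y \<oplus>\<^bsub>U'\<^esub> y')"
  "r \<odot>\<^bsub>direct_sum_module U U'\<^esub> (x, y) = (r \<odot>\<^bsub>U\<^esub> x, r \<odot>\<^bsub>U'\<^esub> y)"
  by (simp_all add: direct_sum_module_def)

lemma direct_sum_abelian_group:
  assumes "abelian_group U" "abelian_group U'"
  shows "abelian_group (direct_sum_module U U')"
proof -
  interpret U: abelian_group U by fact
  interpret U': abelian_group U' by fact
  show ?thesis
  proof (rule abelian_groupI)
    fix p assume "p \<in> carrier (direct_sum_module U U')"
    then obtain x y where p: "p = (x, y)" "x \<in> carrier U" "y \<in> carrier U'" by auto
    then show "\<exists>p'\<in>carrier (direct_sum_module U U'). p' \<oplus>\<^bsub>direct_sum_module U U'\<^esub> p = \<zero>\<^bsub>direct_sum_module U U'\<^esub>"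
      by (intro bexI[of _ "(\<ominus>\<^bsub>U\<^esub> x, \<ominus>\<^bsub>U'\<^esub> y)"]) (auto simp: U.l_neg U'.l_neg)
  qed (auto simp: U.a_ac U'.a_ac)
qed

lemma direct_sum_module_module:
  fixes R :: "('a, 'x) ring_scheme" (structure) and U :: "('a, 'm) module" and U' :: "('a, 'n) module"
  assumes "Module.module R U" "Module.module R U'"
  shows "Module.module R (direct_sum_module U U')"
proof -
  interpret U: Module.module R U by fact
  interpret U': Module.module R U' by fact
  show ?thesis
    by (rule moduleI[OF U.R.is_cring direct_sum_abelian_group])
      (auto simp: U.smult_l_distr U'.smult_l_distr U.smult_r_distr U'.smult_r_distr
        U.smult_assoc1 U'.smult_assoc1 U.abelian_group_axioms U'.abelian_group_axioms)
qed

lemma direct_sum_finsum: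
  assumes "abelian_group U" "abelian_group U'" "finite S"
    and "f \<in> S \<rightarrow> carrier U" "g \<in> S \<rightarrow> carrier U'"
  shows "(\<Oplus>\<^bsub>direct_sum_module U U'\<^esub>i\<in>S. (f i, g i)) = (\<Oplus>\<^bsub>U\<^esub>i\<in>S. f i, \<Oplus>\<^bsub>U'\<^esub>i\<in>S. g i)"
proof -
  interpret U: abelian_group U by fact
  interpret U': abelian_group U' by fact
  interpret D: abelian_group "direct_sum_module U U'" by (rule direct_sum_abelian_group) fact+
  show ?thesis
    using assms(3-)
  proof (induction S rule: finite_induct)
    case (insert i S)
    then have "f \<in> S \<rightarrow> carrier U" "g \<in> S \<rightarrow> carrier U'" "f i \<in> carrier U" "g i \<in> carrier U'"
      "(\<lambda>i. (f i, g i)) \<in> S \<rightarrow> carrier (direct_sum_module U U')" by auto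
    then show ?case using insert by (subst D.finsum_insert) auto
  qed simp
qed

lemma direct_sum_based_module:
  fixes R :: "('a, 'x) ring_scheme" (structure) and U :: "('a, 'm) module" and U' :: "('a, 'n) module"
  assumes "based_module R U J b \<kappa>" "based_module R U' L b' \<kappa>'"
  shows "based_module R (direct_sum_module U U') (J <+> L)
     (case_sum (\<lambda>j. (b j, \<zero>\<^bsub>U'\<^esub>)) (\<lambda>l. (\<zero>\<^bsub>U\<^esub>, b' l)))
     (case_sum (\<lambda>j p. \<kappa> j (fst p)) (\<lambda>l p. \<kappa>' l (snd p)))"
proof -
  interpret U: based_module R U J b \<kappa> by fact
  interpret U': based_module R U' L b' \<kappa>' by fact
  let ?D = "direct_sum_module U U'"
  interpret D: Module.module R ?D
    by (rule direct_sum_module_module[OF U.is_module U'.is_module])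
  note lin = linear_functional_simps[OF U.coord_linear]
  note lin' = linear_functional_simps[OF U'.coord_linear]
  have k0: "\<kappa> j \<zero>\<^bsub>U\<^esub> = \<zero>" if "j \<in> J" for j
    using lin(3)[OF that U.R.zero_closed U.M.zero_closed] lin(1)[OF that U.M.zero_closed] by simp
  have k0': "\<kappa>' j \<zero>\<^bsub>U'\<^esub> = \<zero>" if "j \<in> L" for j
    using lin'(3)[OF that U.R.zero_closed U'.M.zero_closed] lin'(1)[OF that U'.M.zero_closed] by simp
  let ?b = "case_sum (\<lambda>j. (b j, \<zero>\<^bsub>U'\<^esub>)) (\<lambda>l. (\<zero>\<^bsub>U\<^esub>, b' l))"
  let ?k = "case_sum (\<lambda>j p. \<kappa> j (fst p)) (\<lambda>l p. \<kappa>' l (snd p))"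
  show ?thesis
  proof
    show "finite (J <+> L)" using U.finite_index U'.finite_index by simp
    show "?b i \<in> carrier ?D" if "i \<in> J <+> L" for i
      using that U.basis_closed U'.basis_closed by auto
    show "?k i \<in> linear_maps R ?D (ring_as_module R)" if "i \<in> J <+> L" for i
      using that lin lin' unfolding linear_maps_def ring_as_module_def by auto
    show "?k i (?b j) = (if j = i then \<one> else \<zero>)" if "i \<in> J <+> L" "j \<in> J <+> L" for i j
      using that U.coord_basis U'.coord_basis by (auto simp: k0 k0' split: if_splits)
    show "p = (\<Oplus>\<^bsub>?D\<^esub>i\<in>J <+> L. ?k i p \<odot>\<^bsub>?D\<^esub> ?b i)" if p: "p \<in> carrier ?D" for p
    proof -
      obtain x y where xy: "p = (x, y)" "x \<in> carrier U" "y \<in> carrier U'" using p by auto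
      have "(\<Oplus>\<^bsub>?D\<^esub>i\<in>J <+> L. ?k i p \<odot>\<^bsub>?D\<^esub> ?b i)
          = (\<Oplus>\<^bsub>?D\<^esub>i\<in>Inl ` J. ?k i p \<odot>\<^bsub>?D\<^esub> ?b i) \<oplus>\<^bsub>?D\<^esub> (\<Oplus>\<^bsub>?D\<^esub>i\<in>Inr ` L. ?k i p \<odot>\<^bsub>?D\<^esub> ?b i)"
        unfolding Plus_def
        by (rule D.M.finsum_Un_disjoint)
          (use xy lin(1) lin'(1) U.basis_closed U'.basis_closed U.finite_index U'.finite_index in auto)
      also have "(\<Oplus>\<^bsub>?D\<^esub>i\<in>Inl ` J. ?k i p \<odot>\<^bsub>?D\<^esub> ?b i) = (\<Oplus>\<^bsub>?D\<^esub>j\<in>J. (\<kappa> j x \<odot>\<^bsub>U\<^esub> b j, \<zero>\<^bsub>U'\<^esub>))"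
        using xy lin(1) U.basis_closed
        by (subst D.M.finsum_reindex) (auto intro!: D.M.finsum_cong')
      also have "\<dots> = (x, \<zero>\<^bsub>U'\<^esub>)"
        using xy lin(1) U.basis_closed U.basis_expansion[OF xy(2)]
        by (subst direct_sum_finsum[OF U.abelian_group_axioms U'.abelian_group_axioms U.finite_index]) auto
      also have "(\<Oplus>\<^bsub>?D\<^esub>i\<in>Inr ` L. ?k i p \<odot>\<^bsub>?D\<^esub> ?b i) = (\<Oplus>\<^bsub>?D\<^esub>j\<in>L. (\<zero>\<^bsub>U\<^esub>, \<kappa>' j y \<odot>\<^bsub>U'\<^esub> b' j))"
        using xy lin'(1) U'.basis_closed
        by (subst D.M.finsum_reindex) (auto intro!: D.M.finsum_cong')
      also have "\<dots> = (\<zero>\<^bsub>U\<^esub>, y)"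
        using xy lin'(1) U'.basis_closed U'.basis_expansion[OF xy(3)]
        by (subst direct_sum_finsum[OF U.abelian_group_axioms U'.abelian_group_axioms U'.finite_index]) auto
      finally show ?thesis using xy by simp
    qed
  qed
qed

lemma (in cring) contract_scale:
  assumes "finite I" "finite J" "r \<in> carrier R" "s \<in> carrier R" "a \<in> I \<rightarrow> carrier R" "x \<in> J \<rightarrow> carrier R"
    and t: "\<And>i j. i \<in> I \<Longrightarrow> j \<in> J \<Longrightarrow> t i j k \<in> carrier R"
  shows "contract R I J t (\<lambda>i. r \<otimes> a i) (\<lambda>j. s \<otimes> x j) k = (r \<otimes> s) \<otimes> contract R I J t a x k"
proof -
  have inner: "(\<lambda>i. dot R J x (\<lambda>j. t i j k)) \<in> I \<rightarrow> carrier R" using assms by auto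
  have "contract R I J t (\<lambda>i. r \<otimes> a i) (\<lambda>j. s \<otimes> x j) k
     = r \<otimes> dot R I a (\<lambda>i. dot R J (\<lambda>j. s \<otimes> x j) (\<lambda>j. t i j k))"
    unfolding contract_def by (rule dot_scale_left) (use assms in \<open>auto intro!: dot_closed\<close>)
  also have "dot R I a (\<lambda>i. dot R J (\<lambda>j. s \<otimes> x j) (\<lambda>j. t i j k)) = dot R I a (\<lambda>i. s \<otimes> dot R J x (\<lambda>j. t i j k))"
    by (rule dot_cong) (use assms in \<open>auto intro!: dot_scale_left\<close>)
  also have "\<dots> = s \<otimes> contract R I J t a x k"
    unfolding contract_def by (rule dot_scale_right) (use assms inner in auto)
  finally show ?thesis using contract_closed[of a I x J t k] assms by (simp add: m_assoc)
qed

lemma (in ring_hom_cring) hom_dot: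
  assumes "u \<in> I \<rightarrow> carrier R" "v \<in> I \<rightarrow> carrier R"
  shows "h (dot R I u v) = dot S I (\<lambda>i. h (u i)) (\<lambda>i. h (v i))"
  unfolding dot_def using assms by (subst hom_finsum) (auto intro!: S.finsum_cong' simp: Pi_iff)

lemma (in ring_hom_cring) hom_contract:
  assumes "a \<in> I \<rightarrow> carrier R" "x \<in> J \<rightarrow> carrier R"
    and t: "\<And>i j. i \<in> I \<Longrightarrow> j \<in> J \<Longrightarrow> t i j k \<in> carrier R"
  shows "h (contract R I J t a x k) = contract S I J (\<lambda>i j k. h (t i j k)) (\<lambda>i. h (a i)) (\<lambda>j. h (x j)) k"
proof -
  have "h (contract R I J t a x k) = dot S I (\<lambda>i. h (a i)) (\<lambda>i. h (dot R J x (\<lambda>j. t i j k)))"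
    unfolding contract_def by (rule hom_dot) (use assms in auto)
  also have "\<dots> = contract S I J (\<lambda>i j k. h (t i j k)) (\<lambda>i. h (a i)) (\<lambda>j. h (x j)) k"
    unfolding contract_def by (rule S.dot_cong) (use assms in \<open>auto simp: hom_dot intro!: S.dot_closed\<close>)
  finally show ?thesis .
qed

section \<open>Structure constants of a representation, its bullet and its hull\<close>

locale based_rep =
  M: based_module R "rep_par \<theta>" I bm \<kappa>m +
  V: based_module R "rep_dom \<theta>" J bv \<kappa>v +
  W: based_module R "rep_cod \<theta>" K bw \<kappa>w
  for R :: "('a, 'x) ring_scheme" (structure) and \<theta> :: "('a, 'm, 'v, 'w) module_rep"
    and I :: "'i set" and bm \<kappa>m and J :: "'j set" and bv \<kappa>v and K :: "'k set" and bw \<kappa>w +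
  assumes rep: "is_module_rep R \<theta>"
begin

lemma rep_map_mem:
  "rep_map \<theta> \<in> linear_maps R (rep_par \<theta>) (hom_module R (rep_dom \<theta>) (rep_cod \<theta>))"
  using rep by (simp add: is_module_rep_def)

lemma rep_map_closed:
  "a \<in> carrier (rep_par \<theta>) \<Longrightarrow> x \<in> carrier (rep_dom \<theta>) \<Longrightarrow> rep_map \<theta> a x \<in> carrier (rep_cod \<theta>)"
  using rep_map_mem by (auto simp: linear_maps_def hom_module_def)

lemma rep_map_add_right:
  "a \<in> carrier (rep_par \<theta>) \<Longrightarrow> x \<in> carrier (rep_dom \<theta>) \<Longrightarrow> y \<in> carrier (rep_dom \<theta>) \<Longrightarrow>
    rep_map \<theta> a (x \<oplus>\<^bsub>rep_dom \<theta>\<^esub> y) = rep_map \<theta> a x \<oplus>\<^bsub>rep_cod \<theta>\<^esub> rep_map \<theta> a y"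
  using rep_map_mem by (auto simp: linear_maps_def hom_module_def)

lemma rep_map_smult_right:
  "a \<in> carrier (rep_par \<theta>) \<Longrightarrow> r \<in> carrier R \<Longrightarrow> x \<in> carrier (rep_dom \<theta>) \<Longrightarrow>
    rep_map \<theta> a (r \<odot>\<^bsub>rep_dom \<theta>\<^esub> x) = r \<odot>\<^bsub>rep_cod \<theta>\<^esub> rep_map \<theta> a x"
  using rep_map_mem by (auto simp: linear_maps_def hom_module_def Pi_iff)

lemma rep_map_add_left:
  "a \<in> carrier (rep_par \<theta>) \<Longrightarrow> a' \<in> carrier (rep_par \<theta>) \<Longrightarrow> x \<in> carrier (rep_dom \<theta>) \<Longrightarrow>
    rep_map \<theta> (a \<oplus>\<^bsub>rep_par \<theta>\<^esub> a') x = rep_map \<theta> a x \<oplus>\<^bsub>rep_cod \<theta>\<^esub> rep_map \<theta> a' x"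
  using rep_map_mem by (auto simp: linear_maps_def hom_module_def)

lemma rep_map_smult_left:
  "r \<in> carrier R \<Longrightarrow> a \<in> carrier (rep_par \<theta>) \<Longrightarrow> x \<in> carrier (rep_dom \<theta>) \<Longrightarrow>
    rep_map \<theta> (r \<odot>\<^bsub>rep_par \<theta>\<^esub> a) x = r \<odot>\<^bsub>rep_cod \<theta>\<^esub> rep_map \<theta> a x"
  using rep_map_mem by (auto simp: linear_maps_def hom_module_def)

lemma linear_in_parameter:
  assumes f: "f \<in> linear_maps R (rep_cod \<theta>) (ring_as_module R)" and x: "x \<in> carrier (rep_dom \<theta>)"
  shows "(\<lambda>a. f (rep_map \<theta> a x)) \<in> linear_maps R (rep_par \<theta>) (ring_as_module R)"
  using linear_functional_simps[OF f] x
  by (auto simp: linear_maps_def ring_as_module_def rep_map_closed rep_map_add_left rep_map_smult_left)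

lemma linear_in_vector:
  assumes f: "f \<in> linear_maps R (rep_cod \<theta>) (ring_as_module R)" and a: "a \<in> carrier (rep_par \<theta>)"
  shows "(\<lambda>x. f (rep_map \<theta> a x)) \<in> linear_maps R (rep_dom \<theta>) (ring_as_module R)"
  using linear_functional_simps[OF f] a
  by (auto simp: linear_maps_def ring_as_module_def rep_map_closed rep_map_add_right rep_map_smult_right)

definition structure_constants :: "'i \<Rightarrow> 'j \<Rightarrow> 'k \<Rightarrow> 'a" where
  "structure_constants i j k = \<kappa>w k (rep_map \<theta> (bm i) (bv j))"

lemma structure_constants_closed:
  "i \<in> I \<Longrightarrow> j \<in> J \<Longrightarrow> k \<in> K \<Longrightarrow> structure_constants i j k \<in> carrier R"
  unfolding structure_constants_def
  by (intro linear_functional_simps(1)[OF W.coord_linear] rep_map_closed M.basis_closed V.basis_closed)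

lemma coord_closed:
  "a \<in> carrier (rep_par \<theta>) \<Longrightarrow> (\<lambda>i. \<kappa>m i a) \<in> I \<rightarrow> carrier R"
  "x \<in> carrier (rep_dom \<theta>) \<Longrightarrow> (\<lambda>j. \<kappa>v j x) \<in> J \<rightarrow> carrier R"
  "y \<in> carrier (rep_cod \<theta>) \<Longrightarrow> (\<lambda>k. \<kappa>w k y) \<in> K \<rightarrow> carrier R"
  using linear_functional_simps(1)[OF M.coord_linear] linear_functional_simps(1)[OF V.coord_linear]
    linear_functional_simps(1)[OF W.coord_linear] by auto

lemma coord_rep_map_basis:
  assumes "i \<in> I" "x \<in> carrier (rep_dom \<theta>)" "k \<in> K"
  shows "\<kappa>w k (rep_map \<theta> (bm i) x) = dot R J (\<lambda>j. \<kappa>v j x) (\<lambda>j. structure_constants i j k)"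
  unfolding structure_constants_def
  by (rule V.linear_functional_expansion[OF linear_in_vector[OF W.coord_linear[OF assms(3)] M.basis_closed[OF assms(1)]] assms(2)])

lemma coord_rep_map:
  assumes a: "a \<in> carrier (rep_par \<theta>)" and x: "x \<in> carrier (rep_dom \<theta>)" and k: "k \<in> K"
  shows "\<kappa>w k (rep_map \<theta> a x) = contract R I J structure_constants (\<lambda>i. \<kappa>m i a) (\<lambda>j. \<kappa>v j x) k"
proof -
  have "\<kappa>w k (rep_map \<theta> a x) = dot R I (\<lambda>i. \<kappa>m i a) (\<lambda>i. \<kappa>w k (rep_map \<theta> (bm i) x))"
    by (rule M.linear_functional_expansion[OF linear_in_parameter[OF W.coord_linear[OF k] x] a])
  also have "\<dots> = contract R I J structure_constants (\<lambda>i. \<kappa>m i a) (\<lambda>j. \<kappa>v j x) k"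
    unfolding contract_def
    by (rule M.R.dot_cong) (use coord_closed(1)[OF a] coord_closed(2)[OF x] k in
        \<open>auto simp: coord_rep_map_basis x structure_constants_closed intro!: M.R.dot_closed\<close>)
  finally show ?thesis .
qed

lemma bullet_rep_simps [simp]:
  "rep_par (bullet_rep R \<theta>) = dual_module R (rep_cod \<theta>)"
  "rep_dom (bullet_rep R \<theta>) = rep_dom \<theta>"
  "rep_cod (bullet_rep R \<theta>) = dual_module R (rep_par \<theta>)"
  by (simp_all add: bullet_rep_def)

lemma bullet_rep_map:
  assumes "\<psi> \<in> carrier (dual_module R (rep_cod \<theta>))" "x \<in> carrier (rep_dom \<theta>)"
  shows "rep_map (bullet_rep R \<theta>) \<psi> x = (\<lambda>a\<in>carrier (rep_par \<theta>). \<psi> (rep_map \<theta> a x))"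
  using assms by (simp add: bullet_rep_def)

lemma bullet_rep_map_closed:
  assumes \<psi>: "\<psi> \<in> carrier (dual_module R (rep_cod \<theta>))" and x: "x \<in> carrier (rep_dom \<theta>)"
  shows "rep_map (bullet_rep R \<theta>) \<psi> x \<in> carrier (dual_module R (rep_par \<theta>))"
proof -
  have "\<psi> \<in> linear_maps R (rep_cod \<theta>) (ring_as_module R)" using \<psi> by (simp add: dual_module_simps)
  from linear_functional_simps[OF linear_in_parameter[OF this x]]
  show ?thesis unfolding bullet_rep_map[OF assms] mem_dual_iff by auto
qed

text \<open>
  The coordinates of an element of the dual of the parameter module are its values at the
  basis vectors \<open>bm i\<close>, and \<open>\<psi>\<close> is expanded through its values at the \<open>bw k\<close>.
\<close>

lemma bullet_coord:
  assumes \<psi>: "\<psi> \<in> carrier (dual_module R (rep_cod \<theta>))" and x: "x \<in> carrier (rep_dom \<theta>)" and i: "i \<in> I"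
  shows "rep_map (bullet_rep R \<theta>) \<psi> x (bm i)
     = contract R K J (transpose13 structure_constants) (\<lambda>k. \<psi> (bw k)) (\<lambda>j. \<kappa>v j x) i"
proof -
  have lin: "\<psi> \<in> linear_maps R (rep_cod \<theta>) (ring_as_module R)" using \<psi> by (simp add: dual_module_simps)
  have w: "rep_map \<theta> (bm i) x \<in> carrier (rep_cod \<theta>)" by (rule rep_map_closed[OF M.basis_closed[OF i] x])
  have pb: "(\<lambda>k. \<psi> (bw k)) \<in> K \<rightarrow> carrier R" using linear_functional_simps(1)[OF lin] W.basis_closed by auto
  have "rep_map (bullet_rep R \<theta>) \<psi> x (bm i) = \<psi> (rep_map \<theta> (bm i) x)"
    using M.basis_closed[OF i] by (simp add: bullet_rep_map[OF \<psi> x])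
  also have "\<dots> = dot R K (\<lambda>k. \<kappa>w k (rep_map \<theta> (bm i) x)) (\<lambda>k. \<psi> (bw k))"
    by (rule W.linear_functional_expansion[OF lin w])
  also have "\<dots> = dot R K (\<lambda>k. \<psi> (bw k)) (\<lambda>k. \<kappa>w k (rep_map \<theta> (bm i) x))"
    by (rule M.R.dot_commute[OF coord_closed(3)[OF w] pb])
  also have "\<dots> = contract R K J (transpose13 structure_constants) (\<lambda>k. \<psi> (bw k)) (\<lambda>j. \<kappa>v j x) i"
    unfolding contract_def transpose13_def
    by (rule M.R.dot_cong) (use coord_closed(2)[OF x] i pb in
        \<open>auto simp: coord_rep_map_basis x structure_constants_closed intro!: M.R.dot_closed\<close>)
  finally show ?thesis .
qed

end

lemma (in cring) contract_coordinate_axioms: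
  assumes "finite I" "finite J" and t: "\<And>i j k. i \<in> I \<Longrightarrow> j \<in> J \<Longrightarrow> k \<in> K \<Longrightarrow> t i j k \<in> carrier R"
  shows "\<lbrakk>a \<in> vectors I R; x \<in> vectors J R; k \<in> K\<rbrakk> \<Longrightarrow> contract R I J t a x k \<in> carrier R"
    and "\<lbrakk>a \<in> vectors I R; a' \<in> vectors I R; x \<in> vectors J R; k \<in> K\<rbrakk> \<Longrightarrow>
        contract R I J t (\<lambda>i\<in>I. a i \<ominus> a' i) x k = contract R I J t a x k \<ominus> contract R I J t a' x k"
    and "\<lbrakk>a \<in> vectors I R; x \<in> vectors J R; x' \<in> vectors J R; k \<in> K\<rbrakk> \<Longrightarrow>
        contract R I J t a (\<lambda>j\<in>J. x j \<ominus> x' j) k = contract R I J t a x k \<ominus> contract R I J t a x' k"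
proof -
  have vec: "v \<in> S \<rightarrow> carrier R" if "v \<in> vectors S R" for v and S :: "'s set" using that by (auto simp: vectors_def)
  show "\<lbrakk>a \<in> vectors I R; x \<in> vectors J R; k \<in> K\<rbrakk> \<Longrightarrow> contract R I J t a x k \<in> carrier R"
    using t by (intro contract_closed) (auto dest: vec)
  show "contract R I J t (\<lambda>i\<in>I. a i \<ominus> a' i) x k = contract R I J t a x k \<ominus> contract R I J t a' x k"
    if h: "a \<in> vectors I R" "a' \<in> vectors I R" "x \<in> vectors J R" "k \<in> K"
  proof -
    have m: "a \<in> I \<rightarrow> carrier R" "a' \<in> I \<rightarrow> carrier R" "x \<in> J \<rightarrow> carrier R" using h vec by auto
    have "contract R I J t (\<lambda>i\<in>I. a i \<ominus> a' i) x k = contract R I J t (\<lambda>i. a i \<ominus> a' i) x k"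
      by (rule contract_cong) (use m h t in auto)
    then show ?thesis using contract_diff_left[OF assms(1) m, of t k] t h by simp
  qed
  show "contract R I J t a (\<lambda>j\<in>J. x j \<ominus> x' j) k = contract R I J t a x k \<ominus> contract R I J t a x' k"
    if h: "a \<in> vectors I R" "x \<in> vectors J R" "x' \<in> vectors J R" "k \<in> K"
  proof -
    have m: "a \<in> I \<rightarrow> carrier R" "x \<in> J \<rightarrow> carrier R" "x' \<in> J \<rightarrow> carrier R" using h vec by auto
    have "contract R I J t a (\<lambda>j\<in>J. x j \<ominus> x' j) k = contract R I J t a (\<lambda>j. x j \<ominus> x' j) k"
      by (rule contract_cong) (use m h t in auto)
    then show ?thesis using contract_diff_right[OF assms(1,2) m, of t k] t h by simp
  qed
qed

lemma contract_pure:
  assumes "cring A" and "ring_hom_cring R A \<phi>" and fin: "finite I" "finite J"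
    and t: "\<And>i j. i \<in> I \<Longrightarrow> j \<in> J \<Longrightarrow> t i j k \<in> carrier R"
    and a: "a \<in> I \<rightarrow> carrier R" and x: "x \<in> J \<rightarrow> carrier R" and \<alpha>: "\<alpha> \<in> carrier A" and \<beta>: "\<beta> \<in> carrier A"
  shows "contract A I J (\<lambda>i j k. \<phi> (t i j k)) (\<lambda>i\<in>I. \<phi> (a i) \<otimes>\<^bsub>A\<^esub> \<alpha>) (\<lambda>j\<in>J. \<phi> (x j) \<otimes>\<^bsub>A\<^esub> \<beta>) k
     = \<phi> (contract R I J t a x k) \<otimes>\<^bsub>A\<^esub> (\<alpha> \<otimes>\<^bsub>A\<^esub> \<beta>)"
proof -
  interpret h: ring_hom_cring R A \<phi> by fact
  have a': "(\<lambda>i. \<phi> (a i)) \<in> I \<rightarrow> carrier A" and x': "(\<lambda>j. \<phi> (x j)) \<in> J \<rightarrow> carrier A" using a x by auto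
  have t': "\<phi> (t i j k) \<in> carrier A" if "i \<in> I" "j \<in> J" for i j using t that by simp
  have "contract A I J (\<lambda>i j k. \<phi> (t i j k)) (\<lambda>i\<in>I. \<phi> (a i) \<otimes>\<^bsub>A\<^esub> \<alpha>) (\<lambda>j\<in>J. \<phi> (x j) \<otimes>\<^bsub>A\<^esub> \<beta>) k
      = contract A I J (\<lambda>i j k. \<phi> (t i j k)) (\<lambda>i. \<alpha> \<otimes>\<^bsub>A\<^esub> \<phi> (a i)) (\<lambda>j. \<beta> \<otimes>\<^bsub>A\<^esub> \<phi> (x j)) k"
    by (rule h.S.contract_cong) (use a' x' t' \<alpha> \<beta> in \<open>auto simp: h.S.m_comm Pi_iff\<close>)
  also have "\<dots> = (\<alpha> \<otimes>\<^bsub>A\<^esub> \<beta>) \<otimes>\<^bsub>A\<^esub> contract A I J (\<lambda>i j k. \<phi> (t i j k)) (\<lambda>i. \<phi> (a i)) (\<lambda>j. \<phi> (x j)) k"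
    by (rule h.S.contract_scale[where t = "\<lambda>i j k. \<phi> (t i j k)" and k = k, OF fin \<alpha> \<beta> a' x' t'])
  also have "\<dots> = (\<alpha> \<otimes>\<^bsub>A\<^esub> \<beta>) \<otimes>\<^bsub>A\<^esub> \<phi> (contract R I J t a x k)"
    using h.hom_contract[where t = t and k = k, OF a x t] by simp
  finally show ?thesis
    using \<alpha> \<beta> h.R.contract_closed[where t = t and k = k, OF a x t] by (simp add: h.S.m_comm)
qed

lemma based_extensionI:
  assumes "based_module R U J b \<kappa>" "cring A" "ring_hom_cring R A \<phi>"
  shows "based_extension R U J b \<kappa> A \<phi>"
proof -
  interpret h: ring_hom_cring R A \<phi> by fact
  show ?thesis
    by (intro based_extension.intro assms ring_hom_ringI2 h.R.ring_axioms h.S.ring_axioms h.homh)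
qed

context based_rep begin

lemma coordinate_form_rep:
  assumes A: "cring A" and \<phi>: "ring_hom_cring R A \<phi>"
  shows "coordinate_form R \<theta> I bm \<kappa>m J bv \<kappa>v K bw \<kappa>w A \<phi>
    (contract A I J (\<lambda>i j k. \<phi> (structure_constants i j k)))"
proof -
  interpret h: ring_hom_cring R A \<phi> by fact
  note ax = h.S.contract_coordinate_axioms[OF M.finite_index V.finite_index,
      where t = "\<lambda>i j k. \<phi> (structure_constants i j k)" and K = K,
      OF h.hom_closed[OF structure_constants_closed]]
  show ?thesis
  proof (intro coordinate_form.intro coordinate_form_axioms.intro based_extensionI A \<phi>)
    show "based_module R (rep_par \<theta>) I bm \<kappa>m" "based_module R (rep_dom \<theta>) J bv \<kappa>v"
      "based_module R (rep_cod \<theta>) K bw \<kappa>w"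
      by (rule M.based_module_axioms V.based_module_axioms W.based_module_axioms)+
    fix a x \<alpha> \<beta> k assume a: "a \<in> carrier (rep_par \<theta>)" and x: "x \<in> carrier (rep_dom \<theta>)"
    show "rep_map \<theta> a x \<in> carrier (rep_cod \<theta>)" by (rule rep_map_closed[OF a x])
    assume \<alpha>: "\<alpha> \<in> carrier A" "\<beta> \<in> carrier A" and k: "k \<in> K"
    show "contract A I J (\<lambda>i j k. \<phi> (structure_constants i j k)) (\<lambda>i\<in>I. \<phi> (\<kappa>m i a) \<otimes>\<^bsub>A\<^esub> \<alpha>)
        (\<lambda>j\<in>J. \<phi> (\<kappa>v j x) \<otimes>\<^bsub>A\<^esub> \<beta>) k = \<phi> (\<kappa>w k (rep_map \<theta> a x)) \<otimes>\<^bsub>A\<^esub> (\<alpha> \<otimes>\<^bsub>A\<^esub> \<beta>)"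
      unfolding coord_rep_map[OF a x k]
      by (rule contract_pure[OF A \<phi> M.finite_index V.finite_index _ coord_closed(1)[OF a] coord_closed(2)[OF x] \<alpha>])
        (use structure_constants_closed k in auto)
  qed (rule ax; assumption)+
qed

lemma coordinate_form_bullet:
  assumes A: "cring A" and \<phi>: "ring_hom_cring R A \<phi>"
  shows "coordinate_form R (bullet_rep R \<theta>)
    K (\<lambda>k. \<lambda>y\<in>carrier (rep_cod \<theta>). \<kappa>w k y) (\<lambda>k \<psi>. \<psi> (bw k)) J bv \<kappa>v
    I (\<lambda>i. \<lambda>a\<in>carrier (rep_par \<theta>). \<kappa>m i a) (\<lambda>i \<psi>. \<psi> (bm i)) A \<phi>
    (contract A K J (transpose13 (\<lambda>i j k. \<phi> (structure_constants i j k))))"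
proof -
  interpret h: ring_hom_cring R A \<phi> by fact
  have tr: "transpose13 (\<lambda>i j k. \<phi> (structure_constants i j k)) = (\<lambda>k j i. \<phi> (transpose13 structure_constants k j i))"
    by (simp add: transpose13_def)
  have tc: "transpose13 structure_constants k j i \<in> carrier R" if "k \<in> K" "j \<in> J" "i \<in> I" for i j k
    using structure_constants_closed that by (simp add: transpose13_def)
  note ax = h.S.contract_coordinate_axioms[OF W.finite_index V.finite_index,
      where t = "\<lambda>k j i. \<phi> (transpose13 structure_constants k j i)" and K = I, OF h.hom_closed[OF tc]]
  show ?thesis
    unfolding tr
  proof (intro coordinate_form.intro coordinate_form_axioms.intro based_extensionI A \<phi>; (unfold bullet_rep_simps)?)
    show "based_module R (dual_module R (rep_cod \<theta>)) K (\<lambda>k. \<lambda>y\<in>carrier (rep_cod \<theta>). \<kappa>w k y) (\<lambda>k \<psi>. \<psi> (bw k))"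
      by (rule W.dual_based_module)
    show "based_module R (rep_dom \<theta>) J bv \<kappa>v" by (rule V.based_module_axioms)
    show "based_module R (dual_module R (rep_par \<theta>)) I (\<lambda>i. \<lambda>a\<in>carrier (rep_par \<theta>). \<kappa>m i a) (\<lambda>i \<psi>. \<psi> (bm i))"
      by (rule M.dual_based_module)
    fix \<psi> x \<alpha> \<beta> i assume \<psi>: "\<psi> \<in> carrier (dual_module R (rep_cod \<theta>))" and x: "x \<in> carrier (rep_dom \<theta>)"
    show "rep_map (bullet_rep R \<theta>) \<psi> x \<in> carrier (dual_module R (rep_par \<theta>))"
      by (rule bullet_rep_map_closed[OF \<psi> x])
    assume \<alpha>: "\<alpha> \<in> carrier A" "\<beta> \<in> carrier A" and i: "i \<in> I"
    have pb: "(\<lambda>k. \<psi> (bw k)) \<in> K \<rightarrow> carrier R"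
      using \<psi> W.basis_closed unfolding mem_dual_iff by auto
    show "contract A K J (\<lambda>k j i. \<phi> (transpose13 structure_constants k j i)) (\<lambda>k\<in>K. \<phi> (\<psi> (bw k)) \<otimes>\<^bsub>A\<^esub> \<alpha>)
        (\<lambda>j\<in>J. \<phi> (\<kappa>v j x) \<otimes>\<^bsub>A\<^esub> \<beta>) i = \<phi> (rep_map (bullet_rep R \<theta>) \<psi> x (bm i)) \<otimes>\<^bsub>A\<^esub> (\<alpha> \<otimes>\<^bsub>A\<^esub> \<beta>)"
      unfolding bullet_coord[OF \<psi> x i]
      by (rule contract_pure[OF A \<phi> W.finite_index V.finite_index _ pb coord_closed(2)[OF x] \<alpha>]) (use tc i in auto)
  qed (rule ax; assumption)+
qed

end

lemma alternating_hull_simps [simp]: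
  "rep_par (alternating_hull \<theta>) = direct_sum_module (rep_dom \<theta>) (rep_par \<theta>)"
  "rep_dom (alternating_hull \<theta>) = direct_sum_module (rep_dom \<theta>) (rep_par \<theta>)"
  "rep_cod (alternating_hull \<theta>) = rep_cod \<theta>"
  by (simp_all add: alternating_hull_def Let_def)

lemma alternating_hull_map:
  assumes "x' \<in> carrier (rep_dom \<theta>)" "a' \<in> carrier (rep_par \<theta>)" "x \<in> carrier (rep_dom \<theta>)" "a \<in> carrier (rep_par \<theta>)"
  shows "rep_map (alternating_hull \<theta>) (x', a') (x, a) = rep_map \<theta> a' x \<ominus>\<^bsub>rep_cod \<theta>\<^esub> rep_map \<theta> a x'"
  using assms by (simp add: alternating_hull_def Let_def)

lemma sum_vector_parts:
  assumes "z \<in> vectors (J <+> I) A"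
  shows "(\<lambda>j\<in>J. z (Inl j)) \<in> vectors J A" "(\<lambda>i\<in>I. z (Inr i)) \<in> vectors I A"
  using assms by (auto simp: vectors_def)

lemma sum_vector_bij:
  "bij_betw (\<lambda>z. (\<lambda>j\<in>J. z (Inl j), \<lambda>i\<in>I. z (Inr i))) (vectors (J <+> I) A) (vectors J A \<times> vectors I A)"
proof (rule bij_betw_byWitness[where f' = "\<lambda>(x, a). \<lambda>p\<in>J <+> I. case_sum x a p"])
  show "\<forall>z\<in>vectors (J <+> I) A. (case (\<lambda>j\<in>J. z (Inl j), \<lambda>i\<in>I. z (Inr i)) of (x, a) \<Rightarrow> \<lambda>p\<in>J <+> I. case_sum x a p) = z"
  proof
    fix z assume "z \<in> vectors (J <+> I) A"
    then have z: "z \<in> extensional (J <+> I)" by (auto simp: vectors_def PiE_def)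
    have "(\<lambda>p\<in>J <+> I. case_sum (\<lambda>j\<in>J. z (Inl j)) (\<lambda>i\<in>I. z (Inr i)) p) = z"
      by (rule extensionalityI[OF restrict_extensional z]) auto
    then show "(case (\<lambda>j\<in>J. z (Inl j), \<lambda>i\<in>I. z (Inr i)) of (x, a) \<Rightarrow> \<lambda>p\<in>J <+> I. case_sum x a p) = z"
      by simp
  qed
  show "\<forall>v\<in>vectors J A \<times> vectors I A.
      (\<lambda>j\<in>J. (case v of (x, a) \<Rightarrow> \<lambda>p\<in>J <+> I. case_sum x a p) (Inl j),
       \<lambda>i\<in>I. (case v of (x, a) \<Rightarrow> \<lambda>p\<in>J <+> I. case_sum x a p) (Inr i)) = v"
  proof
    fix v assume "v \<in> vectors J A \<times> vectors I A"
    then obtain x a where v: "v = (x, a)" and xa: "x \<in> extensional J" "a \<in> extensional I"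
      by (auto simp: vectors_def PiE_def)
    have "(\<lambda>j\<in>J. (\<lambda>p\<in>J <+> I. case_sum x a p) (Inl j)) = x"
      by (rule extensionalityI[OF restrict_extensional xa(1)]) auto
    moreover have "(\<lambda>i\<in>I. (\<lambda>p\<in>J <+> I. case_sum x a p) (Inr i)) = a"
      by (rule extensionalityI[OF restrict_extensional xa(2)]) auto
    ultimately show "(\<lambda>j\<in>J. (case v of (x, a) \<Rightarrow> \<lambda>p\<in>J <+> I. case_sum x a p) (Inl j),
       \<lambda>i\<in>I. (case v of (x, a) \<Rightarrow> \<lambda>p\<in>J <+> I. case_sum x a p) (Inr i)) = v"
      by (simp add: v)
  qed
  show "(\<lambda>z. (\<lambda>j\<in>J. z (Inl j), \<lambda>i\<in>I. z (Inr i))) ` vectors (J <+> I) A \<subseteq> vectors J A \<times> vectors I A"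
    by (rule image_subsetI, rule SigmaI) (rule sum_vector_parts, assumption)+
  show "(\<lambda>(x, a). \<lambda>p\<in>J <+> I. case_sum x a p) ` (vectors J A \<times> vectors I A) \<subseteq> vectors (J <+> I) A"
  proof (rule image_subsetI)
    fix v assume "v \<in> vectors J A \<times> vectors I A"
    then obtain x a where v: "v = (x, a)" and xa: "x \<in> vectors J A" "a \<in> vectors I A" by (rule SigmaE)
    have "case_sum x a p \<in> carrier A" if "p \<in> J <+> I" for p
      using that by (rule PlusE) (simp_all add: xa[THEN vectors_mem])
    then show "(case v of (x, a) \<Rightarrow> \<lambda>p\<in>J <+> I. case_sum x a p) \<in> vectors (J <+> I) A"
      unfolding vectors_def v prod.case by (rule restrict_PiE_iff[THEN iffD2, OF ballI])
  qed
qed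

context coordinate_form begin

definition hull_form :: "('j + 'i \<Rightarrow> 'b) \<Rightarrow> ('j + 'i \<Rightarrow> 'b) \<Rightarrow> 'k \<Rightarrow> 'b" where
  "hull_form z' z k = B (\<lambda>i\<in>I. z' (Inr i)) (\<lambda>j\<in>J. z (Inl j)) k \<ominus>\<^bsub>A\<^esub> B (\<lambda>i\<in>I. z (Inr i)) (\<lambda>j\<in>J. z' (Inl j)) k"

text \<open>
  Over the direct sum, coordinate vectors are indexed by a disjoint union, with the left
  summand for the vector part and the right one for the parameter part.
\<close>

lemma coordinate_form_hull:
  "coordinate_form R (alternating_hull \<theta>)
     (J <+> I) (case_sum (\<lambda>j. (bv j, \<zero>\<^bsub>rep_par \<theta>\<^esub>)) (\<lambda>i. (\<zero>\<^bsub>rep_dom \<theta>\<^esub>, bm i)))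
       (case_sum (\<lambda>j p. \<kappa>v j (fst p)) (\<lambda>i p. \<kappa>m i (snd p)))
     (J <+> I) (case_sum (\<lambda>j. (bv j, \<zero>\<^bsub>rep_par \<theta>\<^esub>)) (\<lambda>i. (\<zero>\<^bsub>rep_dom \<theta>\<^esub>, bm i)))
       (case_sum (\<lambda>j p. \<kappa>v j (fst p)) (\<lambda>i p. \<kappa>m i (snd p)))
     K bw \<kappa>w A \<phi> hull_form"
proof -
  let ?b = "case_sum (\<lambda>j. (bv j, \<zero>\<^bsub>rep_par \<theta>\<^esub>)) (\<lambda>i. (\<zero>\<^bsub>rep_dom \<theta>\<^esub>, bm i))"
  let ?k = "case_sum (\<lambda>j p. \<kappa>v j (fst p)) (\<lambda>i p. \<kappa>m i (snd p))"
  have diff4: "(a \<ominus>\<^bsub>A\<^esub> b) \<ominus>\<^bsub>A\<^esub> (c \<ominus>\<^bsub>A\<^esub> d) = (a \<ominus>\<^bsub>A\<^esub> c) \<ominus>\<^bsub>A\<^esub> (b \<ominus>\<^bsub>A\<^esub> d)"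
    if "a \<in> carrier A" "b \<in> carrier A" "c \<in> carrier A" "d \<in> carrier A" for a b c d
    using that by (simp add: M.A.minus_eq M.A.minus_add M.A.a_ac)
  have S: "based_module R (direct_sum_module (rep_dom \<theta>) (rep_par \<theta>)) (J <+> I) ?b ?k"
    by (rule direct_sum_based_module[OF V.based_module_axioms M.based_module_axioms])
  have \<phi>: "ring_hom_cring R A \<phi>"
    by (intro ring_hom_cring.intro ring_hom_cring_axioms.intro M.R.is_cring M.A.is_cring M.\<phi>.homh)
  have restrD: "(\<lambda>i\<in>I. (\<lambda>p\<in>J <+> I. z p \<ominus>\<^bsub>A\<^esub> z' p) (Inr i)) = (\<lambda>i\<in>I. (\<lambda>i\<in>I. z (Inr i)) i \<ominus>\<^bsub>A\<^esub> (\<lambda>i\<in>I. z' (Inr i)) i)"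
    "(\<lambda>j\<in>J. (\<lambda>p\<in>J <+> I. z p \<ominus>\<^bsub>A\<^esub> z' p) (Inl j)) = (\<lambda>j\<in>J. (\<lambda>j\<in>J. z (Inl j)) j \<ominus>\<^bsub>A\<^esub> (\<lambda>j\<in>J. z' (Inl j)) j)"
    for z z' by (auto intro!: restrict_ext)
  show ?thesis
  proof (intro coordinate_form.intro coordinate_form_axioms.intro based_extensionI M.A.is_cring \<phi>; (unfold alternating_hull_simps)?)
    show "based_module R (direct_sum_module (rep_dom \<theta>) (rep_par \<theta>)) (J <+> I) ?b ?k" by (rule S)
    show "based_module R (direct_sum_module (rep_dom \<theta>) (rep_par \<theta>)) (J <+> I) ?b ?k" by (rule S)
    show "based_module R (rep_cod \<theta>) K bw \<kappa>w" by (rule W.based_module_axioms)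
    show "rep_map (alternating_hull \<theta>) p' p \<in> carrier (rep_cod \<theta>)"
      if "p' \<in> carrier (direct_sum_module (rep_dom \<theta>) (rep_par \<theta>))" "p \<in> carrier (direct_sum_module (rep_dom \<theta>) (rep_par \<theta>))" for p' p
      using that by (auto simp: alternating_hull_map map_closed)
    show "hull_form z' z k \<in> carrier A"
      if "z' \<in> vectors (J <+> I) A" "z \<in> vectors (J <+> I) A" "k \<in> K" for z' z k
      unfolding hull_form_def using that by (intro M.A.minus_closed B_closed sum_vector_parts)
    show "hull_form (\<lambda>p\<in>J <+> I. z p \<ominus>\<^bsub>A\<^esub> z' p) y k = hull_form z y k \<ominus>\<^bsub>A\<^esub> hull_form z' y k"
      if "z \<in> vectors (J <+> I) A" "z' \<in> vectors (J <+> I) A" "y \<in> vectors (J <+> I) A" "k \<in> K" for z z' y k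
      unfolding hull_form_def restrD
      using sum_vector_parts[OF that(1)] sum_vector_parts[OF that(2)] sum_vector_parts[OF that(3)] that(4)
      by (simp only: B_diff_left B_diff_right) (rule diff4; rule B_closed; assumption)
    show "hull_form y (\<lambda>p\<in>J <+> I. z p \<ominus>\<^bsub>A\<^esub> z' p) k = hull_form y z k \<ominus>\<^bsub>A\<^esub> hull_form y z' k"
      if "y \<in> vectors (J <+> I) A" "z \<in> vectors (J <+> I) A" "z' \<in> vectors (J <+> I) A" "k \<in> K" for z z' y k
      unfolding hull_form_def restrD
      using sum_vector_parts[OF that(1)] sum_vector_parts[OF that(2)] sum_vector_parts[OF that(3)] that(4)
      by (simp only: B_diff_left B_diff_right) (rule diff4; rule B_closed; assumption)
    fix p' p \<alpha> \<beta> k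
    assume p': "p' \<in> carrier (direct_sum_module (rep_dom \<theta>) (rep_par \<theta>))"
      and p: "p \<in> carrier (direct_sum_module (rep_dom \<theta>) (rep_par \<theta>))"
      and \<alpha>: "\<alpha> \<in> carrier A" and \<beta>: "\<beta> \<in> carrier A" and k: "k \<in> K"
    obtain x' a' where p'_eq: "p' = (x', a')" "x' \<in> carrier (rep_dom \<theta>)" "a' \<in> carrier (rep_par \<theta>)" using p' by auto
    obtain x a where p_eq: "p = (x, a)" "x \<in> carrier (rep_dom \<theta>)" "a \<in> carrier (rep_par \<theta>)" using p by auto
    let ?y1 = "rep_map \<theta> a' x" and ?y2 = "rep_map \<theta> a x'"
    have y: "?y1 \<in> carrier (rep_cod \<theta>)" "?y2 \<in> carrier (rep_cod \<theta>)" using p_eq p'_eq map_closed by auto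
    note lin = linear_functional_simps[OF W.coord_linear[OF k]]
    have "\<kappa>w k ?y1 = \<kappa>w k (?y1 \<ominus>\<^bsub>rep_cod \<theta>\<^esub> ?y2) \<oplus> \<kappa>w k ?y2"
      using lin(2)[of "?y1 \<ominus>\<^bsub>rep_cod \<theta>\<^esub> ?y2" ?y2] y by (simp add: W.M.minus_eq W.M.a_assoc W.M.l_neg)
    then have "\<kappa>w k (?y1 \<ominus>\<^bsub>rep_cod \<theta>\<^esub> ?y2) = \<kappa>w k ?y1 \<ominus> \<kappa>w k ?y2"
      using lin(1) y by (simp add: M.R.minus_eq M.R.a_assoc M.R.r_neg)
    then have kd: "\<phi> (\<kappa>w k (?y1 \<ominus>\<^bsub>rep_cod \<theta>\<^esub> ?y2)) = \<phi> (\<kappa>w k ?y1) \<ominus>\<^bsub>A\<^esub> \<phi> (\<kappa>w k ?y2)"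
      using lin(1) y by (simp add: M.R.minus_eq M.A.minus_eq)
    have v: "(\<lambda>i\<in>I. (\<lambda>s\<in>J <+> I. \<phi> (?k s (x'', a'')) \<otimes>\<^bsub>A\<^esub> \<gamma>) (Inr i)) = (\<lambda>i\<in>I. \<phi> (\<kappa>m i a'') \<otimes>\<^bsub>A\<^esub> \<gamma>)"
      "(\<lambda>j\<in>J. (\<lambda>s\<in>J <+> I. \<phi> (?k s (x'', a'')) \<otimes>\<^bsub>A\<^esub> \<gamma>) (Inl j)) = (\<lambda>j\<in>J. \<phi> (\<kappa>v j x'') \<otimes>\<^bsub>A\<^esub> \<gamma>)"
      for x'' a'' \<gamma> by (auto intro!: restrict_ext)
    show "hull_form (\<lambda>s\<in>J <+> I. \<phi> (?k s p') \<otimes>\<^bsub>A\<^esub> \<alpha>) (\<lambda>s\<in>J <+> I. \<phi> (?k s p) \<otimes>\<^bsub>A\<^esub> \<beta>) k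
        = \<phi> (\<kappa>w k (rep_map (alternating_hull \<theta>) p' p)) \<otimes>\<^bsub>A\<^esub> (\<alpha> \<otimes>\<^bsub>A\<^esub> \<beta>)"
      unfolding hull_form_def p'_eq(1) p_eq(1) v alternating_hull_map[OF p'_eq(2,3) p_eq(2,3)] kd
      using p_eq p'_eq \<alpha> \<beta> k lin(1) y
      by (simp add: B_pure M.A.m_comm[of \<beta> \<alpha>] M.A.minus_eq M.A.l_distr M.A.l_minus)
  qed
qed

lemma ask_extend_hull:
  "ask 1 (extend_rep R A \<phi> (alternating_hull \<theta>)) =
     of_nat (card {((x', y'), (x, y)). x' \<in> vectors J A \<and> y' \<in> vectors I A \<and> x \<in> vectors J A \<and> y \<in> vectors I A \<and>
        (\<forall>k\<in>K. B y' x k \<ominus>\<^bsub>A\<^esub> B y x' k = \<zero>\<^bsub>A\<^esub>)}) / of_nat (card (carrier A)) ^ (card J + card I)"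
  if fin: "finite (carrier A)"
proof -
  let ?Z = "vectors (J <+> I) A" and ?X = "vectors J A" and ?Y = "vectors I A"
  interpret H: coordinate_form R "alternating_hull \<theta>"
     "J <+> I" "case_sum (\<lambda>j. (bv j, \<zero>\<^bsub>rep_par \<theta>\<^esub>)) (\<lambda>i. (\<zero>\<^bsub>rep_dom \<theta>\<^esub>, bm i))"
       "case_sum (\<lambda>j p. \<kappa>v j (fst p)) (\<lambda>i p. \<kappa>m i (snd p))"
     "J <+> I" "case_sum (\<lambda>j. (bv j, \<zero>\<^bsub>rep_par \<theta>\<^esub>)) (\<lambda>i. (\<zero>\<^bsub>rep_dom \<theta>\<^esub>, bm i))"
       "case_sum (\<lambda>j p. \<kappa>v j (fst p)) (\<lambda>i p. \<kappa>m i (snd p))"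
     K bw \<kappa>w A \<phi> hull_form
    by (rule coordinate_form_hull)
  have finZ: "finite ?Z" using M.finite_index V.finite_index fin by (intro finite_vectors) auto
  let ?f = "\<lambda>z. (\<lambda>j\<in>J. z (Inl j), \<lambda>i\<in>I. z (Inr i))"
  let ?P = "\<lambda>((x', y'), (x, y)). \<forall>k\<in>K. B y' x k \<ominus>\<^bsub>A\<^esub> B y x' k = \<zero>\<^bsub>A\<^esub>"
  have bb: "bij_betw (map_prod ?f ?f) (?Z \<times> ?Z) ((?X \<times> ?Y) \<times> (?X \<times> ?Y))"
    by (rule bij_betw_map_prod[OF sum_vector_bij sum_vector_bij])
  have "card {((x', y'), (x, y)). x' \<in> ?X \<and> y' \<in> ?Y \<and> x \<in> ?X \<and> y \<in> ?Y \<and> (\<forall>k\<in>K. B y' x k \<ominus>\<^bsub>A\<^esub> B y x' k = \<zero>\<^bsub>A\<^esub>)}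
      = card {w \<in> (?X \<times> ?Y) \<times> (?X \<times> ?Y). ?P w}"
    by (rule arg_cong[where f = card]) auto
  also have "\<dots> = card {v \<in> ?Z \<times> ?Z. \<forall>k\<in>K. hull_form (fst v) (snd v) k = \<zero>\<^bsub>A\<^esub>}"
    by (rule card_filter_bij[OF bb, symmetric]) (simp add: hull_form_def split_beta)
  also have "{v \<in> ?Z \<times> ?Z. \<forall>k\<in>K. hull_form (fst v) (snd v) k = \<zero>\<^bsub>A\<^esub>}
     = (SIGMA z':?Z. {z \<in> ?Z. \<forall>k\<in>K. hull_form z' z k = \<zero>\<^bsub>A\<^esub>})" by auto
  also have "card \<dots> = (\<Sum>z'\<in>?Z. card {z \<in> ?Z. \<forall>k\<in>K. hull_form z' z k = \<zero>\<^bsub>A\<^esub>})"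
    by (rule card_SigmaI) (use finZ in auto)
  finally show ?thesis
    by (simp add: H.ask_extend_rep card_Plus M.finite_index V.finite_index)
qed

end

section \<open>Class numbers\<close>

text \<open>
  Burnside's lemma for the conjugation action: the points fixed by \<open>g\<close> are the elements that
  commute with \<open>g\<close>.
\<close>

lemma class_number_commuting_pairs:
  assumes "group G" and fin: "finite (carrier G)"
  shows "class_number G * card (carrier G)
       = card {(g, h). g \<in> carrier G \<and> h \<in> carrier G \<and> g \<otimes>\<^bsub>G\<^esub> h = h \<otimes>\<^bsub>G\<^esub> g}"
proof -
  interpret group G by fact
  let ?\<phi> = "\<lambda>g. \<lambda>h\<in>carrier G. g \<otimes>\<^bsub>G\<^esub> h \<otimes>\<^bsub>G\<^esub> inv\<^bsub>G\<^esub> g"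
  interpret act: group_action G "carrier G" ?\<phi> by (rule action_by_conjugation)
  have inv_eq: "invariants (carrier G) ?\<phi> g = {h \<in> carrier G. g \<otimes>\<^bsub>G\<^esub> h = h \<otimes>\<^bsub>G\<^esub> g}"
    if g: "g \<in> carrier G" for g
    unfolding invariants_def using g inv_solve_right'[of _ _ g] by auto
  have "class_number G * card (carrier G) = (\<Sum>g\<in>carrier G. card (invariants (carrier G) ?\<phi> g))"
    using act.burnside[OF fin fin] by (simp add: class_number_def order_def)
  also have "\<dots> = (\<Sum>g\<in>carrier G. card {h \<in> carrier G. g \<otimes>\<^bsub>G\<^esub> h = h \<otimes>\<^bsub>G\<^esub> g})"
    by (intro sum.cong refl) (simp add: inv_eq)
  also have "\<dots> = card (SIGMA g:carrier G. {h \<in> carrier G. g \<otimes>\<^bsub>G\<^esub> h = h \<otimes>\<^bsub>G\<^esub> g})"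
    by (rule card_SigmaI[symmetric]) (use fin in auto)
  also have "(SIGMA g:carrier G. {h \<in> carrier G. g \<otimes>\<^bsub>G\<^esub> h = h \<otimes>\<^bsub>G\<^esub> g})
      = {(g, h). g \<in> carrier G \<and> h \<in> carrier G \<and> g \<otimes>\<^bsub>G\<^esub> h = h \<otimes>\<^bsub>G\<^esub> g}" by auto
  finally show ?thesis .
qed

text \<open>
  Biadditivity is what makes the associated semidirect product a group.
\<close>

locale biadditive_rep =
  M: abelian_group "rep_par \<theta>" + V: abelian_group "rep_dom \<theta>" + W: abelian_group "rep_cod \<theta>"
  for \<theta> :: "('a, 'm, 'v, 'w) module_rep" +
  assumes map_closed: "\<And>a x. a \<in> carrier (rep_par \<theta>) \<Longrightarrow> x \<in> carrier (rep_dom \<theta>) \<Longrightarrow> rep_map \<theta> a x \<in> carrier (rep_cod \<theta>)"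
    and map_add_left: "\<And>a a' x. a \<in> carrier (rep_par \<theta>) \<Longrightarrow> a' \<in> carrier (rep_par \<theta>) \<Longrightarrow> x \<in> carrier (rep_dom \<theta>) \<Longrightarrow>
        rep_map \<theta> (a \<oplus>\<^bsub>rep_par \<theta>\<^esub> a') x = rep_map \<theta> a x \<oplus>\<^bsub>rep_cod \<theta>\<^esub> rep_map \<theta> a' x"
    and map_add_right: "\<And>a x x'. a \<in> carrier (rep_par \<theta>) \<Longrightarrow> x \<in> carrier (rep_dom \<theta>) \<Longrightarrow> x' \<in> carrier (rep_dom \<theta>) \<Longrightarrow>
        rep_map \<theta> a (x \<oplus>\<^bsub>rep_dom \<theta>\<^esub> x') = rep_map \<theta> a x \<oplus>\<^bsub>rep_cod \<theta>\<^esub> rep_map \<theta> a x'"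
begin

lemma rep_group_carrier:
  "carrier (rep_group \<theta>) = carrier (rep_par \<theta>) \<times> carrier (rep_dom \<theta>) \<times> carrier (rep_cod \<theta>)"
  by (simp add: rep_group_def semidirect_product_def)

lemma rep_group_mult:
  "(a, x, y) \<otimes>\<^bsub>rep_group \<theta>\<^esub> (a', x', y')
    = (a \<oplus>\<^bsub>rep_par \<theta>\<^esub> a', x \<oplus>\<^bsub>rep_dom \<theta>\<^esub> x', (rep_map \<theta> a' x \<oplus>\<^bsub>rep_cod \<theta>\<^esub> y) \<oplus>\<^bsub>rep_cod \<theta>\<^esub> y')"
  by (simp add: rep_group_def semidirect_product_def)

lemma rep_group_one: "\<one>\<^bsub>rep_group \<theta>\<^esub> = (\<zero>\<^bsub>rep_par \<theta>\<^esub>, \<zero>\<^bsub>rep_dom \<theta>\<^esub>, \<zero>\<^bsub>rep_cod \<theta>\<^esub>)"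
  by (simp add: rep_group_def semidirect_product_def)

lemma map_zero_right:
  assumes a: "a \<in> carrier (rep_par \<theta>)"
  shows "rep_map \<theta> a \<zero>\<^bsub>rep_dom \<theta>\<^esub> = \<zero>\<^bsub>rep_cod \<theta>\<^esub>"
proof -
  have "rep_map \<theta> a \<zero>\<^bsub>rep_dom \<theta>\<^esub> \<oplus>\<^bsub>rep_cod \<theta>\<^esub> rep_map \<theta> a \<zero>\<^bsub>rep_dom \<theta>\<^esub> = rep_map \<theta> a \<zero>\<^bsub>rep_dom \<theta>\<^esub>"
    using map_add_right[OF a V.zero_closed V.zero_closed] by simp
  then show ?thesis using map_closed[OF a V.zero_closed] W.add.r_cancel_one' by simp
qed

lemma rep_group_group: "group (rep_group \<theta>)"
proof (rule groupI)
  show "\<one>\<^bsub>rep_group \<theta>\<^esub> \<in> carrier (rep_group \<theta>)" by (simp add: rep_group_carrier rep_group_one)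
  fix g assume "g \<in> carrier (rep_group \<theta>)"
  then obtain a x y where g: "g = (a, x, y)" and c: "a \<in> carrier (rep_par \<theta>)" "x \<in> carrier (rep_dom \<theta>)" "y \<in> carrier (rep_cod \<theta>)"
    unfolding rep_group_carrier by auto
  show "\<one>\<^bsub>rep_group \<theta>\<^esub> \<otimes>\<^bsub>rep_group \<theta>\<^esub> g = g"
    using c by (simp add: g rep_group_one rep_group_mult map_zero_right)
  let ?z = "rep_map \<theta> a (\<ominus>\<^bsub>rep_dom \<theta>\<^esub> x)"
  have z: "?z \<in> carrier (rep_cod \<theta>)" using c map_closed by simp
  have "(?z \<oplus>\<^bsub>rep_cod \<theta>\<^esub> (\<ominus>\<^bsub>rep_cod \<theta>\<^esub> ?z \<oplus>\<^bsub>rep_cod \<theta>\<^esub> \<ominus>\<^bsub>rep_cod \<theta>\<^esub> y)) \<oplus>\<^bsub>rep_cod \<theta>\<^esub> y = \<zero>\<^bsub>rep_cod \<theta>\<^esub>"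
    using z c by (simp add: W.r_neg2 W.l_neg)
  then show "\<exists>h\<in>carrier (rep_group \<theta>). h \<otimes>\<^bsub>rep_group \<theta>\<^esub> g = \<one>\<^bsub>rep_group \<theta>\<^esub>"
    using c z
    by (intro bexI[of _ "(\<ominus>\<^bsub>rep_par \<theta>\<^esub> a, \<ominus>\<^bsub>rep_dom \<theta>\<^esub> x, \<ominus>\<^bsub>rep_cod \<theta>\<^esub> ?z \<oplus>\<^bsub>rep_cod \<theta>\<^esub> \<ominus>\<^bsub>rep_cod \<theta>\<^esub> y)"])
      (simp_all add: g rep_group_one rep_group_mult rep_group_carrier M.l_neg V.l_neg)
  fix h assume "h \<in> carrier (rep_group \<theta>)"
  then obtain a' x' y' where h: "h = (a', x', y')" and c': "a' \<in> carrier (rep_par \<theta>)" "x' \<in> carrier (rep_dom \<theta>)" "y' \<in> carrier (rep_cod \<theta>)"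
    unfolding rep_group_carrier by auto
  show "g \<otimes>\<^bsub>rep_group \<theta>\<^esub> h \<in> carrier (rep_group \<theta>)"
    using c c' by (simp add: g h rep_group_mult rep_group_carrier map_closed)
  fix k assume "k \<in> carrier (rep_group \<theta>)"
  then obtain b u v where k: "k = (b, u, v)" and b: "b \<in> carrier (rep_par \<theta>)" "u \<in> carrier (rep_dom \<theta>)" "v \<in> carrier (rep_cod \<theta>)"
    unfolding rep_group_carrier by auto
  show "g \<otimes>\<^bsub>rep_group \<theta>\<^esub> h \<otimes>\<^bsub>rep_group \<theta>\<^esub> k = g \<otimes>\<^bsub>rep_group \<theta>\<^esub> (h \<otimes>\<^bsub>rep_group \<theta>\<^esub> k)"
    using c c' b
    by (simp add: g h k rep_group_mult map_closed map_add_left map_add_right M.a_assoc V.a_assoc W.a_ac)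
qed

text \<open>
  The two products differ only in the last component, by \<open>rep_map \<theta> a' x\<close> against
  \<open>rep_map \<theta> a x'\<close>.
\<close>

lemma rep_group_commute_iff:
  assumes c: "a \<in> carrier (rep_par \<theta>)" "x \<in> carrier (rep_dom \<theta>)" "y \<in> carrier (rep_cod \<theta>)"
    and c': "a' \<in> carrier (rep_par \<theta>)" "x' \<in> carrier (rep_dom \<theta>)" "y' \<in> carrier (rep_cod \<theta>)"
  shows "(a, x, y) \<otimes>\<^bsub>rep_group \<theta>\<^esub> (a', x', y') = (a', x', y') \<otimes>\<^bsub>rep_group \<theta>\<^esub> (a, x, y)
    \<longleftrightarrow> rep_map \<theta> a' x = rep_map \<theta> a x'"
proof -
  let ?u = "rep_map \<theta> a' x" and ?v = "rep_map \<theta> a x'" and ?s = "y \<oplus>\<^bsub>rep_cod \<theta>\<^esub> y'"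
  have uv: "?u \<in> carrier (rep_cod \<theta>)" "?v \<in> carrier (rep_cod \<theta>)" using c c' map_closed by auto
  have "(?u \<oplus>\<^bsub>rep_cod \<theta>\<^esub> y) \<oplus>\<^bsub>rep_cod \<theta>\<^esub> y' = ?u \<oplus>\<^bsub>rep_cod \<theta>\<^esub> ?s"
    using uv c c' by (simp add: W.a_assoc)
  moreover have "(?v \<oplus>\<^bsub>rep_cod \<theta>\<^esub> y') \<oplus>\<^bsub>rep_cod \<theta>\<^esub> y = ?v \<oplus>\<^bsub>rep_cod \<theta>\<^esub> ?s"
    using uv c c' by (simp add: W.a_ac)
  moreover have "?u \<oplus>\<^bsub>rep_cod \<theta>\<^esub> ?s = ?v \<oplus>\<^bsub>rep_cod \<theta>\<^esub> ?s \<longleftrightarrow> ?u = ?v"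
    using uv c c' by simp
  ultimately show ?thesis
    using c c' by (simp add: rep_group_mult M.a_comm[of a a'] V.a_comm[of x x'])
qed

text \<open>
  The last components of a commuting pair are arbitrary, which gives the square of the size
  of \<open>rep_cod \<theta>\<close>; one factor cancels against the order of the group.
\<close>

lemma class_number_rep_group:
  assumes fin: "finite (carrier (rep_par \<theta>))" "finite (carrier (rep_dom \<theta>))" "finite (carrier (rep_cod \<theta>))"
  shows "class_number (rep_group \<theta>) * (card (carrier (rep_par \<theta>)) * card (carrier (rep_dom \<theta>)))
    = card (carrier (rep_cod \<theta>)) *
      card {((x', a'), (x, a)). x' \<in> carrier (rep_dom \<theta>) \<and> a' \<in> carrier (rep_par \<theta>) \<and> x \<in> carrier (rep_dom \<theta>) \<and>
        a \<in> carrier (rep_par \<theta>) \<and> rep_map \<theta> a' x = rep_map \<theta> a x'}"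
proof -
  let ?M = "carrier (rep_par \<theta>)" and ?V = "carrier (rep_dom \<theta>)" and ?W = "carrier (rep_cod \<theta>)"
  let ?G = "carrier (rep_group \<theta>)"
  let ?C = "{((x', a'), (x, a)). x' \<in> ?V \<and> a' \<in> ?M \<and> x \<in> ?V \<and> a \<in> ?M \<and> rep_map \<theta> a' x = rep_map \<theta> a x'}"
  have "class_number (rep_group \<theta>) * card ?G
      = card {(g, h). g \<in> ?G \<and> h \<in> ?G \<and> g \<otimes>\<^bsub>rep_group \<theta>\<^esub> h = h \<otimes>\<^bsub>rep_group \<theta>\<^esub> g}"
    by (rule class_number_commuting_pairs[OF rep_group_group]) (simp add: rep_group_carrier fin)
  also have "\<dots> = card (?W \<times> ?W \<times> ?C)"
  proof (rule bij_betw_same_card)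
    show "bij_betw (\<lambda>((a, x, y), (a', x', y')). (y, y', ((x', a'), (x, a))))
      {(g, h). g \<in> ?G \<and> h \<in> ?G \<and> g \<otimes>\<^bsub>rep_group \<theta>\<^esub> h = h \<otimes>\<^bsub>rep_group \<theta>\<^esub> g} (?W \<times> ?W \<times> ?C)"
      by (rule bij_betw_byWitness[where f' = "\<lambda>(y, y', ((x', a'), (x, a))). ((a, x, y), (a', x', y'))"])
        (auto simp: rep_group_carrier rep_group_commute_iff)
  qed
  also have "\<dots> = card ?W * (card ?W * card ?C)" by (simp add: card_cartesian_product)
  finally have "(class_number (rep_group \<theta>) * (card ?M * card ?V)) * card ?W = (card ?W * card ?C) * card ?W"
    by (simp add: rep_group_carrier card_cartesian_product ac_simps)
  moreover have "card ?W \<noteq> 0" using fin(3) W.zero_closed by auto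
  ultimately show ?thesis by simp
qed

end

section \<open>The two identities over a finite quotient\<close>

context coordinate_form begin

text \<open>
  Compatibility of \<open>B\<close> with the difference \<open>(\<mu> + \<mu>') - \<mu>'\<close> yields additivity.
\<close>

lemma extend_rep_biadditive: "biadditive_rep \<theta>A"
proof -
  interpret MA: abelian_group M.UA by (rule M.extend_abelian_group)
  interpret VA: abelian_group V.UA by (rule V.extend_abelian_group)
  interpret WA: abelian_group W.UA by (rule W.extend_abelian_group)
  have add_of_diff: "c = a \<oplus>\<^bsub>A\<^esub> b" if "a = c \<ominus>\<^bsub>A\<^esub> b" "b \<in> carrier A" "c \<in> carrier A" for a b c
    using that by (simp add: M.A.minus_eq M.A.a_assoc M.A.l_neg)
  have diff_of_add: "(a \<oplus>\<^bsub>A\<^esub> b) \<ominus>\<^bsub>A\<^esub> b = a" if "a \<in> carrier A" "b \<in> carrier A" for a b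
    using that by (simp add: M.A.minus_eq M.A.a_assoc M.A.r_neg)
  show ?thesis
  proof (intro biadditive_rep.intro biadditive_rep_axioms.intro; (unfold extend_rep_simps)?)
    show "abelian_group M.UA" "abelian_group V.UA" "abelian_group W.UA"
      by (rule MA.abelian_group_axioms VA.abelian_group_axioms WA.abelian_group_axioms)+
  next
    fix \<mu> \<xi> assume \<mu>: "\<mu> \<in> carrier M.UA" and \<xi>: "\<xi> \<in> carrier V.UA"
    show "rep_map \<theta>A \<mu> \<xi> \<in> carrier W.UA" by (rule extend_rep_map(1)[OF \<mu> \<xi>])
  next
    fix \<mu> \<mu>' \<xi> assume \<mu>: "\<mu> \<in> carrier M.UA" and \<mu>': "\<mu>' \<in> carrier M.UA" and \<xi>: "\<xi> \<in> carrier V.UA"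
    have s: "\<mu> \<oplus>\<^bsub>M.UA\<^esub> \<mu>' \<in> carrier M.UA" using \<mu> \<mu>' by simp
    have "(\<lambda>i\<in>I. M.vcoord (\<mu> \<oplus>\<^bsub>M.UA\<^esub> \<mu>') i \<ominus>\<^bsub>A\<^esub> M.vcoord \<mu>' i) = M.vcoord \<mu>"
      using M.vcoord_closed[OF \<mu>] M.vcoord_closed[OF \<mu>']
      by (intro extensionalityI[OF restrict_extensional])
        (auto simp: vectors_def PiE_iff M.vcoord_add[OF \<mu> \<mu>'] diff_of_add)
    then have "B (M.vcoord \<mu>) (V.vcoord \<xi>) k
        = B (M.vcoord (\<mu> \<oplus>\<^bsub>M.UA\<^esub> \<mu>')) (V.vcoord \<xi>) k \<ominus>\<^bsub>A\<^esub> B (M.vcoord \<mu>') (V.vcoord \<xi>) k" if "k \<in> K" for k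
      using B_diff_left[OF M.vcoord_closed[OF s] M.vcoord_closed[OF \<mu>'] V.vcoord_closed[OF \<xi>] that] by simp
    then have "B (M.vcoord (\<mu> \<oplus>\<^bsub>M.UA\<^esub> \<mu>')) (V.vcoord \<xi>) k
        = B (M.vcoord \<mu>) (V.vcoord \<xi>) k \<oplus>\<^bsub>A\<^esub> B (M.vcoord \<mu>') (V.vcoord \<xi>) k" if "k \<in> K" for k
      using that by (intro add_of_diff B_closed M.vcoord_closed V.vcoord_closed \<mu>' s \<xi>)
    then show "rep_map \<theta>A (\<mu> \<oplus>\<^bsub>M.UA\<^esub> \<mu>') \<xi> = rep_map \<theta>A \<mu> \<xi> \<oplus>\<^bsub>W.UA\<^esub> rep_map \<theta>A \<mu>' \<xi>"
      by (intro W.vcoord_inj WA.a_closed)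
        (simp_all add: extend_rep_map s \<mu> \<mu>' \<xi> W.vcoord_add)
  next
    fix \<mu> \<xi> \<xi>' assume \<mu>: "\<mu> \<in> carrier M.UA" and \<xi>: "\<xi> \<in> carrier V.UA" and \<xi>': "\<xi>' \<in> carrier V.UA"
    have s: "\<xi> \<oplus>\<^bsub>V.UA\<^esub> \<xi>' \<in> carrier V.UA" using \<xi> \<xi>' by simp
    have "(\<lambda>i\<in>J. V.vcoord (\<xi> \<oplus>\<^bsub>V.UA\<^esub> \<xi>') i \<ominus>\<^bsub>A\<^esub> V.vcoord \<xi>' i) = V.vcoord \<xi>"
      using V.vcoord_closed[OF \<xi>] V.vcoord_closed[OF \<xi>']
      by (intro extensionalityI[OF restrict_extensional])
        (auto simp: vectors_def PiE_iff V.vcoord_add[OF \<xi> \<xi>'] diff_of_add)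
    then have "B (M.vcoord \<mu>) (V.vcoord \<xi>) k
        = B (M.vcoord \<mu>) (V.vcoord (\<xi> \<oplus>\<^bsub>V.UA\<^esub> \<xi>')) k \<ominus>\<^bsub>A\<^esub> B (M.vcoord \<mu>) (V.vcoord \<xi>') k" if "k \<in> K" for k
      using B_diff_right[OF M.vcoord_closed[OF \<mu>] V.vcoord_closed[OF s] V.vcoord_closed[OF \<xi>'] that] by simp
    then have "B (M.vcoord \<mu>) (V.vcoord (\<xi> \<oplus>\<^bsub>V.UA\<^esub> \<xi>')) k
        = B (M.vcoord \<mu>) (V.vcoord \<xi>) k \<oplus>\<^bsub>A\<^esub> B (M.vcoord \<mu>) (V.vcoord \<xi>') k" if "k \<in> K" for k
      using that by (intro add_of_diff B_closed M.vcoord_closed V.vcoord_closed \<mu> s \<xi>')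
    then show "rep_map \<theta>A \<mu> (\<xi> \<oplus>\<^bsub>V.UA\<^esub> \<xi>') = rep_map \<theta>A \<mu> \<xi> \<oplus>\<^bsub>W.UA\<^esub> rep_map \<theta>A \<mu> \<xi>'"
      by (intro W.vcoord_inj WA.a_closed)
        (simp_all add: extend_rep_map s \<mu> \<xi> \<xi>' W.vcoord_add)
  qed
qed

lemma class_number_extend_rep:
  assumes fin: "finite (carrier A)"
  shows "class_number (rep_group \<theta>A) * (card (carrier A) ^ card I * card (carrier A) ^ card J)
    = card (carrier A) ^ card K *
      card {((x', a'), (x, a)). x' \<in> vectors J A \<and> a' \<in> vectors I A \<and> x \<in> vectors J A \<and> a \<in> vectors I A \<and>
        (\<forall>k\<in>K. B a' x k \<ominus>\<^bsub>A\<^esub> B a x' k = \<zero>\<^bsub>A\<^esub>)}"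
proof -
  interpret E: biadditive_rep \<theta>A by (rule extend_rep_biadditive)
  let ?X = "vectors J A" and ?Y = "vectors I A"
  let ?f = "map_prod (map_prod V.vcoord M.vcoord) (map_prod V.vcoord M.vcoord)"
  let ?D = "(carrier V.UA \<times> carrier M.UA) \<times> (carrier V.UA \<times> carrier M.UA)"
  let ?P = "\<lambda>((x', a'), (x, a)). \<forall>k\<in>K. B a' x k \<ominus>\<^bsub>A\<^esub> B a x' k = \<zero>\<^bsub>A\<^esub>"
  have finU: "finite (carrier M.UA)" "finite (carrier V.UA)" "finite (carrier W.UA)"
    using bij_betw_finite[OF M.vcoord_bij] bij_betw_finite[OF V.vcoord_bij] bij_betw_finite[OF W.vcoord_bij]
      finite_vectors[OF M.finite_index fin] finite_vectors[OF V.finite_index fin] finite_vectors[OF W.finite_index fin] by auto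
  have bb: "bij_betw ?f ?D ((?X \<times> ?Y) \<times> (?X \<times> ?Y))"
    by (intro bij_betw_map_prod V.vcoord_bij M.vcoord_bij)
  have eq_iff: "rep_map \<theta>A \<mu>' \<xi> = rep_map \<theta>A \<mu> \<xi>' \<longleftrightarrow> ?P (?f ((\<xi>', \<mu>'), (\<xi>, \<mu>)))"
    if "\<xi> \<in> carrier V.UA" "\<xi>' \<in> carrier V.UA" "\<mu> \<in> carrier M.UA" "\<mu>' \<in> carrier M.UA" for \<xi> \<xi>' \<mu> \<mu>'
  proof -
    have "rep_map \<theta>A \<mu>' \<xi> = rep_map \<theta>A \<mu> \<xi>' \<longleftrightarrow> (\<forall>k\<in>K. W.vcoord (rep_map \<theta>A \<mu>' \<xi>) k = W.vcoord (rep_map \<theta>A \<mu> \<xi>') k)"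
    proof
      assume h: "\<forall>k\<in>K. W.vcoord (rep_map \<theta>A \<mu>' \<xi>) k = W.vcoord (rep_map \<theta>A \<mu> \<xi>') k"
      show "rep_map \<theta>A \<mu>' \<xi> = rep_map \<theta>A \<mu> \<xi>'"
        by (rule W.vcoord_inj[OF extend_rep_map(1)[OF that(4,1)] extend_rep_map(1)[OF that(3,2)] h[rule_format]])
    qed simp
    also have "\<dots> \<longleftrightarrow> (\<forall>k\<in>K. B (M.vcoord \<mu>') (V.vcoord \<xi>) k = B (M.vcoord \<mu>) (V.vcoord \<xi>') k)"
      using that by (simp add: extend_rep_map(2))
    also have "\<dots> \<longleftrightarrow> ?P (?f ((\<xi>', \<mu>'), (\<xi>, \<mu>)))"
      using that by (simp add: B_closed M.vcoord_closed V.vcoord_closed M.A.r_right_minus_eq)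
    finally show ?thesis .
  qed
  have "card {((\<xi>', \<mu>'), (\<xi>, \<mu>)). \<xi>' \<in> carrier V.UA \<and> \<mu>' \<in> carrier M.UA \<and> \<xi> \<in> carrier V.UA \<and> \<mu> \<in> carrier M.UA \<and>
       rep_map \<theta>A \<mu>' \<xi> = rep_map \<theta>A \<mu> \<xi>'} = card {w \<in> ?D. ?P (?f w)}"
    by (rule arg_cong[where f = card], rule Set.set_eqI) (auto simp: eq_iff del: equalityI)
  also have "\<dots> = card {w \<in> (?X \<times> ?Y) \<times> (?X \<times> ?Y). ?P w}"
    by (rule card_filter_bij[OF bb refl])
  also have "{w \<in> (?X \<times> ?Y) \<times> (?X \<times> ?Y). ?P w} = {((x', a'), (x, a)). x' \<in> ?X \<and> a' \<in> ?Y \<and> x \<in> ?X \<and> a \<in> ?Y \<and>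
        (\<forall>k\<in>K. B a' x k \<ominus>\<^bsub>A\<^esub> B a x' k = \<zero>\<^bsub>A\<^esub>)}" by auto
  finally show ?thesis
    using E.class_number_rep_group finU by (simp add: M.card_extend V.card_extend W.card_extend)
qed

end

context based_rep begin

text \<open>
  With \<open>N\<close> the number of quadruples in the double count, the extension of \<open>\<theta>\<close> has
  second moment \<open>N / |A|\<^sup>2\<^sup>e\<close> and the hull has first moment \<open>N / |A|\<^sup>d\<^sup>+\<^sup>e\<close>, where \<open>d\<close> and
  \<open>e\<close> are the sizes of \<open>J\<close> and \<open>K\<close>.
\<close>

lemma ask_square_eq_ask_hull:
  assumes A: "cring A" and \<phi>: "ring_hom_cring R A \<phi>" and fin: "finite (carrier A)" and w: "ideal_detector A w"
  shows "of_nat (card (carrier A)) ^ card K * ask 2 (extend_rep R A \<phi> \<theta>)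
    = of_nat (card (carrier A)) ^ card J * ask 1 (extend_rep R A \<phi> (alternating_hull (bullet_rep R \<theta>)))"
proof -
  interpret h: ring_hom_cring R A \<phi> by fact
  let ?t = "\<lambda>i j k. \<phi> (structure_constants i j k)"
  interpret C: coordinate_form R \<theta> I bm \<kappa>m J bv \<kappa>v K bw \<kappa>w A \<phi> "contract A I J ?t"
    by (rule coordinate_form_rep[OF A \<phi>])
  interpret D: coordinate_form R "bullet_rep R \<theta>" K "\<lambda>k. \<lambda>y\<in>carrier (rep_cod \<theta>). \<kappa>w k y" "\<lambda>k \<psi>. \<psi> (bw k)" J bv \<kappa>v
    I "\<lambda>i. \<lambda>a\<in>carrier (rep_par \<theta>). \<kappa>m i a" "\<lambda>i \<psi>. \<psi> (bm i)" A \<phi> "contract A K J (transpose13 ?t)"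
    by (rule coordinate_form_bullet[OF A \<phi>])
  let ?q = "of_nat (card (carrier A)) :: rat"
  have "card (carrier A) \<noteq> 0" using fin h.S.zero_closed by auto
  then have q: "?q \<noteq> 0" by simp
  define S where "S = (\<Sum>a\<in>vectors I A. (of_nat (card {x \<in> vectors J A. \<forall>k\<in>K. contract A I J ?t a x k = \<zero>\<^bsub>A\<^esub>}) :: rat) ^ 2)"
  define N where "N = (of_nat (card {((x', y'), (x, y)). x' \<in> vectors J A \<and> y' \<in> vectors K A \<and> x \<in> vectors J A \<and> y \<in> vectors K A \<and>
        (\<forall>i\<in>I. contract A K J (transpose13 ?t) y' x i \<ominus>\<^bsub>A\<^esub> contract A K J (transpose13 ?t) y x' i = \<zero>\<^bsub>A\<^esub>)}) :: rat)"
  have SN: "?q ^ (2 * card K) * S = ?q ^ card I * N"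
    unfolding S_def N_def
    by (rule h.S.kernel_square_count[OF w fin M.finite_index V.finite_index W.finite_index])
      (simp add: structure_constants_closed)
  have a2: "ask 2 (extend_rep R A \<phi> \<theta>) = S / ?q ^ card I"
    by (simp add: C.ask_extend_rep S_def)
  have a1: "ask 1 (extend_rep R A \<phi> (alternating_hull (bullet_rep R \<theta>))) = N / ?q ^ (card J + card K)"
    unfolding D.ask_extend_hull[OF fin] N_def ..
  have "?q ^ card K * (?q ^ card K * ask 2 (extend_rep R A \<phi> \<theta>)) = N"
    using SN q unfolding a2 mult_2 power_add by (simp add: field_simps)
  then have "?q ^ card K * ask 2 (extend_rep R A \<phi> \<theta>) = N / ?q ^ card K"
    using q by (simp add: field_simps)
  also have "\<dots> = ?q ^ card J * ask 1 (extend_rep R A \<phi> (alternating_hull (bullet_rep R \<theta>)))"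
    using q unfolding a1 by (simp add: power_add)
  finally show ?thesis .
qed

text \<open>
  The quadruples that describe commuting pairs are counted by the double count for the
  transposed array, in which the first index runs over \<open>K\<close> and the third over \<open>I\<close>.
\<close>

lemma class_number_eq_ask_square:
  assumes A: "cring A" and \<phi>: "ring_hom_cring R A \<phi>" and fin: "finite (carrier A)" and w: "ideal_detector A w"
  shows "of_nat (card (carrier A)) ^ card J * of_nat (class_number (rep_group (extend_rep R A \<phi> \<theta>)))
    = of_nat (card (carrier A)) ^ (card I + card K) * ask 2 (extend_rep R A \<phi> (bullet_rep R \<theta>))"
proof -
  interpret h: ring_hom_cring R A \<phi> by fact
  let ?t = "\<lambda>i j k. \<phi> (structure_constants i j k)"
  interpret C: coordinate_form R \<theta> I bm \<kappa>m J bv \<kappa>v K bw \<kappa>w A \<phi> "contract A I J ?t"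
    by (rule coordinate_form_rep[OF A \<phi>])
  interpret D: coordinate_form R "bullet_rep R \<theta>" K "\<lambda>k. \<lambda>y\<in>carrier (rep_cod \<theta>). \<kappa>w k y" "\<lambda>k \<psi>. \<psi> (bw k)" J bv \<kappa>v
    I "\<lambda>i. \<lambda>a\<in>carrier (rep_par \<theta>). \<kappa>m i a" "\<lambda>i \<psi>. \<psi> (bm i)" A \<phi> "contract A K J (transpose13 ?t)"
    by (rule coordinate_form_bullet[OF A \<phi>])
  let ?q = "of_nat (card (carrier A)) :: rat"
  have "card (carrier A) \<noteq> 0" using fin h.S.zero_closed by auto
  then have q: "?q \<noteq> 0" by simp
  let ?k = "of_nat (class_number (rep_group (extend_rep R A \<phi> \<theta>))) :: rat"
  define S where "S = (\<Sum>y\<in>vectors K A. (of_nat (card {x \<in> vectors J A. \<forall>i\<in>I. contract A K J (transpose13 ?t) y x i = \<zero>\<^bsub>A\<^esub>}) :: rat) ^ 2)"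
  define N where "N = card {((x', a'), (x, a)). x' \<in> vectors J A \<and> a' \<in> vectors I A \<and> x \<in> vectors J A \<and> a \<in> vectors I A \<and>
        (\<forall>k\<in>K. contract A I J ?t a' x k \<ominus>\<^bsub>A\<^esub> contract A I J ?t a x' k = \<zero>\<^bsub>A\<^esub>)}"
  have tt: "transpose13 (transpose13 ?t) = ?t" by (simp add: transpose13_def)
  have SN: "?q ^ (2 * card I) * S = ?q ^ card K * of_nat N"
    unfolding S_def N_def
    by (rule h.S.kernel_square_count[OF w fin W.finite_index V.finite_index M.finite_index, of "transpose13 ?t", unfolded tt])
      (simp add: structure_constants_closed transpose13_def)
  have "class_number (rep_group (extend_rep R A \<phi> \<theta>)) * (card (carrier A) ^ card I * card (carrier A) ^ card J)
     = card (carrier A) ^ card K * N"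
    using C.class_number_extend_rep[OF fin] unfolding N_def .
  then have "of_nat (class_number (rep_group (extend_rep R A \<phi> \<theta>)) * (card (carrier A) ^ card I * card (carrier A) ^ card J))
     = (of_nat (card (carrier A) ^ card K * N) :: rat)" by (rule arg_cong)
  then have kN: "?k * (?q ^ card I * ?q ^ card J) = ?q ^ card K * of_nat N" by simp
  have a2: "ask 2 (extend_rep R A \<phi> (bullet_rep R \<theta>)) = S / ?q ^ card K"
    by (simp add: D.ask_extend_rep S_def)
  have "?q ^ card I * (?q ^ card J * ?k) = ?q ^ card I * (?q ^ card I * S)"
    using kN SN unfolding mult_2 power_add by (simp add: ac_simps)
  then have "?q ^ card J * ?k = ?q ^ card I * S" using q by simp
  also have "\<dots> = ?q ^ (card I + card K) * ask 2 (extend_rep R A \<phi> (bullet_rep R \<theta>))"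
    using q unfolding a2 by (simp add: power_add)
  finally show ?thesis .
qed

end

section \<open>Power series and Dirichlet series\<close>

theorem corollary7p11:
  fixes R :: "('a, 'x) ring_scheme"
    and \<theta> :: "('a, 'm, 'v, 'w) module_rep"
    and q l d e :: nat
  assumes "compact_dvr R"
    and "residue_card R = q"
    and "is_module_rep R \<theta>"
    and "free_of_rank R (rep_par \<theta>) l"
    and "free_of_rank R (rep_dom \<theta>) d"
    and "free_of_rank R (rep_cod \<theta>) e"
  shows "ask_series R 2 \<theta> =
           fps_compose (ask_series R 1 (alternating_hull (bullet_rep R \<theta>)))
             (fps_const (of_nat q powi (int d - int e)) * fps_X) \<and>
         class_zeta R (rep_group_functor R \<theta>) =
           dirichlet_shift (int d - int e - int l) (ask_zeta R 2 (bullet_rep R \<theta>))"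
proof -
  have dvr: "discrete_valuation_ring R" and compact: "compact_space (adic_topology R)"
    using assms(1) unfolding compact_dvr_def by auto
  obtain p where p: "uniformized_domain R p" and max: "max_ideal R = PIdl\<^bsub>R\<^esub> p"
    using discrete_valuation_ring_uniformizer[OF dvr] by (elim exE conjE)
  interpret uniformized_domain R p by (rule p)
  have fin1: "finite (carrier (R Quot P 1))" by (rule compact_imp_finite_residue_ring[OF max compact])
  have q: "q = card (carrier (R Quot P 1))" using assms(2) unfolding residue_card_def max P_1 by (rule sym)
  have q2: "q \<ge> 2" unfolding q by (rule residue_card_ge_2[OF fin1])
  have quot: "finite (carrier (R Quot P n))" "card (carrier (R Quot P n)) = q ^ n" for n
    using quotient_by_power[OF fin1, of n] unfolding q by (rule conjunct1, rule conjunct2)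
  have modules: "Module.module R (rep_par \<theta>)" "Module.module R (rep_dom \<theta>)" "Module.module R (rep_cod \<theta>)"
    using assms(3) unfolding is_module_rep_def by blast+
  obtain bm \<kappa>m where M: "based_module R (rep_par \<theta>) {..<l} bm \<kappa>m"
    using free_of_rank_imp_based_module[OF modules(1) assms(4)] by (elim exE)
  obtain bv \<kappa>v where V: "based_module R (rep_dom \<theta>) {..<d} bv \<kappa>v"
    using free_of_rank_imp_based_module[OF modules(2) assms(5)] by (elim exE)
  obtain bw \<kappa>w where W: "based_module R (rep_cod \<theta>) {..<e} bw \<kappa>w"
    using free_of_rank_imp_based_module[OF modules(3) assms(6)] by (elim exE)
  interpret B: based_rep R \<theta> "{..<l}" bm \<kappa>m "{..<d}" bv \<kappa>v "{..<e}" bw \<kappa>w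
    by (intro based_rep.intro M V W based_rep_axioms.intro assms(3))
  let ?A = "\<lambda>n. R Quot P n" and ?\<phi> = "\<lambda>n r. P n +>\<^bsub>R\<^esub> r"
  have A: "cring (?A n)" for n by (rule ideal.quotient_is_cring[OF P_ideal cring_axioms])
  have \<phi>: "ring_hom_cring R (?A n) (?\<phi> n)" for n
    by (rule ideal.rcos_ring_hom_cring[OF P_ideal cring_axioms])
  have detector: "\<exists>w. ideal_detector (?A n) w" for n
  proof -
    interpret Q: cring "?A n" by (rule A)
    obtain s where "s \<in> carrier (?A n)" "\<forall>x\<in>carrier (?A n). x \<noteq> \<zero>\<^bsub>?A n\<^esub> \<longrightarrow>
        s \<noteq> \<zero>\<^bsub>?A n\<^esub> \<and> (\<exists>c\<in>carrier (?A n). s = c \<otimes>\<^bsub>?A n\<^esub> x)"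
      using quotient_socle[of n] by (elim bexE)
    then show ?thesis by (intro Q.ideal_detector_exists[OF quot(1)]) blast+
  qed
  have ask_power: "of_nat q ^ (n * e) * ask 2 (quot_rep R (P n) \<theta>)
      = of_nat q ^ (n * d) * ask 1 (quot_rep R (P n) (alternating_hull (bullet_rep R \<theta>)))" for n
  proof -
    obtain w where "ideal_detector (?A n) w" using detector[of n] by (elim exE)
    from B.ask_square_eq_ask_hull[OF A \<phi> quot(1) this]
    show ?thesis by (simp add: quot quot_rep_def power_mult)
  qed
  have class_power: "of_nat q ^ (n * d) * of_nat (class_number (rep_group (quot_rep R (P n) \<theta>)))
      = of_nat q ^ (n * (l + e)) * ask 2 (quot_rep R (P n) (bullet_rep R \<theta>))" for n
  proof -
    obtain w where "ideal_detector (?A n) w" using detector[of n] by (elim exE)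
    from B.class_number_eq_ask_square[OF A \<phi> quot(1) this]
    show ?thesis by (simp add: quot quot_rep_def power_mult power_add power_mult_distrib)
  qed
  have q0: "(of_nat q :: rat) \<noteq> 0" using q2 by simp
  have first: "ask 2 (quot_rep R (P n) \<theta>)
      = (of_nat q powi (int d - int e)) ^ n * ask 1 (quot_rep R (P n) (alternating_hull (bullet_rep R \<theta>)))" for n
  proof -
    have pw: "(of_nat q powi (int d - int e)) ^ n = (of_nat q ^ (n * d) / of_nat q ^ (n * e) :: rat)"
      using q0 by (simp add: power_int_diff power_divide mult.commute flip: power_mult)
    show ?thesis unfolding pw using ask_power[of n] q0 by (simp add: field_simps)
  qed
  have second: "of_nat (class_number (rep_group (quot_rep R (P n) \<theta>)))
      = ask 2 (quot_rep R (P n) (bullet_rep R \<theta>)) * of_nat (q ^ n) powi (- (int d - int e - int l))" for n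
  proof -
    have pw: "of_nat (q ^ n) powi (- (int d - int e - int l)) = (of_nat q ^ (n * (l + e)) / of_nat q ^ (n * d) :: rat)"
    proof -
      have "- (int d - int e - int l) = int (l + e) - int d" by simp
      then show ?thesis using q0 by (simp only: power_int_diff) (simp add: power_int_diff power_int_add power_mult power_add)
    qed
    show ?thesis unfolding pw using class_power[of n] q0 by (simp add: field_simps)
  qed
  have P_eq: "max_ideal_power R n = P n" for n by (rule max_ideal_power_eq[OF max])
  have "ask_series R 2 \<theta> = fps_compose (ask_series R 1 (alternating_hull (bullet_rep R \<theta>)))
      (fps_const (of_nat q powi (int d - int e)) * fps_X)"
    unfolding fps_compose_linear ask_series_def P_eq by (simp add: first)
  moreover have "class_zeta R (rep_group_functor R \<theta>) N
      = dirichlet_shift (int d - int e - int l) (ask_zeta R 2 (bullet_rep R \<theta>)) N" for N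
  proof -
    have ideals: "{I. ideal I R \<and> finite (carrier (R Quot I)) \<and> card (carrier (R Quot I)) = N} = P ` {n. q ^ n = N}"
    proof (intro equalityI subsetI)
      fix I assume "I \<in> {I. ideal I R \<and> finite (carrier (R Quot I)) \<and> card (carrier (R Quot I)) = N}"
      then have I: "ideal I R" "finite (carrier (R Quot I))" "card (carrier (R Quot I)) = N" by auto
      obtain n where "I = P n" using finite_quotient_imp_power[OF fin1 I(1,2)] by (elim exE)
      then show "I \<in> P ` {n. q ^ n = N}" using I(3) quot(2) by auto
    next
      fix I assume "I \<in> P ` {n. q ^ n = N}"
      then show "I \<in> {I. ideal I R \<and> finite (carrier (R Quot I)) \<and> card (carrier (R Quot I)) = N}"
        using quot P_ideal by auto
    qed
    \<comment> \<open>At most one exponent contributes, as the residue field has at least two elements.\<close>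
    have inj: "inj_on P {n. q ^ n = N}"
    proof (rule inj_onI)
      fix m n assume "m \<in> {n. q ^ n = N}" "n \<in> {n. q ^ n = N}"
      then have "q ^ m = q ^ n" by simp
      then show "m = n" using q2 by (simp add: power_inject_exp)
    qed
    have "class_zeta R (rep_group_functor R \<theta>) N
        = (\<Sum>n | q ^ n = N. of_nat (class_number (rep_group (quot_rep R (P n) \<theta>))))"
      unfolding class_zeta_def ideals rep_group_functor_def
      by (subst sum.reindex[OF inj]) (simp add: quot_rep_def)
    also have "\<dots> = (\<Sum>n | q ^ n = N. ask 2 (quot_rep R (P n) (bullet_rep R \<theta>)) * of_nat N powi (- (int d - int e - int l)))"
      by (intro sum.cong refl) (auto simp: second)
    also have "\<dots> = dirichlet_shift (int d - int e - int l) (ask_zeta R 2 (bullet_rep R \<theta>)) N"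
      unfolding dirichlet_shift_def ask_zeta_def dirichlet_of_fps_def ask_series_def P_eq assms(2)
      by (simp add: sum_distrib_right)
    finally show ?thesis .
  qed
  ultimately show ?thesis by (intro conjI ext)
qed

end
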